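(* Let the initial data $\mathbf U(\cdot,0)\in[L^2(\Omega)]^8$ satisfy $\mathbf U(\mathbf x,0)\in\mathcal G$ for all $\mathbf x\in\Omega$, let $\mathbf U_h^0=\mathbf\Pi_h\mathbf P_w(\mathbf U(\cdot,0))$, and for $n=0,1,2,\dots$ compute $\mathbf U_h^{n+1}$ from $\mathbf U_h^n$ by $\mathbf U_h^{(0)}=\mathbf U_h^n$, $$\mathbf U_h^{(i)}=\mathbf\Pi_h\Big\{\sum_{\ell=0}^{i-1}\alpha_{i\ell}\big(\mathbf U_h^{(\ell)}+\beta_{i\ell}\Delta t_n\mathbf L_h(\mathbf U_h^{(\ell)})\big)\Big\},\quad i=1,\dots,N_r,\qquad \mathbf U_h^{n+1}=\mathbf U_h^{(N_r)}.$$ Under the CFL condition $$\Delta t_n\le\min_{i,\ell}\frac{\varpi_{\mathscr E}^{(q)}|K|}{\beta_{i\ell}\,\omega_q\big(a+\sigma_{K,\mathscr E,q}(\mathbf U_h^{(i)})\big)|\mathscr E|},\qquad 1\le q\le Q,\ \forall\mathscr E\in\partial K,\ \forall K\in\mathcal T_h,$$ with $a=1$, this fully discrete Runge–Kutta discontinuous Galerkin scheme always preserves $\mathbf U_h^n\in\mathbb G_h^k$ for all $n\in\mathbb N$.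
   Context: **RMHD quantities.** The equation of state is a function $H=H(p,\rho)$, differentiable on $(0,\infty)^2$, satisfying for all $p,\rho>0$: $H(p,\rho)\ge\sqrt{1+p^2/\rho^2}+p/\rho$ and $H(p,\rho)\big(\frac1\rho-\frac{\partial H}{\partial p}\big)<\frac{\partial H}{\partial\rho}<0$. For $\rho,p>0$, $\mathbf v,\mathbf B\in\mathbb R^3$, $|\mathbf v|<1$, put $W=(1-|\mathbf v|^2)^{-1/2}$, $H=H(p,\rho)$, $e=H-1-p/\rho$, $p_{tot}=p+\frac12(W^{-2}|\mathbf B|^2+(\mathbf v\cdot\mathbf B)^2)$, $D=\rho W$, $\mathbf m=(\rho HW^2+|\mathbf B|^2)\mathbf v-(\mathbf v\cdot\mathbf B)\mathbf B$, $E=\rho HW^2-p_{tot}+|\mathbf B|^2$. The admissible set $\mathcal G\subset\mathbb R^8$ is the set of $\mathbf U=(D,\mathbf m,\mathbf B,E)^\top$ arising from such primitive variables with $\rho>0$, $p>0$, $e>0$, $|\mathbf v|<1$; each $\mathbf U\in\mathcal G$ determines its primitive variables uniquely, so $\rho,p,\mathbf v,H$ are functions of $\mathbf U\in\mathcal G$. For $\mathbf U\in\mathcal G$, $\mathbf F_i(\mathbf U)=\big(Dv_i,\ v_i\mathbf m-B_i(W^{-2}\mathbf B+(\mathbf v\cdot\mathbf B)\mathbf v)+p_{tot}\mathbf e_i,\ v_i\mathbf B-B_i\mathbf v,\ m_i\big)^\top$ ($\mathbf e_i$ the $i$-th row of the $3\times 3$ identity), and $\mathbf S(\mathbf U)=\big(0,(1-|\mathbf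 v|^2)\mathbf B+(\mathbf v\cdot\mathbf B)\mathbf v,\mathbf v,\mathbf v\cdot\mathbf B\big)^\top$. Here $d=2$; for $\mathbf n\in\mathbb R^d$, $\langle\mathbf n,\mathbf B\rangle=\sum_{j=1}^dn_jB_j$ and $\langle\mathbf n,\mathbf F\rangle=\sum_{j=1}^dn_j\mathbf F_j$. **Mesh and spaces.** The 2D domain $\Omega$ is partitioned into a mesh $\mathcal T_h$ of polygonal cells $K$ of area $|K|$; $\mathscr E\in\partial K$ denotes an edge of $K$, of length $|\mathscr E|$, with outward unit normal $\mathbf n_{\mathscr E,K}$. Every edge of $K$ is shared with exactly one adjacent cell (e.g. periodic boundary conditions); superscripts $\mathrm{int}(K)$ and $\mathrm{ext}(K)$ denote the traces on $\mathscr E$ from inside $K$ and from the adjacent cell. For an integer $k\ge0$, $\mathbb W_h^k$ is the space of $\mathbf u=(u_1,\dots,u_8)^\top$ with each $u_\ell|_K$ a polynomial of total degree $\le k$ and $\sum_{i=1}^d\partial u_{4+i}/\partial x_i=0$ in each $K\in\mathcal T_h$ (components $5,6,7$ are the magnetic field). $\mathbf P_w$ is the $L^2$-projection of $[L^2(\Omega)]^8$ onto $\mathbb W_h^k$. $\overline{\mathbb G}_h^k=\{\mathbf u\in\mathbb W_h^k:\frac1{|K|}\int_K\mathbf u\,d\mathbf x\in\mathcal G\ \forall K\in\mathcal T_h\}$ and $\mathbb G_h^k=\{\mathbf u\in\overline{\mathbb G}_h^k:\mathbf u|_K(\mathbf x)\in\mathcal G\ \forall\mathbf x\in\mathbb S_K,\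 \forall K\in\mathcal T_h\}$, with $\mathbb S_K$ given next. **Quadratures.** On each edge $\mathscr E$: the Gauss quadrature with $Q=k+1$ points $\mathbf x_{\mathscr E}^{(q)}$ and positive weights $\omega_q$, $\sum_q\omega_q=1$. On each cell $K$: a quadrature with points $\breve{\mathbf x}_K^{(q)}$ and weights $\breve\omega_q$, $1\le q\le\breve Q$, of algebraic degree at least $2k$; $\breve{\mathbb S}_K=\{\breve{\mathbf x}_K^{(q)}\}$. It is assumed that each $K$ admits a special quadrature with positive weights, summing to $1$: $$\frac1{|K|}\int_Ku\,d\mathbf x=\sum_{\mathscr E\in\partial K}\sum_{q=1}^Q\varpi_{\mathscr E}^{(q)}u(\mathbf x_{\mathscr E}^{(q)})+\sum_{q=1}^{\widetilde Q}\widetilde\varpi_q\,u(\widetilde{\mathbf x}_K^{(q)})$$ for all polynomials $u$ of degree $\le k$ on $K$; $\widehat{\mathbb S}_K$ is the set of all its nodes. Set $\mathbb S_K=\widehat{\mathbb S}_K\cup\breve{\mathbb S}_K$. **The operator $\mathbf L_h$.** The numerical flux is $\hat{\mathbf F}(\mathbf U^-,\mathbf U^+;\mathbf n)=\frac12\big(\langle\mathbf n,\mathbf F(\mathbf U^-)+\mathbf F(\mathbf U^+)\rangle-a(\mathbf U^+-\mathbf U^-)\big)$ with $a=1$. For $\mathbf U_h\in\mathbb G_h^k$, $\mathbf L_h(\mathbf U_h)\in\mathbb W_h^k$ is defined by $\int_K\mathbf L_h(\mathbf U_h)\cdot\mathbf u\,d\mathbf x=\mathcal J_K(\mathbf U_h,\mathbf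 u)$ for all $\mathbf u\in\mathbb W_h^k$, $K\in\mathcal T_h$, where $$\mathcal J_K(\mathbf U_h,\mathbf u)=-\sum_{\mathscr E\in\partial K}|\mathscr E|\sum_{q=1}^Q\omega_q\Big[\hat{\mathbf F}\big(\mathbf U_h^{\mathrm{int}(K)},\mathbf U_h^{\mathrm{ext}(K)};\mathbf n_{\mathscr E,K}\big)+\tfrac12\big\langle\mathbf n_{\mathscr E,K},\mathbf B_h^{\mathrm{ext}(K)}-\mathbf B_h^{\mathrm{int}(K)}\big\rangle\mathbf S\big(\mathbf U_h^{\mathrm{int}(K)}\big)\Big]\cdot\mathbf u^{\mathrm{int}(K)}\Big|_{\mathbf x_{\mathscr E}^{(q)}}+|K|\sum_{q=1}^{\breve Q}\breve\omega_q\sum_{i=1}^d\mathbf F_i\big(\mathbf U_h(\breve{\mathbf x}_K^{(q)})\big)\cdot\frac{\partial\mathbf u}{\partial x_i}(\breve{\mathbf x}_K^{(q)}).$$ Further, $\sigma_{K,\mathscr E,q}(\mathbf U_h):=\frac12\big|\big\langle\mathbf n_{\mathscr E,K},\mathbf B_h^{\mathrm{int}(K)}-\mathbf B_h^{\mathrm{ext}(K)}\big\rangle\big|\big/\sqrt{\rho H}$, everything evaluated at $\mathbf x_{\mathscr E}^{(q)}$, with $\rho,H$ computed from $\mathbf U_h^{\mathrm{int}(K)}(\mathbf x_{\mathscr E}^{(q)})$. **The limiter $\mathbf\Pi_h:\overline{\mathbb G}_h^k\to\mathbb G_h^k$.** For $\mathbf U=(D,\mathbf m,\mathbf B,E)^\top$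 put $q(\mathbf U)=E-\sqrt{D^2+|\mathbf m|^2}$, $\Phi(\mathbf U)=\sqrt{(|\mathbf B|^2-E)^2+3(E^2-D^2-|\mathbf m|^2)}$, $\Psi(\mathbf U)=\big(\Phi(\mathbf U)-2(|\mathbf B|^2-E)\big)\sqrt{\Phi(\mathbf U)+|\mathbf B|^2-E}-\sqrt{\tfrac{27}2\big(D^2|\mathbf B|^2+(\mathbf m\cdot\mathbf B)^2\big)}$, $\Psi_\epsilon(\mathbf U)=\Psi\big((D,\mathbf m,\mathbf B,E-\epsilon)^\top\big)$, and $\mathcal G_\epsilon=\{\mathbf U:D\ge\epsilon,\ q(\mathbf U)\ge\epsilon,\ \Psi_\epsilon(\mathbf U)\ge0\}$. Given $\mathbf U_h\in\overline{\mathbb G}_h^k$ with $\mathbf U_K=\mathbf U_h|_K=(D_K,\mathbf m_K,\mathbf B_K,E_K)^\top$ and cell averages $\bar{\mathbf U}_K=(\bar D_K,\bar{\mathbf m}_K,\bar{\mathbf B}_K,\bar E_K)^\top$, choose a sufficiently small $\epsilon>0$ such that $\bar{\mathbf U}_K\in\mathcal G_\epsilon$ for all $K$. On each $K$: (1) $\widehat D_K=\theta_1(D_K-\bar D_K)+\bar D_K$, $\theta_1=\min\{1,(\bar D_K-\epsilon)/(\bar D_K-\min_{\mathbb S_K}D_K)\}$, and $\widehat{\mathbf U}_K=(\widehat D_K,\mathbf m_K,\mathbf B_K,E_K)^\top$; (2) $\check{\mathbf U}_K=\big(\theta_2(\widehat D_K-\bar D_K)+\bar D_K,\ \theta_2(\mathbf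 m_K-\bar{\mathbf m}_K)+\bar{\mathbf m}_K,\ \mathbf B_K,\ \theta_2(E_K-\bar E_K)+\bar E_K\big)^\top$, $\theta_2=\min\{1,(q(\bar{\mathbf U}_K)-\epsilon)/(q(\bar{\mathbf U}_K)-\min_{\mathbb S_K}q(\widehat{\mathbf U}_K))\}$; (3) $(\mathbf\Pi_h\mathbf U_h)|_K=\theta_3(\check{\mathbf U}_K-\bar{\mathbf U}_K)+\bar{\mathbf U}_K$, $\theta_3=\min_{\mathbf x\in\mathbb S_K}\tilde\theta(\mathbf x)$, where $\tilde\theta(\mathbf x)=1$ if $\Psi_\epsilon(\check{\mathbf U}_K(\mathbf x))\ge0$ and otherwise $\tilde\theta(\mathbf x)\in[0,1)$ is the unique solution of $\Psi_\epsilon\big((1-\tilde\theta)\bar{\mathbf U}_K+\tilde\theta\check{\mathbf U}_K(\mathbf x)\big)=0$. (If a denominator in $\theta_1$ or $\theta_2$ vanishes, the corresponding $\theta$ is $1$.) For $k=0$, $\mathbf\Pi_h$ is the identity. **Runge–Kutta parameters.** $N_r\ge1$ stages; $\alpha_{i\ell}\ge0$, $\beta_{i\ell}\ge0$ ($1\le i\le N_r$, $0\le\ell\le i-1$), $\sum_{\ell=0}^{i-1}\alpha_{i\ell}=1$. $\Delta t_n>0$ are the time steps. In the CFL condition, the minimum is over the Runge–Kutta indices $i,\ell$ of the coefficients $\beta_{i\ell}$, and a quotient with $\beta_{i\ell}=0$ is read as $+\infty$.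
   Formalization: The equation of state is also assumed to satisfy e(p,ρ)→0 as p→0+ for each ρ>0 (without it the claim fails), and in the CFL condition the bound for β_{iℓ} uses σ at stage U_h^{(ℓ)} instead of U_h^{(i)}, which is not yet known to be admissible. *)

theory Defs
  imports "HOL-Analysis.Analysis" "HOL-Computational_Algebra.Polynomial"
begin

section \<open>Relativistic magnetohydrodynamics\<close>

type_synonym pt = "real^2"

text \<open>\<open>\<real>\<^sup>8\<close> as the Euclidean product of the blocks \<open>(D, m, B, E)\<close>; its inner product is the usual
  one of \<open>\<real>\<^sup>8\<close>, and its \<open>Basis\<close> consists of the eight coordinate vectors.\<close>
type_synonym state = "real \<times> (real^3) \<times> (real^3) \<times> real"

definition dens :: "state \<Rightarrow> real" where "dens U = fst U"
definition mom :: "state \<Rightarrow> real^3" where "mom U = fst (snd U)"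
definition mag :: "state \<Rightarrow> real^3" where "mag U = fst (snd (snd U))"
definition ener :: "state \<Rightarrow> real" where "ener U = snd (snd (snd U))"

text \<open>The equation of state is a function \<open>H p \<rho>\<close> (pressure first).\<close>
definition eos :: "(real \<Rightarrow> real \<Rightarrow> real) \<Rightarrow> bool" where
  "eos H \<longleftrightarrow> (\<forall>p>0. \<forall>\<rho>>0.
     (\<lambda>(p, \<rho>). H p \<rho>) differentiable (at (p, \<rho>)) \<and>
     H p \<rho> \<ge> sqrt (1 + p^2 / \<rho>^2) + p / \<rho> \<and>
     H p \<rho> * (1 / \<rho> - deriv (\<lambda>p. H p \<rho>) p) < deriv (\<lambda>\<rho>. H p \<rho>) \<rho> \<and>
     deriv (\<lambda>\<rho>. H p \<rho>) \<rho> < 0)"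

definition internal_energy :: "(real \<Rightarrow> real \<Rightarrow> real) \<Rightarrow> real \<Rightarrow> real \<Rightarrow> real" where
  "internal_energy H p \<rho> = H p \<rho> - 1 - p / \<rho>"

text \<open>No internal energy in the limit of vanishing pressure. This is not a consequence of \<open>eos\<close>: for
  \<open>H p \<rho> = 2 + 3 * p / \<rho>\<close> the internal energy tends to 1, and the admissible set is then strictly smaller
  than \<open>{U. D > 0 \<and> q U > 0 \<and> \<Psi> U > 0}\<close>, the constraints enforced by the limiter.\<close>
definition no_cold_energy :: "(real \<Rightarrow> real \<Rightarrow> real) \<Rightarrow> bool" where
  "no_cold_energy H \<longleftrightarrow> (\<forall>\<rho>>0. ((\<lambda>p. internal_energy H p \<rho>) \<longlongrightarrow> 0) (at_right 0))"

definition lorentz :: "real^3 \<Rightarrow> real" where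
  "lorentz v = 1 / sqrt (1 - (norm v)^2)"

definition ptot :: "real \<Rightarrow> real^3 \<Rightarrow> real^3 \<Rightarrow> real" where
  "ptot p v B = p + ((norm B)^2 / (lorentz v)^2 + (v \<bullet> B)^2) / 2"

definition conserved :: "(real \<Rightarrow> real \<Rightarrow> real) \<Rightarrow> real \<Rightarrow> real \<Rightarrow> real^3 \<Rightarrow> real^3 \<Rightarrow> state" where
  "conserved H \<rho> p v B =
     (\<rho> * lorentz v,
      (\<rho> * H p \<rho> * (lorentz v)^2 + (norm B)^2) *\<^sub>R v - (v \<bullet> B) *\<^sub>R B,
      B,
      \<rho> * H p \<rho> * (lorentz v)^2 - ptot p v B + (norm B)^2)"

definition admissible_prim :: "(real \<Rightarrow> real \<Rightarrow> real) \<Rightarrow> real \<Rightarrow> real \<Rightarrow> real^3 \<Rightarrow> bool" where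
  "admissible_prim H \<rho> p v \<longleftrightarrow> \<rho> > 0 \<and> p > 0 \<and> internal_energy H p \<rho> > 0 \<and> norm v < 1"

definition admissible :: "(real \<Rightarrow> real \<Rightarrow> real) \<Rightarrow> state set" where
  "admissible H = {conserved H \<rho> p v B | \<rho> p v B. admissible_prim H \<rho> p v}"

text \<open>The (unique) primitive variables \<open>(\<rho>, p, v)\<close> of an admissible state; arbitrary otherwise.\<close>
definition prim :: "(real \<Rightarrow> real \<Rightarrow> real) \<Rightarrow> state \<Rightarrow> real \<times> real \<times> (real^3)" where
  "prim H U = (SOME (\<rho>, p, v). admissible_prim H \<rho> p v \<and> conserved H \<rho> p v (mag U) = U)"

definition rho_of :: "(real \<Rightarrow> real \<Rightarrow> real) \<Rightarrow> state \<Rightarrow> real" where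
  "rho_of H U = fst (prim H U)"
definition pres_of :: "(real \<Rightarrow> real \<Rightarrow> real) \<Rightarrow> state \<Rightarrow> real" where
  "pres_of H U = fst (snd (prim H U))"
definition vel_of :: "(real \<Rightarrow> real \<Rightarrow> real) \<Rightarrow> state \<Rightarrow> real^3" where
  "vel_of H U = snd (snd (prim H U))"
definition enth_of :: "(real \<Rightarrow> real \<Rightarrow> real) \<Rightarrow> state \<Rightarrow> real" where
  "enth_of H U = H (pres_of H U) (rho_of H U)"

definition flux :: "(real \<Rightarrow> real \<Rightarrow> real) \<Rightarrow> 3 \<Rightarrow> state \<Rightarrow> state" where
  "flux H i U = (let v = vel_of H U; B = mag U in
     (dens U * v$i,
      v$i *\<^sub>R mom U - B$i *\<^sub>R ((1 / (lorentz v)^2) *\<^sub>R B + (v \<bullet> B) *\<^sub>R v)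
        + ptot (pres_of H U) v B *\<^sub>R axis i 1,
      v$i *\<^sub>R B - B$i *\<^sub>R v,
      mom U $ i))"

definition source :: "(real \<Rightarrow> real \<Rightarrow> real) \<Rightarrow> state \<Rightarrow> state" where
  "source H U = (let v = vel_of H U; B = mag U in
     (0, (1 - (norm v)^2) *\<^sub>R B + (v \<bullet> B) *\<^sub>R v, v, v \<bullet> B))"

definition ndot :: "pt \<Rightarrow> real^3 \<Rightarrow> real" where
  "ndot n B = n$1 * B$1 + n$2 * B$2"

definition nflux :: "(real \<Rightarrow> real \<Rightarrow> real) \<Rightarrow> pt \<Rightarrow> state \<Rightarrow> state" where
  "nflux H n U = n$1 *\<^sub>R flux H 1 U + n$2 *\<^sub>R flux H 2 U"

text \<open>Lax--Friedrichs flux with viscosity \<open>a = 1\<close> (the speed of light).\<close>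
definition num_flux :: "(real \<Rightarrow> real \<Rightarrow> real) \<Rightarrow> state \<Rightarrow> state \<Rightarrow> pt \<Rightarrow> state" where
  "num_flux H Um Up n = (1/2) *\<^sub>R (nflux H n Um + nflux H n Up - 1 *\<^sub>R (Up - Um))"


section \<open>Mesh\<close>

text \<open>An edge is a pair of end points. The order fixes the numbering of the Gauss points on the
  edge and is the same for both cells sharing the edge.\<close>
type_synonym edge = "pt \<times> pt"

definition segm :: "edge \<Rightarrow> pt set" where "segm e = closed_segment (fst e) (snd e)"
definition open_segm :: "edge \<Rightarrow> pt set" where "open_segm e = open_segment (fst e) (snd e)"
definition elen :: "edge \<Rightarrow> real" where "elen e = dist (fst e) (snd e)"
definition shift_edge :: "pt \<Rightarrow> edge \<Rightarrow> edge" where "shift_edge s e = (fst e + s, snd e + s)"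

text \<open>\<open>P\<close> is a closed polygonal region whose edges are \<open>es\<close>. Consecutive edges may be collinear.\<close>
definition polygonal_cell :: "pt set \<Rightarrow> edge set \<Rightarrow> bool" where
  "polygonal_cell P es \<longleftrightarrow>
     compact P \<and> interior P \<noteq> {} \<and> connected (interior P) \<and> closure (interior P) = P \<and>
     finite es \<and> (\<forall>e\<in>es. fst e \<noteq> snd e) \<and>
     frontier P = (\<Union>e\<in>es. segm e) \<and>
     (\<forall>e\<in>es. \<forall>e'\<in>es. e \<noteq> e' \<longrightarrow> open_segm e \<inter> segm e' = {})"

definition outward_unit_normal :: "pt set \<Rightarrow> edge \<Rightarrow> pt \<Rightarrow> bool" where
  "outward_unit_normal P e n \<longleftrightarrow>
     norm n = 1 \<and> n \<bullet> (snd e - fst e) = 0 \<and>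
     (\<forall>x\<in>open_segm e. eventually (\<lambda>s. x + s *\<^sub>R n \<notin> P) (at_right 0))"

text \<open>The cells are indexed by a finite type. The cell adjacent to \<open>K\<close> across the edge \<open>e\<close> is
  \<open>nbr M K e\<close>; if \<open>e\<close> lies on the boundary of the domain and is identified with another boundary edge
  (periodicity), the identification is the translation by \<open>shift M K e\<close>, otherwise the shift is 0.\<close>
record 'c mesh =
  domain :: "pt set"
  cell :: "'c \<Rightarrow> pt set"
  edges :: "'c \<Rightarrow> edge set"
  nrm :: "'c \<Rightarrow> edge \<Rightarrow> pt"
  nbr :: "'c \<Rightarrow> edge \<Rightarrow> 'c"
  shift :: "'c \<Rightarrow> edge \<Rightarrow> pt"

text \<open>The domain may or may not contain its boundary.\<close>
definition valid_mesh :: "('c::finite) mesh \<Rightarrow> bool" where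
  "valid_mesh M \<longleftrightarrow>
     (\<forall>K. polygonal_cell (cell M K) (edges M K)) \<and>
     (\<forall>K K'. K \<noteq> K' \<longrightarrow> interior (cell M K) \<inter> interior (cell M K') = {}) \<and>
     (\<Union>K. interior (cell M K)) \<subseteq> domain M \<and> domain M \<subseteq> (\<Union>K. cell M K) \<and>
     (\<forall>K. \<forall>e\<in>edges M K. outward_unit_normal (cell M K) e (nrm M K e)) \<and>
     (\<forall>K. \<forall>e\<in>edges M K.
        let K' = nbr M K e; s = shift M K e; e' = shift_edge s e in
          e' \<in> edges M K' \<and> nrm M K' e' = - nrm M K e \<and>
          nbr M K' e' = K \<and> shift M K' e' = - s \<and>
          (s = 0 \<or> segm e \<subseteq> frontier (\<Union>L. cell M L)))"

definition area :: "'c mesh \<Rightarrow> 'c \<Rightarrow> real" where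
  "area M K = measure lebesgue (cell M K)"


section \<open>Discrete function spaces\<close>

text \<open>A piecewise polynomial \<open>u\<close> is given by the polynomials \<open>u K\<close>, regarded as functions on the whole
  plane. They are determined by their restrictions to the cells, and \<open>u K x\<close> at a boundary
  point \<open>x\<close> of \<open>K\<close> is the trace from inside \<open>K\<close>.\<close>
type_synonym 'c dgfun = "'c \<Rightarrow> pt \<Rightarrow> state"

definition poly2 :: "nat \<Rightarrow> (pt \<Rightarrow> real) set" where
  "poly2 k = {\<lambda>x. \<Sum>(i, j)\<in>{(i, j). i + j \<le> k}. c i j * x$1 ^ i * x$2 ^ j | c :: nat \<Rightarrow> nat \<Rightarrow> real. True}"

definition partial :: "2 \<Rightarrow> (pt \<Rightarrow> 'b::real_normed_vector) \<Rightarrow> pt \<Rightarrow> 'b" where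
  "partial i f x = frechet_derivative f (at x) (axis i 1)"

definition Wh :: "'c mesh \<Rightarrow> nat \<Rightarrow> 'c dgfun set" where
  "Wh M k = {u. \<forall>K. (\<forall>b\<in>Basis. (\<lambda>x. u K x \<bullet> b) \<in> poly2 k) \<and>
     (\<forall>x\<in>cell M K. partial 1 (\<lambda>y. mag (u K y) $ 1) x + partial 2 (\<lambda>y. mag (u K y) $ 2) x = 0)}"

definition cell_avg :: "'c mesh \<Rightarrow> 'c dgfun \<Rightarrow> 'c \<Rightarrow> state" where
  "cell_avg M u K = (1 / area M K) *\<^sub>R (LINT x:cell M K|lebesgue. u K x)"

text \<open>\<open>[L\<^sup>2(\<Omega>)]\<^sup>8\<close>\<close>
definition L2fun :: "pt set \<Rightarrow> (pt \<Rightarrow> state) set" where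
  "L2fun X = {f. f \<in> borel_measurable (lebesgue_on X) \<and> integrable (lebesgue_on X) (\<lambda>x. (norm (f x))^2)}"

definition proj_Wh :: "('c::finite) mesh \<Rightarrow> nat \<Rightarrow> (pt \<Rightarrow> state) \<Rightarrow> 'c dgfun" where
  "proj_Wh M k f = (THE w. w \<in> Wh M k \<and>
     (\<forall>u\<in>Wh M k. (\<Sum>K\<in>UNIV. LINT x:cell M K|lebesgue. (f x - w K x) \<bullet> u K x) = 0))"


section \<open>Quadratures\<close>

text \<open>Fields: Gauss points and weights on the reference edge \<open>[0,1]\<close>; number of points, points and
  weights of the volume quadrature of each cell; weights of the special quadrature at the Gauss points of
  the edges of each cell; number, positions and weights of its remaining nodes. Indices start at 0.\<close>
record 'c quads =
  gpt :: "nat \<Rightarrow> real"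
  gwt :: "nat \<Rightarrow> real"
  vnum :: "'c \<Rightarrow> nat"
  vpt :: "'c \<Rightarrow> nat \<Rightarrow> pt"
  vwt :: "'c \<Rightarrow> nat \<Rightarrow> real"
  ewt :: "'c \<Rightarrow> edge \<Rightarrow> nat \<Rightarrow> real"
  inum :: "'c \<Rightarrow> nat"
  ipt :: "'c \<Rightarrow> nat \<Rightarrow> pt"
  iwt :: "'c \<Rightarrow> nat \<Rightarrow> real"

text \<open>The \<open>Q\<close>-point Gauss quadrature: \<open>Q\<close> points, exact up to degree \<open>2 Q - 1\<close>.\<close>
definition gauss_quadrature :: "nat \<Rightarrow> (nat \<Rightarrow> real) \<Rightarrow> (nat \<Rightarrow> real) \<Rightarrow> bool" where
  "gauss_quadrature Q t w \<longleftrightarrow>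
     inj_on t {..<Q} \<and> (\<forall>q<Q. 0 < t q \<and> t q < 1 \<and> w q > 0) \<and> (\<Sum>q<Q. w q) = 1 \<and>
     (\<forall>p :: real poly. degree p \<le> 2 * Q - 1 \<longrightarrow> integral {0..1} (poly p) = (\<Sum>q<Q. w q * poly p (t q)))"

definition edge_pt :: "'c quads \<Rightarrow> edge \<Rightarrow> nat \<Rightarrow> pt" where
  "edge_pt R e q = fst e + gpt R q *\<^sub>R (snd e - fst e)"

definition valid_quads :: "'c mesh \<Rightarrow> nat \<Rightarrow> 'c quads \<Rightarrow> bool" where
  "valid_quads M k R \<longleftrightarrow>
     gauss_quadrature (k + 1) (gpt R) (gwt R) \<and>
     (\<forall>K. (\<forall>q<vnum R K. vpt R K q \<in> cell M K) \<and>
       (\<forall>f\<in>poly2 (2 * k). (1 / area M K) * (LINT x:cell M K|lebesgue. f x) =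
          (\<Sum>q<vnum R K. vwt R K q * f (vpt R K q)))) \<and>
     (\<forall>K. (\<forall>e\<in>edges M K. \<forall>q<k+1. ewt R K e q > 0) \<and>
       (\<forall>q<inum R K. iwt R K q > 0 \<and> ipt R K q \<in> cell M K) \<and>
       (\<Sum>e\<in>edges M K. \<Sum>q<k+1. ewt R K e q) + (\<Sum>q<inum R K. iwt R K q) = 1 \<and>
       (\<forall>f\<in>poly2 k. (1 / area M K) * (LINT x:cell M K|lebesgue. f x) =
          (\<Sum>e\<in>edges M K. \<Sum>q<k+1. ewt R K e q * f (edge_pt R e q)) +
          (\<Sum>q<inum R K. iwt R K q * f (ipt R K q))))"

definition special_nodes :: "'c mesh \<Rightarrow> nat \<Rightarrow> 'c quads \<Rightarrow> 'c \<Rightarrow> pt set" where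
  "special_nodes M k R K =
     (\<lambda>(e, q). edge_pt R e q) ` (edges M K \<times> {..<k+1}) \<union> ipt R K ` {..<inum R K}"

definition volume_nodes :: "'c quads \<Rightarrow> 'c \<Rightarrow> pt set" where
  "volume_nodes R K = vpt R K ` {..<vnum R K}"

definition nodes :: "'c mesh \<Rightarrow> nat \<Rightarrow> 'c quads \<Rightarrow> 'c \<Rightarrow> pt set" where
  "nodes M k R K = special_nodes M k R K \<union> volume_nodes R K"

definition Gh_bar :: "(real \<Rightarrow> real \<Rightarrow> real) \<Rightarrow> 'c mesh \<Rightarrow> nat \<Rightarrow> 'c dgfun set" where
  "Gh_bar H M k = {u \<in> Wh M k. \<forall>K. cell_avg M u K \<in> admissible H}"

definition Gh :: "(real \<Rightarrow> real \<Rightarrow> real) \<Rightarrow> 'c mesh \<Rightarrow> nat \<Rightarrow> 'c quads \<Rightarrow> 'c dgfun set" where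
  "Gh H M k R = {u \<in> Gh_bar H M k. \<forall>K. \<forall>x\<in>nodes M k R K. u K x \<in> admissible H}"


section \<open>The discontinuous Galerkin operator\<close>

definition trace_ext :: "'c mesh \<Rightarrow> 'c dgfun \<Rightarrow> 'c \<Rightarrow> edge \<Rightarrow> pt \<Rightarrow> state" where
  "trace_ext M U K e x = U (nbr M K e) (x + shift M K e)"

definition dg_form :: "(real \<Rightarrow> real \<Rightarrow> real) \<Rightarrow> 'c mesh \<Rightarrow> nat \<Rightarrow> 'c quads \<Rightarrow> 'c \<Rightarrow> 'c dgfun \<Rightarrow> 'c dgfun \<Rightarrow> real" where
  "dg_form H M k R K U u =
     - (\<Sum>e\<in>edges M K. elen e * (\<Sum>q<k+1. gwt R q *
          (let x = edge_pt R e q; n = nrm M K e; Ui = U K x; Ue = trace_ext M U K e x in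
             (num_flux H Ui Ue n + ((1/2) * ndot n (mag Ue - mag Ui)) *\<^sub>R source H Ui) \<bullet> u K x)))
     + area M K * (\<Sum>q<vnum R K. vwt R K q *
          (let x = vpt R K q in
             flux H 1 (U K x) \<bullet> partial 1 (u K) x + flux H 2 (U K x) \<bullet> partial 2 (u K) x))"

definition Lh :: "(real \<Rightarrow> real \<Rightarrow> real) \<Rightarrow> 'c mesh \<Rightarrow> nat \<Rightarrow> 'c quads \<Rightarrow> 'c dgfun \<Rightarrow> 'c dgfun" where
  "Lh H M k R U = (THE w. w \<in> Wh M k \<and>
     (\<forall>u\<in>Wh M k. \<forall>K. (LINT x:cell M K|lebesgue. w K x \<bullet> u K x) = dg_form H M k R K U u))"

text \<open>In the time step restriction for the Runge--Kutta coefficient \<open>\<beta> i l\<close>, this is evaluated at the stage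
  \<open>l\<close>, whose \<open>Lh\<close> is multiplied by \<open>\<beta> i l\<close>.\<close>
definition jump_sigma :: "(real \<Rightarrow> real \<Rightarrow> real) \<Rightarrow> 'c mesh \<Rightarrow> 'c quads \<Rightarrow> 'c \<Rightarrow> edge \<Rightarrow> nat \<Rightarrow> 'c dgfun \<Rightarrow> real" where
  "jump_sigma H M R K e q U =
     (let x = edge_pt R e q; Ui = U K x; Ue = trace_ext M U K e x in
        (1/2) * \<bar>ndot (nrm M K e) (mag Ui - mag Ue)\<bar> / sqrt (rho_of H Ui * enth_of H Ui))"


section \<open>The limiter\<close>

definition qfun :: "state \<Rightarrow> real" where
  "qfun U = ener U - sqrt ((dens U)^2 + (norm (mom U))^2)"

definition Phi :: "state \<Rightarrow> real" where
  "Phi U = sqrt (((norm (mag U))^2 - ener U)^2 + 3 * ((ener U)^2 - (dens U)^2 - (norm (mom U))^2))"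

definition Psi :: "state \<Rightarrow> real" where
  "Psi U = (Phi U - 2 * ((norm (mag U))^2 - ener U)) * sqrt (Phi U + (norm (mag U))^2 - ener U)
     - sqrt (27/2 * ((dens U)^2 * (norm (mag U))^2 + (mom U \<bullet> mag U)^2))"

definition Psi_eps :: "real \<Rightarrow> state \<Rightarrow> real" where
  "Psi_eps \<epsilon> U = Psi (dens U, mom U, mag U, ener U - \<epsilon>)"

definition G_eps :: "real \<Rightarrow> state set" where
  "G_eps \<epsilon> = {U. dens U \<ge> \<epsilon> \<and> qfun U \<ge> \<epsilon> \<and> Psi_eps \<epsilon> U \<ge> 0}"

text \<open>The three steps on one cell with node set \<open>S\<close>, cell average \<open>a\<close> and polynomial \<open>u\<close>.\<close>

definition theta1 :: "pt set \<Rightarrow> real \<Rightarrow> state \<Rightarrow> (pt \<Rightarrow> state) \<Rightarrow> real" where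
  "theta1 S \<epsilon> a u = (let d = dens a - Min ((\<lambda>x. dens (u x)) ` S) in
     if d = 0 then 1 else min 1 ((dens a - \<epsilon>) / d))"

definition limit1 :: "pt set \<Rightarrow> real \<Rightarrow> state \<Rightarrow> (pt \<Rightarrow> state) \<Rightarrow> pt \<Rightarrow> state" where
  "limit1 S \<epsilon> a u x =
     (theta1 S \<epsilon> a u * (dens (u x) - dens a) + dens a, mom (u x), mag (u x), ener (u x))"

text \<open>Steps 2 and 3 are applied to the results of the preceding step.\<close>

definition theta2 :: "pt set \<Rightarrow> real \<Rightarrow> state \<Rightarrow> (pt \<Rightarrow> state) \<Rightarrow> real" where
  "theta2 S \<epsilon> a u = (let d = qfun a - Min ((\<lambda>x. qfun (u x)) ` S) in
     if d = 0 then 1 else min 1 ((qfun a - \<epsilon>) / d))"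

definition limit2 :: "pt set \<Rightarrow> real \<Rightarrow> state \<Rightarrow> (pt \<Rightarrow> state) \<Rightarrow> pt \<Rightarrow> state" where
  "limit2 S \<epsilon> a u x = (let \<theta> = theta2 S \<epsilon> a u in
     (\<theta> * (dens (u x) - dens a) + dens a,
      \<theta> *\<^sub>R (mom (u x) - mom a) + mom a,
      mag (u x),
      \<theta> * (ener (u x) - ener a) + ener a))"

text \<open>The solution is unique when \<open>Psi_eps \<epsilon> a > 0\<close>. In the borderline case
  \<open>Psi_eps \<epsilon> a = 0\<close>, which membership of \<open>a\<close> in \<open>G_eps \<epsilon>\<close> does not exclude, uniqueness may
  fail; then any solution is taken.\<close>
definition theta_tilde :: "real \<Rightarrow> state \<Rightarrow> state \<Rightarrow> real" where
  "theta_tilde \<epsilon> a U = (if Psi_eps \<epsilon> U \<ge> 0 then 1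
     else (SOME \<theta>. 0 \<le> \<theta> \<and> \<theta> < 1 \<and> Psi_eps \<epsilon> ((1 - \<theta>) *\<^sub>R a + \<theta> *\<^sub>R U) = 0))"

definition theta3 :: "pt set \<Rightarrow> real \<Rightarrow> state \<Rightarrow> (pt \<Rightarrow> state) \<Rightarrow> real" where
  "theta3 S \<epsilon> a u = Min ((\<lambda>x. theta_tilde \<epsilon> a (u x)) ` S)"

definition limit3 :: "pt set \<Rightarrow> real \<Rightarrow> state \<Rightarrow> (pt \<Rightarrow> state) \<Rightarrow> pt \<Rightarrow> state" where
  "limit3 S \<epsilon> a u x = theta3 S \<epsilon> a u *\<^sub>R (u x - a) + a"

text \<open>The parameter \<open>\<epsilon>\<close> is chosen in dependence on the argument of the limiter by a rule \<open>eps\<close>.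
  The rule is constrained only on \<open>Gh_bar\<close>, the domain of definition of the limiter.\<close>
definition eps_rule :: "(real \<Rightarrow> real \<Rightarrow> real) \<Rightarrow> 'c mesh \<Rightarrow> nat \<Rightarrow> ('c dgfun \<Rightarrow> real) \<Rightarrow> bool" where
  "eps_rule H M k eps \<longleftrightarrow>
     (\<forall>u\<in>Gh_bar H M k. eps u > 0 \<and> (\<forall>K. cell_avg M u K \<in> G_eps (eps u)))"

definition limiter :: "'c mesh \<Rightarrow> nat \<Rightarrow> 'c quads \<Rightarrow> ('c dgfun \<Rightarrow> real) \<Rightarrow> 'c dgfun \<Rightarrow> 'c dgfun" where
  "limiter M k R eps u = (if k = 0 then u else
     (\<lambda>K. let S = nodes M k R K; \<epsilon> = eps u; a = cell_avg M u K in
        limit3 S \<epsilon> a (limit2 S \<epsilon> a (limit1 S \<epsilon> a (u K)))))"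

end

theory Submission
  imports Defs
begin

text \<open>The admissible set is the intersection of \<open>D > 0\<close> with the half spaces
  \<open>U \<bullet> nst w C + pst w C > 0\<close>, \<open>|w| < 1\<close>, \<open>C \<in> \<real>\<^sup>3\<close>. Cell averages are linear, so it suffices to evaluate
  these linear functionals on one forward Euler step tested with constants. The flux at each edge node
  costs at most \<open>U \<bullet> nst w C + pst w C\<close> up to the term \<open>\<langle>n, w\<rangle> pst w C - \<langle>n, B\<rangle> (w \<bullet> C)\<close>, whose sum
  over the edges vanishes because \<open>B\<close> is divergence-free in the cell; the Godunov source term replaces
  the magnetic trace of the neighbour by the interior one, at the price of the factor \<open>1 + \<sigma>\<close> of the CFL
  condition. Covariantly, \<open>U \<bullet> nst w C + pst w C\<close> is the sum of a fluid part, positive because of the lower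
  bound on \<open>H\<close>, and of a contraction of the energy--momentum tensor of the difference of two
  electromagnetic fields, nonnegative by the dominant energy condition. The limiter enforces \<open>\<Psi> \<ge> 0\<close>, which says that the half space inequalities hold with margin
  \<open>\<epsilon>\<close>.\<close>

section \<open>Inequalities for the primitive variables\<close>

text \<open>The obstacle is that neither side of the scheme is explicit in \<open>U\<close>: the
  fluxes need the primitive variables, which have no closed form, while \<open>Psi\<close> is too
  nonlinear to be followed through an update. With the parameters \<open>(w, C)\<close> frozen, the
  half space inequalities are affine in \<open>U\<close>, and every estimate becomes one between
  polynomials in \<open>v\<close>, \<open>B\<close>, \<open>w\<close>, \<open>C\<close> plus a fluid
  inequality. Only one-sided passages to \<open>Psi\<close> and to the primitive variables remain;
  the second is where vanishing internal energy at zero pressure enters.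

  The viscosity \<open>a = 1\<close> is dictated by the flux bound: subtracting the normal flux from
  the state contracts the energy-momentum tensor with a null vector, and the result keeps a sign up
  to the remainder. Of that remainder, the \<open>pst\<close> part cancels over a cell because the
  length-weighted normals do; the magnetic part cancels only for the interior trace, since the
  normal component of \<open>B\<close> may jump across an edge. This mismatch is what the source
  term compensates.

  Cells may be nonconvex or have holes, so the divergence theorem is obtained by slicing with
  lines.\<close>

lemma null_energy_form_nonneg:
  fixes w1 w2 w3 X f2 f3 a b :: real
  assumes w: "w1^2 + w2^2 + w3^2 \<le> 1"
  shows "0 \<le> (1 - w1) * (f2^2 + f3^2) + (1 + w1) * (a^2 + b^2)
            + 2 * (w2 * (a * f2 - b * f3) + w3 * (a * f3 + b * f2))"
proof -
  have w1: "\<bar>w1\<bar> \<le> 1"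
  proof -
    have "w1^2 \<le> 1" using w zero_le_power2[of w2] zero_le_power2[of w3] by linarith
    thus ?thesis by (simp add: abs_square_le_1)
  qed
  define X where "X = f2^2 + f3^2"
  define Y where "Y = a^2 + b^2"
  define G where "G = w2 * (a * f2 - b * f3) + w3 * (a * f3 + b * f2)"
  have XY: "X \<ge> 0" "Y \<ge> 0" by (auto simp: X_def Y_def)
  \<comment> \<open>Lagrange's identity: \<open>G\<close> is the inner product of
    \<open>(w2, w3)\<close> with the complex product of \<open>a + ib\<close> and
    \<open>f2 + if3\<close>, whose squared length is \<open>X * Y\<close>. Splitting
    \<open>1 - w1^2\<close> into its two factors then prepares the inequality of arithmetic and
    geometric means.\<close>
  have "(w2^2 + w3^2) * (X * Y) - G^2 = (w2 * (a * f3 + b * f2) - w3 * (a * f2 - b * f3))^2"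
    unfolding X_def Y_def G_def by algebra
  hence "G^2 \<le> (w2^2 + w3^2) * (X * Y)"
    using zero_le_power2[of "w2 * (a * f3 + b * f2) - w3 * (a * f2 - b * f3)"] by linarith
  also have "\<dots> \<le> ((1 - w1) * (1 + w1)) * (X * Y)"
    using w XY by (intro mult_right_mono) (auto simp: power2_eq_square algebra_simps)
  also have "\<dots> = ((1 - w1) * X) * ((1 + w1) * Y)" by (simp add: algebra_simps)
  finally have G: "G^2 \<le> ((1 - w1) * X) * ((1 + w1) * Y)" .
  have nn: "(1 - w1) * X \<ge> 0" "(1 + w1) * Y \<ge> 0" using w1 XY by auto
  have "(2 * G)^2 \<le> ((1 - w1) * X + (1 + w1) * Y)^2"
  proof -
    have "(2 * G)^2 \<le> 4 * (((1 - w1) * X) * ((1 + w1) * Y))" using G by (simp add: power_mult_distrib)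
    also have "\<dots> \<le> ((1 - w1) * X + (1 + w1) * Y)^2"
      using zero_le_power2[of "(1 - w1) * X - (1 + w1) * Y"]
      by (simp add: power2_eq_square algebra_simps)
    finally show ?thesis .
  qed
  hence "\<bar>2 * G\<bar> \<le> (1 - w1) * X + (1 + w1) * Y"
    using nn by (metis abs_le_square_iff abs_of_nonneg add_nonneg_nonneg)
  thus ?thesis unfolding X_def Y_def G_def by linarith
qed

text \<open>Twice the expression is the energy flux, in the null direction \<open>(1, e\<^sub>1)\<close> and relative to an observer with
  velocity \<open>w\<close>, of the electromagnetic field \<open>E = - v \<times> B + w \<times> C\<close>, \<open>B - C\<close>. The numbers \<open>F\<close> and \<open>G\<close> are the
  contributions of \<open>(v, B)\<close> and \<open>(w, C)\<close> to \<open>E\<^sub>1\<close> and to the transverse part of \<open>E + (B - C) \<times> e\<^sub>1\<close>.\<close>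

lemma null_energy_nonneg:
  fixes v1 v2 v3 B1 B2 B3 w1 w2 w3 C1 C2 C3 :: real
  defines "vv \<equiv> v1 * v1 + v2 * v2 + v3 * v3" and "vB \<equiv> v1 * B1 + v2 * B2 + v3 * B3" and "BB \<equiv> B1 * B1 + B2 * B2 + B3 * B3"
    and "vw \<equiv> v1 * w1 + v2 * w2 + v3 * w3" and "wB \<equiv> w1 * B1 + w2 * B2 + w3 * B3" and "ww \<equiv> w1 * w1 + w2 * w2 + w3 * w3"
    and "CB \<equiv> C1 * B1 + C2 * B2 + C3 * B3" and "wC \<equiv> w1 * C1 + w2 * C2 + w3 * C3" and "CC \<equiv> C1 * C1 + C2 * C2 + C3 * C3"
    and "vC \<equiv> v1 * C1 + v2 * C2 + v3 * C3"
  assumes w: "ww \<le> 1"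
  shows "0 \<le> BB - ((1 - vv) * BB + vB^2) / 2 + BB * v1 - vB * B1 - (1 + v1) * (BB * vw - vB * wB)
     + B1 * ((1 - vv) * wB + vB * vw) - ((1 - vv) * BB + vB^2) / 2 * w1
     - (1 + v1) * ((1 - ww) * CB + wC * wB) + B1 * ((1 - ww) * vC + wC * vw)
     + (1 + w1) * (((1 - ww) * CC + wC^2) / 2) - B1 * wC"
    (is "0 \<le> ?T")
proof -
  define F1 where "F1 = v3 * B2 - v2 * B3"
  define F2 where "F2 = v1 * B3 - v3 * B1 + B3"
  define F3 where "F3 = v2 * B1 - v1 * B2 - B2"
  define G1 where "G1 = w2 * C3 - w3 * C2"
  define G2 where "G2 = w3 * C1 - w1 * C3 - C3"
  define G3 where "G3 = w1 * C2 - w2 * C1 + C2"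
  \<comment> \<open>The expression is quadratic in the pair of fields. The form of
    \<open>null_energy_form_nonneg\<close> at \<open>F + G\<close> is therefore compared degree by
    degree: quadratic in \<open>B\<close>, bilinear, quadratic in \<open>C\<close>. The slot
    \<open>b\<close> of the form receives \<open>B1 - C1\<close>.\<close>
  have BB: "2 * (BB - ((1 - vv) * BB + vB^2) / 2 + BB * v1 - vB * B1 - (1 + v1) * (BB * vw - vB * wB)
     + B1 * ((1 - vv) * wB + vB * vw) - ((1 - vv) * BB + vB^2) / 2 * w1) =
      (1 - w1) * (F2^2 + F3^2) + (1 + w1) * (F1^2 + B1^2)
            + 2 * (w2 * (F1 * F2 - B1 * F3) + w3 * (F1 * F3 + B1 * F2))"
    unfolding assms(1-10) F1_def F2_def F3_def by algebra
  have BC: "- (1 + v1) * ((1 - ww) * CB + wC * wB) + B1 * ((1 - ww) * vC + wC * vw) - B1 * wC =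
     (1 - w1) * (F2 * G2 + F3 * G3) + (1 + w1) * (F1 * G1 - B1 * C1)
     + (w2 * (F1 * G2 - B1 * G3) + w3 * (F1 * G3 + B1 * G2))
     + (w2 * (G1 * F2 + C1 * F3) + w3 * (G1 * F3 - C1 * F2))"
    unfolding assms(1-10) F1_def F2_def F3_def G1_def G2_def G3_def by (simp add: algebra_simps)
  have CC: "(1 + w1) * ((1 - ww) * CC + wC * wC) =
     (1 - w1) * (G2^2 + G3^2) + (1 + w1) * (G1^2 + C1^2)
            + 2 * (w2 * (G1 * G2 + C1 * G3) + w3 * (G1 * G3 - C1 * G2))"
    unfolding assms(1-10) G1_def G2_def G3_def by (simp add: power2_eq_square) (simp add: algebra_simps)
  define PB where "PB = BB - ((1 - vv) * BB + vB^2) / 2 + BB * v1 - vB * B1 - (1 + v1) * (BB * vw - vB * wB)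
     + B1 * ((1 - vv) * wB + vB * vw) - ((1 - vv) * BB + vB^2) / 2 * w1"
  define PM where "PM = - (1 + v1) * ((1 - ww) * CB + wC * wB) + B1 * ((1 - ww) * vC + wC * vw) - B1 * wC"
  define PC where "PC = (1 + w1) * (((1 - ww) * CC + wC^2) / 2)"
  have PC2: "2 * PC = (1 + w1) * ((1 - ww) * CC + wC * wC)" unfolding PC_def by (simp add: power2_eq_square)
  have "?T = PB + PM + PC" unfolding PB_def PM_def PC_def by linarith
  hence "2 * ?T = 2 * PB + 2 * PM + 2 * PC" by (simp only: distrib_left)
  also have "\<dots> = (1 - w1) * ((F2 + G2)^2 + (F3 + G3)^2) + (1 + w1) * ((F1 + G1)^2 + (B1 - C1)^2)
     + 2 * (w2 * ((F1 + G1) * (F2 + G2) - (B1 - C1) * (F3 + G3))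
          + w3 * ((F1 + G1) * (F3 + G3) + (B1 - C1) * (F2 + G2)))"
    unfolding BB[folded PB_def] BC[folded PM_def] PC2 CC by algebra
  also have "\<dots> \<ge> 0"
    by (rule null_energy_form_nonneg) (use w in \<open>simp add: assms power2_eq_square\<close>)
  finally have "0 \<le> 2 * ?T" .
  moreover have "0 \<le> 2 * x \<Longrightarrow> 0 \<le> x" for x :: real by simp
  ultimately show ?thesis by blast
qed

text \<open>The square is completed around the field \<open>(E, B) = r (0, v - w)\<close>.\<close>

lemma energy_ge_source:
  fixes v1 v2 v3 B1 B2 B3 w1 w2 w3 C1 C2 C3 r :: real
  defines "vv \<equiv> v1 * v1 + v2 * v2 + v3 * v3" and "vB \<equiv> v1 * B1 + v2 * B2 + v3 * B3" and "BB \<equiv> B1 * B1 + B2 * B2 + B3 * B3"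
    and "vw \<equiv> v1 * w1 + v2 * w2 + v3 * w3" and "wB \<equiv> w1 * B1 + w2 * B2 + w3 * B3" and "ww \<equiv> w1 * w1 + w2 * w2 + w3 * w3"
    and "CB \<equiv> C1 * B1 + C2 * B2 + C3 * B3" and "wC \<equiv> w1 * C1 + w2 * C2 + w3 * C3" and "CC \<equiv> C1 * C1 + C2 * C2 + C3 * C3"
    and "vC \<equiv> v1 * C1 + v2 * C2 + v3 * C3"
  assumes w: "ww \<le> 1"
  shows "r * (vB * (1 - vw) - (1 - vv) * wB + wC * (1 - vw) - (1 - ww) * vC) \<le>
     BB - ((1 - vv) * BB + vB^2) / 2 - (BB * vw - vB * wB)
     - ((1 - ww) * CB + wC * wB) + ((1 - ww) * CC + wC^2) / 2 + r^2 / 2 * (vv - 2 * vw + ww)"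
    (is "r * ?f \<le> ?T + _")
proof -
  define E1 where "E1 = v3 * B2 - v2 * B3 + (w2 * C3 - w3 * C2)"
  define E2 where "E2 = v1 * B3 - v3 * B1 + (w3 * C1 - w1 * C3)"
  define E3 where "E3 = v2 * B1 - v1 * B2 + (w1 * C2 - w2 * C1)"
  define D1 where "D1 = B1 - C1"
  define D2 where "D2 = B2 - C2"
  define D3 where "D3 = B3 - C3"
  define b1 where "b1 = D1 - r * (v1 - w1)"
  define b2 where "b2 = D2 - r * (v2 - w2)"
  define b3 where "b3 = D3 - r * (v3 - w3)"
  have T: "2 * ?T = E1 * E1 + E2 * E2 + E3 * E3 + (D1 * D1 + D2 * D2 + D3 * D3)
      - 2 * (w1 * (E2 * D3 - E3 * D2) + w2 * (E3 * D1 - E1 * D3) + w3 * (E1 * D2 - E2 * D1))"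
    unfolding assms(1-10) E1_def E2_def E3_def D1_def D2_def D3_def
    by algebra
  have f: "?f = (v1 - w1) * D1 + (v2 - w2) * D2 + (v3 - w3) * D3
      - ((v2 * w3 - v3 * w2) * E1 + (v3 * w1 - v1 * w3) * E2 + (v1 * w2 - v2 * w1) * E3)"
    unfolding assms(1-10) E1_def E2_def E3_def D1_def D2_def D3_def
    by algebra
  have a: "vv - 2 * vw + ww = (v1 - w1)^2 + (v2 - w2)^2 + (v3 - w3)^2"
    unfolding assms(1-10) by algebra
  define Q where "Q = ?T"
  define f where "f = ?f"
  \<comment> \<open>After the shift the left side is |E|^2 + |b|^2 - 2 w . (E x b), the energy
    density seen with velocity \<open>w\<close>. It equals |E - b x w|^2 + |b|^2 - |b x w|^2, and
    the last two terms are (1 - |w|^2) |b|^2 + (w . b)^2.\<close>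
  have "2 * (Q + r^2 / 2 * (vv - 2 * vw + ww) - r * f) =
      (E1 - (b2 * w3 - b3 * w2))^2 + (E2 - (b3 * w1 - b1 * w3))^2 + (E3 - (b1 * w2 - b2 * w1))^2
      + (1 - ww) * (b1^2 + b2^2 + b3^2) + (w1 * b1 + w2 * b2 + w3 * b3)^2"
    unfolding f[folded f_def] a right_diff_distrib[of 2] distrib_left[of 2] T[folded Q_def]
    unfolding b1_def b2_def b3_def assms(6)
    by algebra
  also have "\<dots> \<ge> 0"
    using w by (intro add_nonneg_nonneg mult_nonneg_nonneg) auto
  finally have "r * f \<le> Q + r^2 / 2 * (vv - 2 * vw + ww)" by simp
  thus ?thesis unfolding Q_def f_def .
qed

section \<open>Fluid inequalities\<close>

text \<open>The lower bound on the enthalpy in \<open>eos\<close> as a function of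
  \<open>p / \<rho>\<close>. It equals exp (arsinh x), so \<open>x\<close> is recovered as
  \<open>(g - 1 / g) / 2\<close> from \<open>g = taub x\<close>.\<close>

definition taub :: "real \<Rightarrow> real" where
  "taub x = sqrt (1 + x^2) + x"

lemma taub_ge:
  assumes "x > 0" shows "taub x > 1" "taub x > 0" "x = (taub x - 1 / taub x) / 2" "taub x \<ge> 2 * x"
proof -
  have "sqrt (1 + x^2) > 1" using assms by simp
  thus g: "taub x > 1" using assms unfolding taub_def by linarith
  thus g0: "taub x > 0" by linarith
  have "taub x * (sqrt (1 + x^2) - x) = 1"
    unfolding taub_def by (simp add: algebra_simps flip: power2_eq_square)
  hence "1 / taub x = sqrt (1 + x^2) - x" using g0 by (simp add: field_simps)
  thus "x = (taub x - 1 / taub x) / 2" by (simp add: taub_def)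
  have "x \<le> sqrt (1 + x^2)" by (rule real_le_rsqrt) simp
  thus "taub x \<ge> 2 * x" by (simp add: taub_def)
qed

text \<open>Here \<open>s\<close> and \<open>t\<close> stand for the inverse Lorentz factors of
  \<open>v\<close> and \<open>w\<close>, and \<open>aa\<close> for |v - w|^2. Once
  \<open>h * aa / 2\<close> is moved over, \<open>h\<close> has a coefficient of at least (1 + y^2)
  / 2 with y = t / s, and \<open>taub x\<close> is exactly the threshold above which h (1 + y^2) / 2
  - y - x is nonnegative for every real y. The reserve \<open>h * aa / 2\<close> later pays for the
  magnetic source term.\<close>

lemma fluid_time:
  fixes x h s t vw aa :: real
  assumes x: "x > 0" and h: "h > taub x" and s: "0 < s" "s \<le> 1" and t: "0 < t"
    and aa: "aa \<ge> 0" "2 * (1 - vw) = aa + s^2 + t^2"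
  shows "h * aa / 2 < h * ((1 - vw) / s^2) - x - t / s"
proof -
  define X where "X = (1 - vw) / s^2 - aa / 2"
  define y where "y = t / s"
  have "X = (1 + y^2) / 2 + aa / 2 * (1 / s^2 - 1)"
  proof -
    have 1: "1 - vw = (aa + s^2 + t^2) / 2" using aa by simp
    show ?thesis unfolding X_def y_def 1 using s by (simp add: field_simps)
  qed
  moreover have "1 / s^2 - 1 \<ge> 0" using s by (simp add: field_simps power_le_one)
  ultimately have X: "X \<ge> (1 + y^2) / 2" using aa by simp
  have "(1 + y^2) / 2 > 0" by (simp add: add_pos_nonneg)
  hence X0: "X > 0" using X by (rule less_le_trans)
  define g where "g = taub x"
  have g: "g > 0" "x = (g - 1 / g) / 2" unfolding g_def by (rule taub_ge[OF x])+
  have "g * (1 + y^2) / 2 - x - y = g / 2 * (y - 1 / g)^2"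
    unfolding g(2) using g(1) by (simp add: field_simps power2_eq_square)
  also have "\<dots> \<ge> 0" using g by simp
  finally have "x + y \<le> g * ((1 + y^2) / 2)" by simp
  also have "\<dots> \<le> g * X" using X g by (intro mult_left_mono) auto
  also have "\<dots> < h * X" using h X0 by (simp add: g_def)
  finally have "x + y < h * X" .
  thus ?thesis unfolding X_def y_def by (simp add: algebra_simps)
qed

text \<open>The numbers \<open>a\<close> and \<open>b\<close> are the frequencies of one null
  direction for two observers with relative Lorentz factor \<open>g\<close>. The quadratic condition
  limits \<open>b / a\<close> by the extreme Doppler factor \<open>g + sqrt (g^2 - 1)\<close>; what
  remains is 1 + x d <= g R, the Cauchy-Schwarz inequality for (1, x) and (1, d).\<close>

lemma fluid_null:
  fixes x h a b g :: real
  assumes x: "x > 0" and h: "h > taub x" and a: "a > 0" and g: "g \<ge> 1"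
    and q: "a^2 - 2 * g * a * b + b^2 \<le> 0"
  shows "x * b + a < h * g * a"
proof -
  define d where "d = sqrt (g^2 - 1)"
  define R where "R = sqrt (1 + x^2)"
  have "1 \<le> g^2" using g by (rule one_le_power)
  hence d2: "d^2 = g^2 - 1" and d0: "d \<ge> 0" unfolding d_def by simp_all
  have R2: "R^2 = 1 + x^2" and R0: "R \<ge> 0" unfolding R_def by auto
  have "(b - g * a)^2 \<le> (d * a)^2"
  proof -
    have "(d * a)^2 - (b - g * a)^2 = - (a^2 - 2 * g * a * b + b^2)"
      unfolding power_mult_distrib d2 by (simp add: power2_eq_square algebra_simps)
    thus ?thesis using q by linarith
  qed
  hence 1: "b - g * a \<le> d * a"
    by (rule power2_le_imp_le) (use a d0 in simp)
  have "(1 + x * d)^2 \<le> (g * R)^2"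
  proof -
    have "(g * R)^2 - (1 + x * d)^2 = (x - d)^2"
    proof -
      have 1: "(g * R)^2 = (1 + d^2) * (1 + x^2)" unfolding power_mult_distrib d2 R2 by simp
      show ?thesis unfolding 1 by (simp add: power2_eq_square algebra_simps)
    qed
    thus ?thesis using zero_le_power2[of "x - d"] by linarith
  qed
  hence 2: "1 + x * d \<le> g * R" by (rule power2_le_imp_le) (use g R0 in simp)
  have "x * b + a \<le> x * (g * a + d * a) + a" using 1 x by simp
  also have "\<dots> = (x * g + (1 + x * d)) * a" by (simp add: algebra_simps)
  also have "\<dots> \<le> (x * g + g * R) * a" using 2 a by simp
  also have "\<dots> = taub x * g * a" by (simp add: taub_def R_def algebra_simps)
  also have "\<dots> < h * g * a" using h g a by simp
  finally show ?thesis .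
qed

section \<open>The half spaces and the bounds for a single state\<close>

text \<open>For every density, \<open>U \<bullet> nst w C + pst w C\<close> vanishes at pressureless
  matter with \<open>H\<close> = 1, velocity \<open>w\<close> and magnetic field \<open>C\<close>;
  such matter marks the boundary of the admissible set.\<close>

definition nst :: "real^3 \<Rightarrow> real^3 \<Rightarrow> state" where
  "nst w C = (- sqrt (1 - (norm w)^2), - w, - ((1 - (norm w)^2) *\<^sub>R C + (w \<bullet> C) *\<^sub>R w), 1)"

text \<open>The magnetic part of \<open>ptot\<close> for velocity \<open>w\<close> and field
  \<open>C\<close>.\<close>

definition pst :: "real^3 \<Rightarrow> real^3 \<Rightarrow> real" where
  "pst w C = ((1 - (norm w)^2) * (norm C)^2 + (w \<bullet> C)^2) / 2"

lemma inner_nst: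
  "U \<bullet> nst w C = - dens U * sqrt (1 - (norm w)^2) - mom U \<bullet> w
     - ((1 - w \<bullet> w) * (C \<bullet> mag U) + (w \<bullet> C) * (w \<bullet> mag U)) + ener U"
  by (simp add: nst_def dens_def mom_def mag_def ener_def inner_prod_def inner_add_right
      inner_minus_right power2_norm_eq_inner inner_commute
      inner_diff_right)

lemma pst_inner: "pst w C = ((1 - w \<bullet> w) * (C \<bullet> C) + (w \<bullet> C)^2) / 2"
  by (simp add: pst_def power2_norm_eq_inner)

lemma state_sel [simp]:
  "dens (a, m, B, e) = a" "mom (a, m, B, e) = m" "mag (a, m, B, e) = B" "ener (a, m, B, e) = e"
  by (simp_all add: dens_def mom_def mag_def ener_def)

lemma norm_lt_1_inner: "norm (v :: real^3) < 1 \<Longrightarrow> v \<bullet> v < 1"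
  by (metis norm_lt_square one_power2 zero_less_one power_one)

lemma lorentz_sq:
  assumes "norm v < 1"
  shows "(lorentz v)^2 = 1 / (1 - v \<bullet> v)"
  using norm_lt_1_inner[OF assms] by (simp add: lorentz_def power_divide power2_norm_eq_inner)

text \<open>At a contact point the graphs of \<open>H\<close> and of its lower bound would have the same gradient, and the
  bound satisfies the derivative condition of \<open>eos\<close> with equality.\<close>

lemma eos_strict:
  assumes eos: "eos H" and p: "p > 0" and r: "\<rho> > 0"
  shows "H p \<rho> > taub (p / \<rho>)"
proof (rule ccontr)
  assume neq: "\<not> ?thesis"
  have tb: "taub (q / s) = sqrt (1 + q^2 / s^2) + q / s" for q s by (simp add: taub_def power_divide)
  have ge: "H q s \<ge> taub (q / s)" if "q > 0" "s > 0" for q s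
    using eos that unfolding eos_def tb by blast
  have eq: "H p \<rho> = taub (p / \<rho>)" using neq ge[OF p r] by simp
  have "(\<lambda>(p, \<rho>). H p \<rho>) differentiable (at (p, \<rho>))" using eos p r unfolding eos_def by blast
  then obtain F where F: "((\<lambda>(p, \<rho>). H p \<rho>) has_derivative F) (at (p, \<rho>))"
    by (auto simp: differentiable_def)
  have "((\<lambda>q. (\<lambda>(p, \<rho>). H p \<rho>) (q, \<rho>)) has_derivative (\<lambda>h. F (h, 0))) (at p)"
    by (rule has_derivative_compose[of "\<lambda>q. (q, \<rho>)" _ _ _ "\<lambda>(p, \<rho>). H p \<rho>"])
       (use F in \<open>auto intro!: derivative_eq_intros\<close>)
  hence "(\<lambda>q. H q \<rho>) differentiable (at p)" by (auto simp: differentiable_def)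
  hence dp: "((\<lambda>q. H q \<rho>) has_field_derivative deriv (\<lambda>q. H q \<rho>) p) (at p)"
    by (simp add: DERIV_deriv_iff_real_differentiable)
  have "((\<lambda>q. (\<lambda>(p, \<rho>). H p \<rho>) (p, q)) has_derivative (\<lambda>h. F (0, h))) (at \<rho>)"
    by (rule has_derivative_compose[of "\<lambda>q. (p, q)" _ _ _ "\<lambda>(p, \<rho>). H p \<rho>"])
       (use F in \<open>auto intro!: derivative_eq_intros\<close>)
  hence "(\<lambda>q. H p q) differentiable (at \<rho>)" by (auto simp: differentiable_def)
  hence dr: "((\<lambda>q. H p q) has_field_derivative deriv (\<lambda>q. H p q) \<rho>) (at \<rho>)"
    by (simp add: DERIV_deriv_iff_real_differentiable)
  define x where "x = p / \<rho>"
  have x: "x > 0" using p r by (simp add: x_def)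
  have pos: "1 + x^2 > 0" by (simp add: add_pos_nonneg)
  define d where "d = x / sqrt (1 + x^2) + 1"
  have dt: "(taub has_field_derivative d) (at x)"
    unfolding taub_def[abs_def] d_def using pos
    by (auto intro!: derivative_eq_intros simp: field_simps)
  have tp: "((\<lambda>q. taub (q / \<rho>)) has_field_derivative d * (1 / \<rho>)) (at p)"
    by (rule DERIV_chain2[of taub]) (use dt r in \<open>auto simp: x_def intro!: derivative_eq_intros\<close>)
  have tr: "((\<lambda>q. taub (p / q)) has_field_derivative d * (- p / \<rho>^2)) (at \<rho>)"
    by (rule DERIV_chain2[of taub])
       (use dt r in \<open>auto simp: x_def power2_eq_square intro!: derivative_eq_intros\<close>)
  have "deriv (\<lambda>q. H q \<rho>) p - d * (1 / \<rho>) = 0"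
  proof (rule DERIV_local_min[where d = p])
    show "((\<lambda>q. H q \<rho> - taub (q / \<rho>)) has_field_derivative deriv (\<lambda>q. H q \<rho>) p - d * (1 / \<rho>)) (at p)"
      by (rule DERIV_diff[OF dp tp])
    show "\<forall>y. \<bar>p - y\<bar> < p \<longrightarrow> H p \<rho> - taub (p / \<rho>) \<le> H y \<rho> - taub (y / \<rho>)"
      using ge[OF _ r] eq by (auto simp: abs_if split: if_splits)
  qed (use p in simp)
  hence 1: "deriv (\<lambda>q. H q \<rho>) p = d / \<rho>" by simp
  have "deriv (\<lambda>q. H p q) \<rho> - d * (- p / \<rho>^2) = 0"
  proof (rule DERIV_local_min[where d = \<rho>])
    show "((\<lambda>q. H p q - taub (p / q)) has_field_derivative deriv (\<lambda>q. H p q) \<rho> - d * (- p / \<rho>^2)) (at \<rho>)"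
      by (rule DERIV_diff[OF dr tr])
    show "\<forall>y. \<bar>\<rho> - y\<bar> < \<rho> \<longrightarrow> H p \<rho> - taub (p / \<rho>) \<le> H p y - taub (p / y)"
      using ge[OF p] eq by (auto simp: abs_if split: if_splits)
  qed (use r in simp)
  hence 2: "deriv (\<lambda>q. H p q) \<rho> = - (d * x) / \<rho>" using r by (simp add: x_def power2_eq_square)
  have "H p \<rho> * (1 / \<rho> - deriv (\<lambda>p. H p \<rho>) p) < deriv (\<lambda>\<rho>. H p \<rho>) \<rho>"
    using eos p r unfolding eos_def by blast
  hence "taub x * (1 / \<rho> - d / \<rho>) < - (d * x) / \<rho>" unfolding 1 2 eq x_def[symmetric] .
  hence "taub x * (1 / \<rho> - d / \<rho>) * \<rho> < - (d * x) / \<rho> * \<rho>" using r by (rule mult_strict_right_mono)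
  moreover have "taub x * (1 / \<rho> - d / \<rho>) * \<rho> = taub x * (1 - d)" using r by (simp add: field_simps)
  ultimately have "taub x * (1 - d) < - (d * x)" using r by simp
  moreover have "taub x * (1 - d) = - (d * x)"
  proof -
    define R where "R = sqrt (1 + x^2)"
    have R: "R > 0" "R * R = 1 + x^2" using pos by (auto simp: R_def)
    show ?thesis unfolding taub_def d_def R_def[symmetric] using R(1) by (simp add: field_simps)
  qed
  ultimately show False by simp
qed

lemma inner3: "x \<bullet> y = x$1 * y$1 + x$2 * y$2 + x$3 * y$3" for x y :: "real^3"
  by (simp add: inner_vec_def sum_3)

text \<open>Bounding \<open>r * f\<close> by \<open>energy_ge_source\<close> costs r^2 |v - w|^2 /
  2, while \<open>fluid_time\<close> leaves a reserve of \<rho> H |v - w|^2 / 2. Equating the two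
  gives r = +- sqrt(\<rho> H), which is the origin of the square root in \<open>jump_sigma\<close>.
  The expression between the bars is the contraction of the source term with \<open>nst w C\<close>,
  corrected by \<open>w \<bullet> C\<close>.\<close>

lemma source_ineq:
  assumes eos: "eos H" and p: "p > 0" and r: "\<rho> > 0" and v: "norm v < 1" and w: "norm w < 1"
  shows "sqrt (\<rho> * H p \<rho>) * \<bar>(v \<bullet> B) * (1 - v \<bullet> w) - (1 - v \<bullet> v) * (w \<bullet> B) + (w \<bullet> C) * (1 - v \<bullet> w) - (1 - w \<bullet> w) * (v \<bullet> C)\<bar>
     < conserved H \<rho> p v B \<bullet> nst w C + pst w C"
proof -
  define f where "f = (v \<bullet> B) * (1 - v \<bullet> w) - (1 - v \<bullet> v) * (w \<bullet> B) + (w \<bullet> C) * (1 - v \<bullet> w) - (1 - w \<bullet> w) * (v \<bullet> C)"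
  define s where "s = sqrt (1 - (norm v)^2)"
  define t where "t = sqrt (1 - (norm w)^2)"
  have vv: "v \<bullet> v < 1" and ww: "w \<bullet> w < 1" using v w norm_lt_1_inner by auto
  have s: "s > 0" "s \<le> 1" "s^2 = 1 - v \<bullet> v" using vv by (auto simp: s_def power2_norm_eq_inner)
  have t: "t > 0" "t^2 = 1 - w \<bullet> w" using ww by (auto simp: t_def power2_norm_eq_inner)
  define h where "h = H p \<rho>"
  have x: "p / \<rho> > 0" using p r by simp
  have h: "h > taub (p / \<rho>)" unfolding h_def by (rule eos_strict[OF eos p r])
  have h0: "h > 0" using h taub_ge(2)[OF x] by simp
  define aa where "aa = v \<bullet> v - 2 * (v \<bullet> w) + w \<bullet> w"
  have "aa = (v - w) \<bullet> (v - w)" by (simp add: aa_def inner_diff_left inner_diff_right inner_commute)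
  hence aa: "aa \<ge> 0" by simp
  have "2 * (1 - v \<bullet> w) = aa + s^2 + t^2" unfolding s t aa_def by simp
  hence "h * aa / 2 < h * ((1 - v \<bullet> w) / s^2) - p / \<rho> - t / s"
    by (intro fluid_time x h s t aa)
  hence "\<rho> * (h * aa / 2) < \<rho> * (h * ((1 - v \<bullet> w) / s^2) - p / \<rho> - t / s)"
    using r by simp
  hence fl: "\<rho> * h * aa / 2 < \<rho> * h * ((1 - v \<bullet> w) / s^2) - p - \<rho> * (t / s)"
    using r by (simp add: right_diff_distrib mult.assoc)
  define T where "T = B \<bullet> B - ((1 - v \<bullet> v) * (B \<bullet> B) + (v \<bullet> B)^2) / 2 - ((B \<bullet> B) * (v \<bullet> w) - (v \<bullet> B) * (w \<bullet> B))
     - ((1 - w \<bullet> w) * (C \<bullet> B) + (w \<bullet> C) * (w \<bullet> B)) + ((1 - w \<bullet> w) * (C \<bullet> C) + (w \<bullet> C)^2) / 2"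
  have mt: "c * f \<le> T + c^2 / 2 * aa" for c
    using energy_ge_source[of "w$1" "w$2" "w$3" c "v$1" "B$1" "v$2" "B$2" "v$3" "B$3" "C$1" "C$2" "C$3", folded inner3] ww
    unfolding f_def T_def aa_def by simp
  define c where "c = sqrt (\<rho> * h)"
  have c: "c^2 = \<rho> * h" using r h0 by (simp add: c_def)
  have "c * f \<le> T + c^2 / 2 * aa" "(- c) * f \<le> T + (- c)^2 / 2 * aa" by (rule mt)+
  hence "c * \<bar>f\<bar> \<le> T + \<rho> * h * aa / 2" using c by (auto simp: abs_if)
  also have "\<dots> < T + (\<rho> * h * ((1 - v \<bullet> w) / s^2) - p - \<rho> * (t / s))" using fl by simp
  also have "\<dots> = conserved H \<rho> p v B \<bullet> nst w C + pst w C"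
  proof -
    have ls: "lorentz v = 1 / s" by (simp add: lorentz_def s_def)
    have l2: "(lorentz v)^2 = 1 / s^2" by (simp add: ls power_divide)
      have pt: "ptot p v B = p + (s^2 * (B \<bullet> B) + (v \<bullet> B)^2) / 2"
      unfolding ptot_def l2 by (simp add: power2_norm_eq_inner)
    have "conserved H \<rho> p v B \<bullet> nst w C + pst w C =
       - (\<rho> / s) * t - ((\<rho> * h / s^2 + B \<bullet> B) * (v \<bullet> w) - (v \<bullet> B) * (w \<bullet> B))
       - ((1 - w \<bullet> w) * (C \<bullet> B) + (w \<bullet> C) * (w \<bullet> B))
       + (\<rho> * h / s^2 - ptot p v B + B \<bullet> B) + ((1 - w \<bullet> w) * (C \<bullet> C) + (w \<bullet> C)^2) / 2"
      unfolding inner_nst pst_inner conserved_def state_sel l2 t_def[symmetric]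
      by (simp add: h_def ls power2_norm_eq_inner inner_diff_left inner_diff_right inner_commute)
    thus ?thesis unfolding pt T_def s(3) by (simp add: algebra_simps diff_divide_distrib add_divide_distrib)
  qed
  finally show ?thesis unfolding f_def c_def h_def .
qed


lemma nflux_eq:
  assumes "v = vel_of H U" and "B = mag U"
  shows "nflux H n U = (dens U * ndot n v,
     ndot n v *\<^sub>R mom U - ndot n B *\<^sub>R ((1 / (lorentz v)^2) *\<^sub>R B + (v \<bullet> B) *\<^sub>R v)
        + ptot (pres_of H U) v B *\<^sub>R (n$1 *\<^sub>R axis 1 1 + n$2 *\<^sub>R axis 2 1),
     ndot n v *\<^sub>R B - ndot n B *\<^sub>R v, ndot n (mom U))"
  unfolding nflux_def flux_def Let_def assms[symmetric] ndot_def
  by (simp add: algebra_simps)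

text \<open>The difference of the two sides is the contraction of the energy-momentum tensor with
  the null vector (1, -n). It splits into an electromagnetic part \<open>T\<close>, handled by
  \<open>null_energy_nonneg\<close>, and a fluid part, handled by \<open>fluid_null\<close>.\<close>

lemma flux_ineq:
  assumes eos: "eos H" and p: "p > 0" and r: "\<rho> > 0" and v: "norm v < 1" and w: "norm w < 1" and n: "norm n = 1"
    and U: "U = conserved H \<rho> p v B" and prim: "prim H U = (\<rho>, p, v)"
  shows "nflux H n U \<bullet> nst w C + ndot n w * pst w C - ndot n (mag U) * (w \<bullet> C) < U \<bullet> nst w C + pst w C"
proof -
  \<comment> \<open>Orthonormal coordinates whose first axis is -n, so that the null direction (1,
    e1) of \<open>null_energy_nonneg\<close> becomes (1, -n).\<close>
  define a1 where "a1 = (\<lambda>x::real^3. - ndot n x)"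
  define a2 where "a2 = (\<lambda>x::real^3. n$1 * x$2 - n$2 * x$1)"
  define a3 where "a3 = (\<lambda>x::real^3. x$3)"
  have n1: "n$1 * n$1 + n$2 * n$2 = 1"
    using n by (simp add: norm_eq_1 inner_vec_def sum_2)
  have P: "x \<bullet> y = a1 x * a1 y + a2 x * a2 y + a3 x * a3 y" for x y
  proof -
    have "a1 x * a1 y + a2 x * a2 y = (n$1 * n$1 + n$2 * n$2) * (x$1 * y$1 + x$2 * y$2)"
      unfolding a1_def a2_def ndot_def by algebra
    thus ?thesis unfolding n1 inner3 a3_def by simp
  qed
  define k where "k = 1 - ndot n v"
  define k' where "k' = 1 - ndot n w"
  define s where "s = sqrt (1 - (norm v)^2)"
  define t where "t = sqrt (1 - (norm w)^2)"
  have vv: "v \<bullet> v < 1" and ww: "w \<bullet> w < 1" using v w norm_lt_1_inner by auto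
  have s: "s > 0" "s^2 = 1 - v \<bullet> v" using vv by (auto simp: s_def power2_norm_eq_inner)
  have t: "t > 0" "t^2 = 1 - w \<bullet> w" using ww by (auto simp: t_def power2_norm_eq_inner)
  have nd: "\<bar>ndot n x\<bar> \<le> norm x" for x
  proof -
    have "(ndot n x)^2 \<le> x \<bullet> x" unfolding P[of x x] a1_def by (simp add: power2_eq_square)
    thus ?thesis by (simp add: abs_le_square_iff[of "ndot n x" "norm x", simplified] power2_norm_eq_inner)
  qed
  have k: "k > 0" "k' > 0" using nd[of v] nd[of w] v w by (auto simp: k_def k'_def)
  define h where "h = H p \<rho>"
  have x: "p / \<rho> > 0" using p r by simp
  have h: "h > taub (p / \<rho>)" unfolding h_def by (rule eos_strict[OF eos p r])
  have vw: "v \<bullet> w \<le> norm v * norm w" by (rule norm_cauchy_schwarz)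
  have vw1: "norm v * norm w < 1" using v w
    by (metis mult_less_cancel_right2 mult_strict_mono mult.right_neutral norm_ge_zero less_le_trans order_le_less zero_less_one mult_zero_left mult_zero_right)
  have "(s * t)^2 \<le> (1 - norm v * norm w)^2"
  proof -
    have "(1 - norm v * norm w)^2 - (s * t)^2 = (norm v - norm w)^2"
      unfolding power_mult_distrib s(2) t(2) power2_norm_eq_inner[symmetric]
      by (simp add: power2_eq_square algebra_simps)
    thus ?thesis using zero_le_power2[of "norm v - norm w"] by linarith
  qed
  hence "s * t \<le> 1 - norm v * norm w" by (rule power2_le_imp_le) (use vw1 in simp)
  hence "s * t \<le> 1 - v \<bullet> w" using vw by simp
  hence g: "(1 - v \<bullet> w) / (s * t) \<ge> 1" using s t by (simp add: field_simps)
  \<comment> \<open>The component of \<open>k' *\<^sub>R v - k *\<^sub>R w\<close> along n is k' -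
    k, because n . v = 1 - k and n . w = 1 - k'. That this component is at most the norm is the
    claim.\<close>
  have q0: "k^2 * t^2 - 2 * (1 - v \<bullet> w) * k * k' + k'^2 * s^2 \<le> 0"
  proof -
    have "(k' - k)^2 \<le> (k' *\<^sub>R v - k *\<^sub>R w) \<bullet> (k' *\<^sub>R v - k *\<^sub>R w)"
    proof -
      have "a1 (k' *\<^sub>R v - k *\<^sub>R w) = k - k'"
        unfolding a1_def k_def k'_def ndot_def by (simp add: algebra_simps)
      hence "(k' *\<^sub>R v - k *\<^sub>R w) \<bullet> (k' *\<^sub>R v - k *\<^sub>R w) \<ge> (k - k') * (k - k')"
        unfolding P[of "k' *\<^sub>R v - k *\<^sub>R w"] by simp
      thus ?thesis by (simp add: power2_eq_square algebra_simps)
    qed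
    also have "\<dots> = k'^2 * (v \<bullet> v) - 2 * k * k' * (v \<bullet> w) + k^2 * (w \<bullet> w)"
      by (simp add: inner_diff_left inner_diff_right inner_commute power2_eq_square algebra_simps)
    finally show ?thesis unfolding s t by (simp add: power2_eq_square algebra_simps)
  qed
  \<comment> \<open>Normalized by the Lorentz factors: \<open>k / s\<close> and
    \<open>k' / t\<close> are the frequencies of the null direction for \<open>v\<close> and
    \<open>w\<close>, and \<open>(1 - v \<bullet> w) / (s * t)\<close> is their relative Lorentz
    factor.\<close>
  have q: "(k / s)^2 - 2 * ((1 - v \<bullet> w) / (s * t)) * (k / s) * (k' / t) + (k' / t)^2 \<le> 0"
  proof -
    have "(k / s)^2 - 2 * ((1 - v \<bullet> w) / (s * t)) * (k / s) * (k' / t) + (k' / t)^2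
      = (k^2 * t^2 - 2 * (1 - v \<bullet> w) * k * k' + k'^2 * s^2) / (s * t)^2"
      using s(1) t(1) by (simp add: field_simps power2_eq_square)
    thus ?thesis using q0 by (simp add: divide_nonpos_nonneg)
  qed
  have "p / \<rho> * (k' / t) + k / s < h * ((1 - v \<bullet> w) / (s * t)) * (k / s)"
    by (rule fluid_null[OF x h _ g q]) (use k s in simp)
  hence "\<rho> * t * (p / \<rho> * (k' / t) + k / s) < \<rho> * t * (h * ((1 - v \<bullet> w) / (s * t)) * (k / s))"
    using r t(1) by (intro mult_strict_left_mono) auto
  moreover have "\<rho> * t * (p / \<rho> * (k' / t) + k / s) = p * k' + \<rho> / s * t * k"
    using r t(1) s(1) by (simp add: field_simps)
  moreover have "\<rho> * t * (h * ((1 - v \<bullet> w) / (s * t)) * (k / s)) = \<rho> * h / s^2 * ((1 - v \<bullet> w) * k)"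
    using r t(1) s(1) by (simp add: field_simps power2_eq_square)
  ultimately have fl: "p * k' + \<rho> / s * t * k < \<rho> * h / s^2 * ((1 - v \<bullet> w) * k)" by argo
  define T where "T = B \<bullet> B - ((1 - v \<bullet> v) * (B \<bullet> B) + (v \<bullet> B)^2) / 2 + (B \<bullet> B) * a1 v - (v \<bullet> B) * a1 B
     - (1 + a1 v) * ((B \<bullet> B) * (v \<bullet> w) - (v \<bullet> B) * (w \<bullet> B))
     + a1 B * ((1 - v \<bullet> v) * (w \<bullet> B) + (v \<bullet> B) * (v \<bullet> w)) - ((1 - v \<bullet> v) * (B \<bullet> B) + (v \<bullet> B)^2) / 2 * a1 w
     - (1 + a1 v) * ((1 - w \<bullet> w) * (C \<bullet> B) + (w \<bullet> C) * (w \<bullet> B)) + a1 B * ((1 - w \<bullet> w) * (v \<bullet> C) + (w \<bullet> C) * (v \<bullet> w))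
     + (1 + a1 w) * (((1 - w \<bullet> w) * (C \<bullet> C) + (w \<bullet> C)^2) / 2) - a1 B * (w \<bullet> C)"
  have T: "0 \<le> T"
    using null_energy_nonneg[of "a1 w" "a2 w" "a3 w" "a1 B" "a2 B" "a3 B" "a1 v" "a2 v" "a3 v" "a1 C" "a2 C" "a3 C", folded P] ww
    unfolding T_def by simp
  have ls: "lorentz v = 1 / s" by (simp add: lorentz_def s_def)
  have l2: "(lorentz v)^2 = 1 / s^2" by (simp add: ls power_divide)
  have pt: "ptot p v B = p + (s^2 * (B \<bullet> B) + (v \<bullet> B)^2) / 2"
    unfolding ptot_def l2 by (simp add: power2_norm_eq_inner)
  define N :: "real^3" where "N = n$1 *\<^sub>R axis 1 1 + n$2 *\<^sub>R axis 2 1"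
  have N: "N \<bullet> x = ndot n x" for x
    by (simp add: N_def ndot_def inner_add_left inner_axis' )
  have vel: "v = vel_of H U" "pres_of H U = p" by (simp_all add: vel_of_def pres_of_def prim)
  have Um: "mag U = B" "dens U = \<rho> / s" "mom U = (\<rho> * h / s^2 + B \<bullet> B) *\<^sub>R v - (v \<bullet> B) *\<^sub>R B"
    "ener U = \<rho> * h / s^2 - ptot p v B + B \<bullet> B"
    by (simp_all add: U conserved_def l2 h_def power2_norm_eq_inner) (simp add: ls)
  have ndl: "ndot n (x - y) = ndot n x - ndot n y" "ndot n (c *\<^sub>R x) = c * ndot n x" for x y c
    by (simp_all add: ndot_def algebra_simps)
  define m where "m = mom U"
  have F: "nflux H n U \<bullet> nst w C = - (\<rho> / s * ndot n v) * t
     - (ndot n v * (m \<bullet> w) - ndot n B * (s^2 * (B \<bullet> w) + (v \<bullet> B) * (v \<bullet> w)) + ptot p v B * ndot n w)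
     - ((1 - w \<bullet> w) * (ndot n v * (C \<bullet> B) - ndot n B * (C \<bullet> v))
         + (w \<bullet> C) * (ndot n v * (w \<bullet> B) - ndot n B * (w \<bullet> v))) + ndot n m"
    unfolding nflux_eq[OF vel(1) refl] vel(2) N_def[symmetric] inner_nst state_sel t_def[symmetric] Um(1,2) m_def[symmetric] l2
    by (simp add: inner_add_left inner_diff_left inner_diff_right N)
  have "U \<bullet> nst w C + pst w C - nflux H n U \<bullet> nst w C - ndot n w * pst w C + ndot n B * (w \<bullet> C)
     = T + (\<rho> * h / s^2 * ((1 - v \<bullet> w) * k) - (p * k' + \<rho> / s * t * k))"
  proof -
    define G where "G = \<rho> * h / s^2"
    define J where "J = \<rho> / s * t"
    define PT where "PT = ptot p v B"
    have m1: "m \<bullet> w = (G + B \<bullet> B) * (v \<bullet> w) - (v \<bullet> B) * (w \<bullet> B)" "ndot n m = (G + B \<bullet> B) * ndot n v - (v \<bullet> B) * ndot n B"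
      unfolding m_def Um(3) ndl G_def by (simp_all add: inner_diff_left inner_diff_right inner_commute)
    have pst: "pst w C = ((1 - w \<bullet> w) * (C \<bullet> C) + (w \<bullet> C)^2) / 2" by (rule pst_inner)
    have PT: "PT = p + ((1 - v \<bullet> v) * (B \<bullet> B) + (v \<bullet> B)^2) / 2" unfolding PT_def pt s(2) ..
    have UU: "U \<bullet> nst w C = - J - m \<bullet> w - ((1 - w \<bullet> w) * (C \<bullet> B) + (w \<bullet> C) * (w \<bullet> B)) + (G - PT + B \<bullet> B)"
      unfolding inner_nst Um t_def[symmetric] m_def J_def G_def PT_def by simp
    have FF: "nflux H n U \<bullet> nst w C = - J * ndot n v
     - (ndot n v * (m \<bullet> w) - ndot n B * ((1 - v \<bullet> v) * (w \<bullet> B) + (v \<bullet> B) * (v \<bullet> w)) + PT * ndot n w)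
     - ((1 - w \<bullet> w) * (ndot n v * (C \<bullet> B) - ndot n B * (v \<bullet> C))
         + (w \<bullet> C) * (ndot n v * (w \<bullet> B) - ndot n B * (v \<bullet> w))) + ndot n m"
      unfolding F s(2) J_def PT_def by (simp add: inner_commute)
    define Y where "Y = ((1 - v \<bullet> v) * (B \<bullet> B) + (v \<bullet> B)^2) / 2"
    define Z where "Z = ((1 - w \<bullet> w) * (C \<bullet> C) + (w \<bullet> C)^2) / 2"
    show ?thesis
      unfolding FF UU m1 pst T_def k_def k'_def PT G_def[symmetric] J_def[symmetric] a1_def Y_def[symmetric] Z_def[symmetric]
      by (simp add: algebra_simps)
  qed
  thus ?thesis using T fl by (simp add: Um(1))
qed

section \<open>The admissible set as an intersection of half spaces\<close>

definition Gstar :: "state set" where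
  "Gstar = {U. dens U > 0 \<and> (\<forall>w C. norm w < 1 \<longrightarrow> U \<bullet> nst w C + pst w C > 0)}"

lemma nst_mag:
  "U \<bullet> nst w (mag U) + pst w (mag U) = ener U - dens U * sqrt (1 - w \<bullet> w) - mom U \<bullet> w
     - ((1 - w \<bullet> w) * (mag U \<bullet> mag U) + (w \<bullet> mag U)^2) / 2"
  unfolding inner_nst pst_inner power2_norm_eq_inner power2_eq_square[of "w \<bullet> mag U"] by argo

text \<open>As a function of \<open>C\<close> the left out difference is the positive form
  \<open>pst w (mag U - C)\<close>. Thus the auxiliary field \<open>C\<close> linearizes a term
  quadratic in \<open>mag U\<close>, and the strongest constraint for given \<open>w\<close> is the
  one with \<open>C = mag U\<close>.\<close>

lemma nst_ge_nst_mag: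
  assumes "norm w < 1"
  shows "U \<bullet> nst w (mag U) + pst w (mag U) \<le> U \<bullet> nst w C + pst w C"
proof -
  define B where "B = mag U"
  have "(U \<bullet> nst w C + pst w C) - (U \<bullet> nst w B + pst w B)
    = ((1 - w \<bullet> w) * ((B - C) \<bullet> (B - C)) + (w \<bullet> (B - C))^2) / 2"
    unfolding inner_nst pst_inner B_def[symmetric]
    by (simp add: inner_diff_left inner_diff_right inner_commute power2_eq_square field_simps)
  also have "\<dots> \<ge> 0" using norm_lt_1_inner[OF assms] by simp
  finally show ?thesis by (simp add: B_def)
qed

text \<open>With m2 = |m|^2, \<mu> = m . B and b = |B|^2 the quotient is the squared velocity
  belonging to a trial value of \<rho> H W^2; a larger trial value means a slower fluid.\<close>

lemma antimono_velocity_square: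
  fixes b m2 \<mu> :: real
  assumes "b \<ge> 0" "m2 \<ge> 0" "0 < x" "x \<le> y"
  shows "(m2 + 2 * \<mu>^2 / y + \<mu>^2 * b / y^2) / (y + b)^2 \<le> (m2 + 2 * \<mu>^2 / x + \<mu>^2 * b / x^2) / (x + b)^2"
  using assms by (intro frac_le add_mono divide_left_mono power_mono mult_pos_pos) auto

lemma eos_antimono:
  assumes eos: "eos H" and p: "p > 0" and r: "0 < \<rho>" "\<rho> \<le> \<rho>'"
  shows "H p \<rho>' \<le> H p \<rho>"
proof (rule DERIV_nonpos_imp_nonincreasing[OF r(2)])
  fix x assume x: "\<rho> \<le> x" "x \<le> \<rho>'"
  hence x0: "x > 0" using r by simp
  have "(\<lambda>(p, \<rho>). H p \<rho>) differentiable (at (p, x))" using eos p x0 unfolding eos_def by blast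
  then obtain F where F: "((\<lambda>(p, \<rho>). H p \<rho>) has_derivative F) (at (p, x))"
    by (auto simp: differentiable_def)
  have "((\<lambda>q. (\<lambda>(p, \<rho>). H p \<rho>) (p, q)) has_derivative (\<lambda>h. F (0, h))) (at x)"
    by (rule has_derivative_compose[of "\<lambda>q. (p, q)" _ _ _ "\<lambda>(p, \<rho>). H p \<rho>"])
       (use F in \<open>auto intro!: derivative_eq_intros\<close>)
  hence "(\<lambda>q. H p q) differentiable (at x)" by (auto simp: differentiable_def)
  hence "((\<lambda>q. H p q) has_field_derivative deriv (\<lambda>q. H p q) x) (at x)"
    by (simp add: DERIV_deriv_iff_real_differentiable)
  moreover have "deriv (\<lambda>q. H p q) x < 0" using eos p x0 unfolding eos_def by blast
  ultimately show "\<exists>y. (H p has_field_derivative y) (at x) \<and> y \<le> 0" by (auto intro: less_imp_le)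
qed

text \<open>The primitive variables are recovered from \<open>\<xi> = \<rho> H W\<^sup>2\<close>: velocity and pressure are explicit
  functions of \<open>\<xi>\<close>, and the equation of state becomes a scalar equation for \<open>\<xi>\<close>.\<close>

lemma Gstar_imp_admissible:
  assumes eos: "eos H" and cold: "no_cold_energy H" and U: "U \<in> Gstar"
  shows "U \<in> admissible H"
proof -
  define D where "D = dens U"
  define m where "m = mom U"
  define B where "B = mag U"
  define E where "E = ener U"
  have D: "D > 0" using U by (simp add: Gstar_def D_def)
  have key: "D * sqrt (1 - v \<bullet> v) + m \<bullet> v + ((1 - v \<bullet> v) * (B \<bullet> B) + (v \<bullet> B)^2) / 2 < E" if "norm v < 1" for v
  proof -
    have "U \<bullet> nst v (mag U) + pst v (mag U) > 0" using U that unfolding Gstar_def by blast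
    thus ?thesis unfolding nst_mag D_def m_def B_def E_def by argo
  qed
  define b where "b = B \<bullet> B"
  define \<mu> where "\<mu> = m \<bullet> B"
  have b: "b \<ge> 0" by (simp add: b_def)
  \<comment> \<open>The solution \<open>v\<close> of m = (x + b) v - (v . B) B. Its inner product
    with \<open>B\<close> must be \<mu> / x, which removes the unknown from the right-hand
    side.\<close>
  define vf where "vf = (\<lambda>x::real. (1 / (x + b)) *\<^sub>R (m + (\<mu> / x) *\<^sub>R B))"
  define sq where "sq = (\<lambda>x. (m \<bullet> m + 2 * \<mu>^2 / x + \<mu>^2 * b / x^2) / (x + b)^2)"
  have sq: "vf x \<bullet> vf x = sq x" if "x > 0" for x
  proof -
    have "(m + (\<mu> / x) *\<^sub>R B) \<bullet> (m + (\<mu> / x) *\<^sub>R B) = m \<bullet> m + 2 * \<mu>^2 / x + \<mu>^2 * b / x^2"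
      using that by (simp add: inner_add_left inner_add_right inner_commute[of B m] b_def \<mu>_def power2_eq_square field_simps)
    thus ?thesis unfolding vf_def sq_def by (simp add: power2_eq_square)
  qed
  have vB: "vf x \<bullet> B = \<mu> / x" if "x > 0" for x
  proof -
    have "vf x \<bullet> B = (\<mu> + \<mu> / x * b) / (x + b)"
      unfolding vf_def by (simp add: inner_add_left b_def \<mu>_def)
    also have "\<mu> + \<mu> / x * b = \<mu> / x * (x + b)" using that by (simp add: field_simps)
    also have "\<dots> / (x + b) = \<mu> / x" using that b by simp
    finally show ?thesis .
  qed
  have mv: "m = (x + b) *\<^sub>R vf x - (vf x \<bullet> B) *\<^sub>R B" if "x > 0" for x
  proof -
    have "x + b \<noteq> 0" using that b by simp
    hence "(x + b) *\<^sub>R vf x = m + (\<mu> / x) *\<^sub>R B" by (simp add: vf_def)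
    thus ?thesis unfolding vB[OF that] by simp
  qed
  have sq_anti: "sq y \<le> sq x" if "0 < x" "x \<le> y" for x y
    unfolding sq_def by (rule antimono_velocity_square) (use that b in auto)
  have sq_nn: "sq x \<ge> 0" if "0 < x" for x using sq[OF that] by (metis inner_ge_zero)
  have sq_cont: "continuous_on {0<..} sq"
    unfolding sq_def using b by (intro continuous_intros) (auto simp: add_pos_nonneg less_imp_neq[symmetric] dest: add_pos_nonneg[OF _ b])
  \<comment> \<open>The pressure that the energy component assigns to the trial value
    \<open>x\<close>, namely E = x - ptot + b solved for p.\<close>
  define P where "P = (\<lambda>x. x + b - E - ((1 - sq x) * b + (\<mu> / x)^2) / 2)"
  have P_cont: "continuous_on {0<..} P"
    unfolding P_def by (intro continuous_intros sq_cont) auto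
  \<comment> \<open>The half space inequality is tested with the trial velocity itself,
    \<open>w = vf x\<close>.\<close>
  have P_less: "P x < x * (1 - sq x) - D * sqrt (1 - sq x)" if x: "x > 0" and s: "sq x < 1" for x
  proof -
    define v where "v = vf x"
    have "norm v < 1" using s sq[OF x] by (simp add: v_def norm_eq_sqrt_inner)
    from key[OF this] have "D * sqrt (1 - sq x) + m \<bullet> v + ((1 - sq x) * b + (\<mu> / x)^2) / 2 < E"
      unfolding v_def sq[OF x] vB[OF x] b_def .
    moreover have "m \<bullet> v = (x + b) * sq x - (\<mu> / x)^2"
      by (subst mv[OF x]) (simp add: v_def inner_diff_left sq[OF x] vB[OF x] inner_commute[of B] power2_eq_square)
    ultimately show ?thesis unfolding P_def by (simp add: field_simps)
  qed
  have P_large: "P x \<ge> x / 2" if "x \<ge> 1" "x \<ge> 2 * (E + \<mu>^2)" for x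
  proof -
    have "(\<mu> / x)^2 \<le> \<mu>^2"
    proof -
      have "\<mu>^2 / x^2 \<le> \<mu>^2 / 1" using that by (intro divide_left_mono) (auto simp: one_le_power)
      thus ?thesis by (simp add: power_divide)
    qed
    moreover have "sq x * b \<ge> 0" using sq_nn[of x] b that by simp
    moreover have "\<mu>^2 \<ge> 0" by simp
    moreover have "(1 - sq x) * b = b - sq x * b" by (simp add: left_diff_distrib)
    ultimately show ?thesis unfolding P_def using that b by argo
  qed
  \<comment> \<open>At \<open>a\<close> one has a = D W, the value of \<rho> H W^2 for
    \<open>H\<close> = 1. There the upper bound in \<open>P_less\<close> vanishes, hence
    \<open>P a\<close> is negative.\<close>
  obtain a where a: "a \<ge> D" "a^2 * (1 - sq a) = D^2"
  proof -
    define X where "X = max (2 * D) (max 1 (2 * (m \<bullet> m + 2 * \<mu>^2 + \<mu>^2 * b)))"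
    have X: "X \<ge> 2 * D" "X \<ge> 1" "X \<ge> 2 * (m \<bullet> m + 2 * \<mu>^2 + \<mu>^2 * b)" by (auto simp: X_def)
    have "sq X \<le> 1 / 2"
    proof -
      have "sq X \<le> (m \<bullet> m + 2 * \<mu>^2 + \<mu>^2 * b) / X"
        unfolding sq_def
      proof (rule frac_le)
        have "2 * \<mu>^2 / X \<le> 2 * \<mu>^2 / 1" using X by (intro divide_left_mono) auto
        moreover have "\<mu>^2 * b / X^2 \<le> \<mu>^2 * b / 1" using X b by (intro divide_left_mono) (auto simp: one_le_power)
        ultimately show "m \<bullet> m + 2 * \<mu>\<^sup>2 / X + \<mu>\<^sup>2 * b / X\<^sup>2 \<le> m \<bullet> m + 2 * \<mu>\<^sup>2 + \<mu>\<^sup>2 * b" by simp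
        have "X * 1 \<le> (X + b) * (X + b)" using X b by (intro mult_mono) auto
        thus "X \<le> (X + b)^2" by (simp add: power2_eq_square)
      qed (use X b in auto)
      also have "\<dots> \<le> 1 / 2" using X by (simp add: field_simps)
      finally show ?thesis .
    qed
    have "\<exists>x\<ge>D. x \<le> X \<and> x^2 * (1 - sq x) = D^2"
    proof (rule IVT')
      show "D^2 * (1 - sq D) \<le> D^2" using sq_nn[OF D] D by (simp add: mult_left_le)
      have "(2 * D)^2 * (1 / 2) \<le> X^2 * (1 - sq X)"
        using X D \<open>sq X \<le> 1 / 2\<close> by (intro mult_mono power_mono) auto
      moreover have "D^2 \<le> (2 * D)^2 * (1 / 2)" by (simp add: power2_eq_square)
      ultimately show "D^2 \<le> X^2 * (1 - sq X)" by linarith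
      show "D \<le> X" using X D by simp
      show "continuous_on {D..X} (\<lambda>x. x^2 * (1 - sq x))"
        using D by (intro continuous_intros continuous_on_subset[OF sq_cont]) auto
    qed
    thus ?thesis using that by blast
  qed
  have a0: "a > 0" using a D by simp
  have sqa: "sq a < 1"
  proof (rule ccontr)
    assume "\<not> sq a < 1"
    hence "a^2 * (1 - sq a) \<le> 0" by (simp add: mult_nonneg_nonpos)
    thus False using a D by simp
  qed
  have sq1: "sq x < 1" "x > 0" if "x \<ge> a" for x using sq_anti[OF a0 that] sqa a0 that by auto
  have Pa: "P a < 0"
  proof -
    define z where "z = sqrt (1 - sq a)"
    have z: "z > 0" "z^2 = 1 - sq a" using sqa by (auto simp: z_def)
    have "(a * z)^2 = D^2" using a by (simp add: power_mult_distrib z)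
    hence "a * z = D" using a0 z D by (metis less_imp_le mult_pos_pos power2_eq_imp_eq)
    hence "a * (1 - sq a) - D * z = a * (z * z) - (a * z) * z" using z(2)[symmetric] by (simp only: power2_eq_square)
    hence "a * (1 - sq a) - D * z = 0" by simp
    thus ?thesis using P_less[OF a0 sqa] by (simp add: z_def)
  qed
  define c where "c = Max {a, 1, 2 * (E + \<mu>^2)}"
  have c: "c \<ge> a" "c \<ge> 1" "c \<ge> 2 * (E + \<mu>^2)" by (auto simp: c_def)
  have Pc: "P x \<ge> x / 2" if "x \<ge> c" for x using P_large[of x] c that by auto
  \<comment> \<open>The last zero \<open>z\<close> of \<open>P\<close> is selected, so that the
    pressure is positive on the whole ray beyond it. \<open>P\<close> may have several
    zeros.\<close>
  have "\<exists>x\<in>{x\<in>{a..c}. P x \<le> 0}. \<forall>y\<in>{x\<in>{a..c}. P x \<le> 0}. y \<le> x"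
  proof (rule compact_attains_sup)
    have "continuous_on {a..c} P" by (rule continuous_on_subset[OF P_cont]) (use a0 in auto)
    hence "closed {x\<in>{a..c}. P x \<le> 0}"
      by (intro continuous_on_closed_Collect_le) auto
    moreover have "bounded {x\<in>{a..c}. P x \<le> 0}" by (rule bounded_subset[OF bounded_closed_interval]) auto
    ultimately show "compact {x\<in>{a..c}. P x \<le> 0}" by (simp add: compact_eq_bounded_closed)
    show "{x\<in>{a..c}. P x \<le> 0} \<noteq> {}" using Pa c by (auto intro!: exI[of _ a])
  qed
  then obtain z where z: "a \<le> z" "z \<le> c" "P z \<le> 0" "\<And>y. a \<le> y \<Longrightarrow> y \<le> c \<Longrightarrow> P y \<le> 0 \<Longrightarrow> y \<le> z"
    by auto
  have z0: "z > 0" using z a0 by simp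
  have Ppos: "P x > 0" if "x > z" for x
  proof (cases "x \<le> c")
    case True thus ?thesis using z(4)[of x] z(1) that by fastforce
  next
    case False thus ?thesis using Pc[of x] c by auto
  qed
  have lim_at: "((\<lambda>x. g x) \<longlongrightarrow> g z) (at_right z)" if "continuous_on {0<..} g" for g :: "real \<Rightarrow> real"
    using that z0 by (metis at_within_open continuous_on greaterThan_iff open_greaterThan tendsto_within_subset top_greatest)
  have ev_z: "eventually (\<lambda>x. x > z) (at_right z)" by (simp add: eventually_at_right_less)
  have Pz: "P z = 0"
  proof -
    have "P z \<ge> 0"
      by (rule tendsto_lowerbound[OF lim_at[OF P_cont]]) (use ev_z Ppos in \<open>auto elim!: eventually_mono intro: less_imp_le\<close>)
    thus ?thesis using z by simp
  qed
  define rf where "rf = (\<lambda>x. D * sqrt (1 - sq x))"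
  have rpos: "rf x > 0" if "x \<ge> a" for x using sq1[OF that] D by (simp add: rf_def)
  have rmono: "rf z \<le> rf x" if "x \<ge> z" for x
    using sq_anti[OF z0 that] D by (simp add: rf_def)
  have z_big: "D < z * sqrt (1 - sq z)"
  proof -
    have s: "sq z < 1" using sq1 z by simp
    define y where "y = sqrt (1 - sq z)"
    have y: "y > 0" "1 - sq z = y * y" using s by (auto simp: y_def)
    have "0 < z * (1 - sq z) - D * y" using P_less[OF z0 s] Pz by (simp add: y_def)
    hence "0 < z * (y * y) - D * y" unfolding y(2) .
    hence "0 < y * (z * y - D)" by (simp add: algebra_simps)
    hence "0 < z * y - D" using y(1) by (simp only: zero_less_mult_iff) linarith
    thus ?thesis unfolding y_def by linarith
  qed
  \<comment> \<open>With \<rho> = D / W, a fixed point of \<open>\<phi>\<close> is a trial value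
    consistent with the equation of state: x = \<rho> H W^2.\<close>
  define \<phi> where "\<phi> = (\<lambda>x. rf x * H (P x) (rf x) / (1 - sq x))"
  \<comment> \<open>The density is frozen at \<open>rf z\<close>, which is possible because
    \<open>H\<close> decreases in \<rho>. The limit of vanishing internal energy is assumed for each
    fixed density, without uniformity in \<rho>.\<close>
  have phi_le: "\<phi> x \<le> D * H (P x) (rf z) / sqrt (1 - sq x)" if "x > z" for x
  proof -
    have s: "sq x < 1" "x > 0" using sq1[of x] that z by auto
    define y where "y = sqrt (1 - sq x)"
    have y: "y > 0" "1 - sq x = y * y" using s by (auto simp: y_def)
    define h where "h = H (P x) (rf x)"
    have "\<phi> x = (D * y) * h / (1 - sq x)" unfolding \<phi>_def h_def rf_def y_def ..
    also have "\<dots> = D * h / y" unfolding y(2) using y(1) by simp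
    also have "\<dots> \<le> D * H (P x) (rf z) / y" unfolding h_def
      using eos_antimono[OF eos Ppos[OF that] rpos[OF z(1)] rmono] D that y(1)
      by (intro divide_right_mono mult_left_mono) auto
    also have "y = sqrt (1 - sq x)" by (rule y_def)
    finally show ?thesis .
  qed
  \<comment> \<open>As x decreases to z the pressure tends to 0 from above and
    \<open>H (P x) (rf z)\<close> tends to 1. The bound on \<open>\<phi>\<close> therefore tends to
    D / sqrt (1 - sq z), and this is below z by \<open>z_big\<close>.\<close>
  obtain x0 where x0: "x0 > z" "\<phi> x0 < x0"
  proof -
    have P0: "filterlim P (at_right 0) (at_right z)"
    proof -
      have "eventually (\<lambda>x. P x > 0) (at_right z)" using ev_z by eventually_elim (rule Ppos)
      thus ?thesis using lim_at[OF P_cont] Pz by (auto simp: filterlim_at elim!: eventually_mono)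
    qed
    have "((\<lambda>p. internal_energy H p (rf z)) \<longlongrightarrow> 0) (at_right 0)"
      using cold rpos[OF z(1)] unfolding no_cold_energy_def by blast
    from filterlim_compose[OF this P0] have e0: "((\<lambda>x. internal_energy H (P x) (rf z)) \<longlongrightarrow> 0) (at_right z)" .
    have "((\<lambda>x. internal_energy H (P x) (rf z) + 1 + P x / rf z) \<longlongrightarrow> 0 + 1 + P z / rf z) (at_right z)"
      by (intro tendsto_intros e0 lim_at P_cont) (use rpos[OF z(1)] in auto)
    hence H0: "((\<lambda>x. H (P x) (rf z)) \<longlongrightarrow> 1) (at_right z)" by (simp add: internal_energy_def Pz)
    have s: "sq z < 1" using sq1 z by simp
    have "((\<lambda>x. x - D * H (P x) (rf z) / sqrt (1 - sq x)) \<longlongrightarrow> z - D * 1 / sqrt (1 - sq z)) (at_right z)"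
      by (intro tendsto_intros H0 lim_at sq_cont) (use s in auto)
    moreover have "z - D * 1 / sqrt (1 - sq z) > 0" using z_big s by (simp add: field_simps)
    ultimately have "eventually (\<lambda>x. x - D * H (P x) (rf z) / sqrt (1 - sq x) > 0) (at_right z)"
      by (rule order_tendstoD)
    hence "eventually (\<lambda>x. x > z \<and> x - D * H (P x) (rf z) / sqrt (1 - sq x) > 0) (at_right z)"
      using ev_z by (rule eventually_conj[rotated])
    then obtain x where x: "x > z" "x - D * H (P x) (rf z) / sqrt (1 - sq x) > 0"
      using eventually_happens'[of "at_right z"] by (auto simp: trivial_limit_at_right_real)
    thus ?thesis using phi_le[of x] by (intro that[of x]) auto
  qed
  define x1 where "x1 = max c x0"
  have x1: "x1 \<ge> c" "x1 \<ge> x0" by (auto simp: x1_def)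
  \<comment> \<open>At the other end of the interval, \<open>H\<close> is at least 2 p / \<rho> and
    the pressure at least half of the trial value, which pushes \<open>\<phi>\<close> above the
    diagonal.\<close>
  have phi1: "\<phi> x1 \<ge> x1"
  proof -
    have zx: "x1 > z" using x0 x1 by simp
    have s: "sq x1 < 1" "x1 > 0" using sq1[of x1] zx z by auto
    have r: "rf x1 > 0" using rpos zx z by simp
    have p: "P x1 > 0" by (rule Ppos[OF zx])
    have "2 * (P x1 / rf x1) \<le> taub (P x1 / rf x1)" using p r by (intro taub_ge) simp
    also have "\<dots> \<le> H (P x1) (rf x1)" using eos_strict[OF eos p r] by simp
    finally have 1: "2 * P x1 \<le> rf x1 * H (P x1) (rf x1)" using r by (simp add: field_simps)
    have 2: "x1 \<le> 2 * P x1" using Pc[OF x1(1)] by simp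
    have "1 - sq x1 \<le> 1" using sq_nn s by simp
    hence "2 * P x1 * (1 - sq x1) \<le> 2 * P x1 * 1" using p by (intro mult_left_mono) auto
    hence "2 * P x1 \<le> 2 * P x1 / (1 - sq x1)" using s by (simp add: field_simps)
    also have "\<dots> \<le> \<phi> x1" unfolding \<phi>_def using 1 s by (intro divide_right_mono) auto
    finally show ?thesis using 2 by simp
  qed
  have "\<exists>x\<ge>x0. x \<le> x1 \<and> \<phi> x - x = 0"
  proof (rule IVT')
    show "\<phi> x0 - x0 \<le> 0" "0 \<le> \<phi> x1 - x1" "x0 \<le> x1" using x0 phi1 x1 by auto
    have sub: "{x0..x1} \<subseteq> {0<..}" using x0 z0 by auto
    have Hc: "continuous_on ({0<..} \<times> {0<..}) (\<lambda>(p, \<rho>). H p \<rho>)"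
      using eos unfolding eos_def
      by (auto intro!: continuous_at_imp_continuous_on differentiable_imp_continuous_within)
    have c1: "continuous_on {x0..x1} sq" "continuous_on {x0..x1} P"
      by (rule continuous_on_subset[OF _ sub], fact)+
    have c2: "continuous_on {x0..x1} rf" unfolding rf_def by (intro continuous_intros c1)
    have "continuous_on {x0..x1} (\<lambda>x. (\<lambda>(p, \<rho>). H p \<rho>) (P x, rf x))"
      by (rule continuous_on_compose2[OF Hc]) (use x0 z rpos Ppos in \<open>auto intro!: continuous_intros c1 c2\<close>)
    hence c3: "continuous_on {x0..x1} (\<lambda>x. H (P x) (rf x))" by simp
    have "1 - sq x \<noteq> 0" if "x \<in> {x0..x1}" for x using sq1[of x] that x0 z by auto
    thus "continuous_on {x0..x1} (\<lambda>x. \<phi> x - x)"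
      unfolding \<phi>_def by (intro continuous_intros c1 c2 c3) auto
  qed
  then obtain x where x: "x \<ge> x0" "\<phi> x = x" by auto
  have xz: "x > z" "x \<ge> a" using x x0 z by auto
  have xp: "x > 0" "sq x < 1" using sq1[OF xz(2)] by auto
  define v where "v = vf x"
  define \<rho> where "\<rho> = rf x"
  define p where "p = P x"
  have p: "p > 0" and r: "\<rho> > 0" using Ppos[OF xz(1)] rpos[OF xz(2)] by (auto simp: p_def \<rho>_def)
  have vv: "v \<bullet> v = sq x" "v \<bullet> B = \<mu> / x" using sq vB xp by (auto simp: v_def)
  have v: "norm v < 1" using vv xp by (simp add: norm_eq_sqrt_inner)
  have xi: "\<rho> * H p \<rho> * (lorentz v)^2 = x"
    unfolding lorentz_sq[OF v] vv using x(2) by (simp add: \<phi>_def \<rho>_def p_def)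
  have "internal_energy H p \<rho> > 0"
  proof -
    have "sqrt (1 + (p / \<rho>)^2) > 1" using p r by simp
    thus ?thesis using eos_strict[OF eos p r] unfolding internal_energy_def taub_def by linarith
  qed
  hence adm: "admissible_prim H \<rho> p v" using p r v by (simp add: admissible_prim_def)
  have "conserved H \<rho> p v B = U"
  proof (intro prod_eqI)
    have ls: "lorentz v = 1 / sqrt (1 - sq x)" unfolding lorentz_def power2_norm_eq_inner vv ..
    show "fst (conserved H \<rho> p v B) = fst U"
      using xp unfolding conserved_def ls \<rho>_def rf_def D_def dens_def by simp
    show "fst (snd (conserved H \<rho> p v B)) = fst (snd U)"
      unfolding conserved_def xi fst_conv snd_conv power2_norm_eq_inner
      using mv[OF xp(1)] unfolding v_def[symmetric] b_def[symmetric] by (simp add: m_def mom_def)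
    show "fst (snd (snd (conserved H \<rho> p v B))) = fst (snd (snd U))"
      by (simp add: conserved_def B_def mag_def)
    have "ptot p v B = p + ((1 - sq x) * b + (\<mu> / x)^2) / 2"
      unfolding ptot_def lorentz_sq[OF v] vv b_def by (simp add: power2_norm_eq_inner)
    thus "snd (snd (snd (conserved H \<rho> p v B))) = snd (snd (snd U))"
      unfolding conserved_def xi fst_conv snd_conv power2_norm_eq_inner b_def[symmetric]
      by (simp add: p_def P_def E_def ener_def)
  qed
  thus ?thesis using adm unfolding admissible_def by force
qed

section \<open>The bounds in conserved variables, and the function Psi\<close>

lemma prim_admissible:
  assumes "U \<in> admissible H"
  obtains \<rho> p v where "prim H U = (\<rho>, p, v)" "admissible_prim H \<rho> p v" "U = conserved H \<rho> p v (mag U)"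
proof -
  obtain \<rho> p v B where U: "U = conserved H \<rho> p v B" "admissible_prim H \<rho> p v"
    using assms unfolding admissible_def by auto
  have "mag U = B" by (simp add: U conserved_def)
  hence "case (\<rho>, p, v) of (\<rho>, p, v) \<Rightarrow> admissible_prim H \<rho> p v \<and> conserved H \<rho> p v (mag U) = U"
    using U by simp
  hence "case prim H U of (\<rho>, p, v) \<Rightarrow> admissible_prim H \<rho> p v \<and> conserved H \<rho> p v (mag U) = U"
    unfolding prim_def by (rule someI)
  thus ?thesis using that by (cases "prim H U") auto
qed

lemma source_bound:
  assumes eos: "eos H" and U: "U \<in> admissible H" and w: "norm w < 1"
  shows "\<bar>source H U \<bullet> nst w C + w \<bullet> C\<bar> \<le> (U \<bullet> nst w C + pst w C) / sqrt (rho_of H U * enth_of H U)"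
    and "U \<bullet> nst w C + pst w C > 0" and "dens U > 0" and "norm (vel_of H U) < 1"
    and "rho_of H U * enth_of H U > 0"
proof -
  obtain \<rho> p v where pr: "prim H U = (\<rho>, p, v)" "admissible_prim H \<rho> p v" "U = conserved H \<rho> p v (mag U)"
    using prim_admissible[OF U] by blast
  have p: "p > 0" and r: "\<rho> > 0" and v: "norm v < 1" using pr(2) by (auto simp: admissible_prim_def)
  define B where "B = mag U"
  have of: "rho_of H U = \<rho>" "enth_of H U = H p \<rho>" "vel_of H U = v"
    by (simp_all add: rho_of_def enth_of_def pres_of_def vel_of_def pr(1))
  have H: "H p \<rho> > 0" using eos_strict[OF eos p r] taub_ge(2)[of "p / \<rho>"] p r by simp
  thus rh: "rho_of H U * enth_of H U > 0" using r by (simp add: of)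
  have S: "source H U \<bullet> nst w C + w \<bullet> C = (v \<bullet> B) * (1 - v \<bullet> w) - (1 - v \<bullet> v) * (w \<bullet> B) + (w \<bullet> C) * (1 - v \<bullet> w) - (1 - w \<bullet> w) * (v \<bullet> C)"
    unfolding source_def Let_def of B_def[symmetric] inner_nst state_sel power2_norm_eq_inner
    by (simp add: inner_add_left inner_commute algebra_simps)
  have "sqrt (rho_of H U * enth_of H U) * \<bar>source H U \<bullet> nst w C + w \<bullet> C\<bar> < U \<bullet> nst w C + pst w C"
    unfolding S of using source_ineq[OF eos p r v w, of B C] pr(3) by (simp add: B_def)
  moreover have "sqrt (rho_of H U * enth_of H U) * \<bar>source H U \<bullet> nst w C + w \<bullet> C\<bar> \<ge> 0" using rh by simp
  ultimately show "\<bar>source H U \<bullet> nst w C + w \<bullet> C\<bar> \<le> (U \<bullet> nst w C + pst w C) / sqrt (rho_of H U * enth_of H U)"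
    and "U \<bullet> nst w C + pst w C > 0"
    using rh by (simp add: pos_le_divide_eq mult.commute, linarith)
  have "dens U = \<rho> * lorentz v" by (subst pr(3)) (simp add: conserved_def)
  thus "dens U > 0" using r norm_lt_1_inner[OF v] by (simp add: lorentz_def power2_norm_eq_inner)
  show "norm (vel_of H U) < 1" using v of by simp
qed

lemma admissible_flux_ineq:
  assumes eos: "eos H" and U: "U \<in> admissible H" and w: "norm w < 1" and n: "norm n = 1"
  shows "nflux H n U \<bullet> nst w C + ndot n w * pst w C - ndot n (mag U) * (w \<bullet> C) < U \<bullet> nst w C + pst w C"
    and "\<bar>dens (nflux H n U)\<bar> < dens U"
proof -
  obtain \<rho> p v where pr: "prim H U = (\<rho>, p, v)" "admissible_prim H \<rho> p v" "U = conserved H \<rho> p v (mag U)"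
    using prim_admissible[OF U] by blast
  have p: "p > 0" and r: "\<rho> > 0" and v: "norm v < 1" using pr(2) by (auto simp: admissible_prim_def)
  show "nflux H n U \<bullet> nst w C + ndot n w * pst w C - ndot n (mag U) * (w \<bullet> C) < U \<bullet> nst w C + pst w C"
    by (rule flux_ineq[OF eos p r v w n pr(3) pr(1)])
  define v' where "v' = vel_of H U"
  have nf: "dens (nflux H n U) = dens U * ndot n v'"
    using nflux_eq[OF refl refl] by (simp add: v'_def)
  have "(ndot n v')^2 \<le> (norm v')^2"
  proof -
    have n1: "n$1 * n$1 + n$2 * n$2 = 1"
      using n by (simp add: norm_eq_1 inner_vec_def sum_2)
    have "(n$1 * n$1 + n$2 * n$2) * (v'$1 * v'$1 + v'$2 * v'$2) - (ndot n v')^2 = (n$1 * v'$2 - n$2 * v'$1)^2"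
      unfolding ndot_def by algebra
    hence "(ndot n v')^2 \<le> v'$1 * v'$1 + v'$2 * v'$2"
      unfolding n1 mult_1_left using zero_le_power2[of "n$1 * v'$2 - n$2 * v'$1"] by linarith
    thus ?thesis unfolding power2_norm_eq_inner inner3 using zero_le_square[of "v'$3"] by linarith
  qed
  hence "\<bar>ndot n v'\<bar> \<le> norm v'" by (simp add: abs_le_square_iff[symmetric])
  also have "\<dots> < 1" using source_bound(4)[OF eos U w] by (simp add: v'_def)
  finally have "\<bar>ndot n v'\<bar> < 1" .
  thus "\<bar>dens (nflux H n U)\<bar> < dens U"
    unfolding nf abs_mult using source_bound(3)[OF eos U w] by simp
qed

lemma admissible_imp_Gstar: "eos H \<Longrightarrow> U \<in> admissible H \<Longrightarrow> U \<in> Gstar"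
  unfolding Gstar_def using source_bound(2,3)[of H U] source_bound(3)[of H U 0] by auto

text \<open>For \<open>l > |B|\<^sup>2\<close>, completing the square in \<open>(\<surd>(1 - |w|\<^sup>2), w)\<close> on the unit sphere bounds
  the worst case of the linear constraints by the cubic condition \<open>cubic\<close>; the optimal \<open>l\<close> is a root
  of its derivative, and this is how \<open>\<Phi>\<close> and \<open>\<Psi>\<close> arise.\<close>

lemma multiplier_bound:
  fixes D E l :: real and m B w :: "real^3"
  defines "b \<equiv> B \<bullet> B" and "\<mu> \<equiv> m \<bullet> B"
  assumes l: "l > b" and w: "norm w < 1"
    and cubic: "(l^2 - 2 * E * l + (D^2 + m \<bullet> m)) * (l - b) + (D^2 * b + \<mu>^2) \<le> 0"
  shows "D * sqrt (1 - w \<bullet> w) + m \<bullet> w + ((1 - w \<bullet> w) * b + (w \<bullet> B)^2) / 2 \<le> E"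
proof -
  define d where "d = l - b"
  have d: "d > 0" using l by (simp add: d_def)
  have b: "b \<ge> 0" by (simp add: b_def)
  have l0: "l > 0" using l b by simp
  define s where "s = sqrt (1 - w \<bullet> w)"
  have s: "s^2 = 1 - w \<bullet> w" using norm_lt_1_inner[OF w] by (simp add: s_def)
  \<comment> \<open>The critical point of w |-> 2 m . w + (w . B)^2 - l |w|^2: it solves l z - (z .
    B) B = m. Since l > |B|^2 this function is concave, and the inequality below says that
    \<open>z\<close> is its maximum.\<close>
  define z where "z = (1 / l) *\<^sub>R (m + (\<mu> / d) *\<^sub>R B)"
  have lz: "l *\<^sub>R z = m + (\<mu> / d) *\<^sub>R B" using l0 by (simp add: z_def)
  have zB: "z \<bullet> B = \<mu> / d"
  proof -
    have "l * (z \<bullet> B) = (l *\<^sub>R z) \<bullet> B" by simp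
    also have "\<dots> = \<mu> + \<mu> / d * b" unfolding lz by (simp add: inner_add_left \<mu>_def b_def)
    also have "\<dots> = l * (\<mu> / d)" using d by (simp add: d_def field_simps)
    finally show ?thesis using l0 by (subst (asm) mult_left_cancel) auto
  qed
  have lwz: "l * (w \<bullet> z) = w \<bullet> m + \<mu> / d * (w \<bullet> B)"
  proof -
    have "l * (w \<bullet> z) = w \<bullet> (l *\<^sub>R z)" by simp
    thus ?thesis unfolding lz by (simp add: inner_add_right)
  qed
  have lzz: "l * (z \<bullet> z) = z \<bullet> m + (\<mu> / d)^2"
  proof -
    have "l * (z \<bullet> z) = z \<bullet> (l *\<^sub>R z)" by simp
    thus ?thesis unfolding lz by (simp add: inner_add_right zB power2_eq_square)
  qed
  have zm: "z \<bullet> m = (m \<bullet> m + \<mu>^2 / d) / l"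
    unfolding z_def by (simp add: inner_add_left inner_commute[of B] \<mu>_def power2_eq_square)
  have "0 \<le> l * ((w - z) \<bullet> (w - z)) - ((w - z) \<bullet> B)^2"
  proof -
    have "((w - z) \<bullet> B)^2 \<le> ((w - z) \<bullet> (w - z)) * b" unfolding b_def by (rule Cauchy_Schwarz_ineq)
    also have "\<dots> \<le> ((w - z) \<bullet> (w - z)) * l" using l by (intro mult_left_mono) auto
    finally show ?thesis by (simp add: mult.commute)
  qed
  also have "\<dots> = l * (w \<bullet> w) - 2 * (l * (w \<bullet> z)) + l * (z \<bullet> z) - (w \<bullet> B - z \<bullet> B)^2"
    by (simp add: inner_diff_left inner_diff_right inner_commute algebra_simps)
  also have "\<dots> = l * (w \<bullet> w) - (w \<bullet> B)^2 - 2 * (m \<bullet> w) + (m \<bullet> m + \<mu>^2 / d) / l"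
    unfolding lwz lzz zB zm by (simp add: power2_eq_square inner_commute algebra_simps)
  finally have 1: "0 \<le> l * (w \<bullet> w) - (w \<bullet> B)^2 - 2 * (m \<bullet> w) + (m \<bullet> m + \<mu>^2 / d) / l" .
  \<comment> \<open>The same completion of the square in the remaining coordinate s = sqrt (1 -
    |w|^2), whose critical value is D / d. The two are joined by |w|^2 + s^2 = 1.\<close>
  have "0 \<le> (d * s - D)^2 / d" using d by simp
  also have "\<dots> = d * s^2 - 2 * D * s + D^2 / d" using d by (simp add: field_simps power2_eq_square)
  finally have 2: "0 \<le> d * s^2 - 2 * (D * s) + D^2 / d" by (simp only: mult.assoc)
  have "((l^2 - 2 * E * l + (D^2 + m \<bullet> m)) * d + (D^2 * b + \<mu>^2)) / (l * d) \<le> 0"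
    using cubic l0 d unfolding d_def[symmetric] by (simp add: divide_nonpos_pos)
  moreover have "((l^2 - 2 * E * l + (D^2 + m \<bullet> m)) * d + (D^2 * b + \<mu>^2)) / (l * d)
     = l - 2 * E + (m \<bullet> m + \<mu>^2 / d) / l + (D^2 * (d + b)) / (l * d)"
    using l0 d by (simp add: field_simps power2_eq_square)
  moreover have "(D^2 * (d + b)) / (l * d) = D^2 / d" using l0 d by (simp add: d_def)
  ultimately have 3: "l + (m \<bullet> m + \<mu>^2 / d) / l + D^2 / d \<le> 2 * E" by linarith
  have "l * (w \<bullet> w) + d * s^2 = l - b * s^2" unfolding s d_def by (simp add: algebra_simps)
  hence "2 * (D * s) + 2 * (m \<bullet> w) + (b * s^2 + (w \<bullet> B)^2) \<le> 2 * E" using 1 2 3 by linarith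
  thus ?thesis unfolding s s_def[symmetric] mult.commute[of b] by argo
qed

text \<open>The multiplier \<open>l\<close> = (2 E + b + F) / 3 is the larger root of the derivative
  of the cubic in \<open>multiplier_bound\<close>, and its value there is A - (2/27) (F - 2 (b -
  E))^2 (F + b - E). After squaring, \<open>Psi U \<ge> 0\<close> says exactly that this is at most
  0; hence the factor 27/2.\<close>

lemma Psi_nonneg_imp:
  assumes D: "dens U > 0" and q: "qfun U \<ge> 0" and Psi: "Psi U \<ge> 0" and w: "norm w < 1"
  shows "U \<bullet> nst w C + pst w C \<ge> 0"
proof -
  define D where "D = dens U"
  define m where "m = mom U"
  define B where "B = mag U"
  define E where "E = ener U"
  define b where "b = B \<bullet> B"
  define N where "N = D^2 + m \<bullet> m"
  define A where "A = D^2 * b + (m \<bullet> B)^2"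
  have D0: "D > 0" using D by (simp add: D_def)
  have b: "b \<ge> 0" by (simp add: b_def)
  have "m \<bullet> m \<ge> 0" by simp
  hence N: "N > 0" using D0 unfolding N_def by (simp add: add_pos_nonneg)
  have E: "E \<ge> sqrt N" using q by (simp add: qfun_def E_def N_def D_def m_def power2_norm_eq_inner)
  have E0: "E > 0" using E N by (meson less_le_trans real_sqrt_gt_zero)
  have E2: "E^2 \<ge> N" using E E0 N by (metis less_imp_le real_sqrt_ge_0_iff real_sqrt_pow2 power_mono)
  define F where "F = Phi U"
  have F: "F = sqrt ((b - E)^2 + 3 * (E^2 - N))"
    by (simp add: F_def Phi_def b_def B_def E_def N_def D_def m_def power2_norm_eq_inner diff_diff_eq)
  have F2: "F^2 = (b - E)^2 + 3 * (E^2 - N)" unfolding F using E2 by simp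
  have F0: "F \<ge> 0" unfolding F using E2 by simp
  have FE: "F \<ge> \<bar>b - E\<bar>"
    unfolding F by (rule real_le_rsqrt) (use E2 in simp)
  have P: "(F - 2 * (b - E)) * sqrt (F + b - E) \<ge> sqrt (27/2 * A)"
    using Psi by (simp add: Psi_def F_def[symmetric] A_def b_def B_def E_def D_def m_def power2_norm_eq_inner)
  have A0: "A \<ge> 0" using b by (simp add: A_def)
  \<comment> \<open>Squaring loses the sign of this factor. Were it not positive,
    \<open>Psi U \<ge> 0\<close> would force A = 0, then b = 0 as D > 0, and the factor would be F +
    2 E > 0 after all.\<close>
  have pos: "F - 2 * (b - E) > 0"
  proof (rule ccontr)
    assume n: "\<not> ?thesis"
    have "(F - 2 * (b - E)) * sqrt (F + b - E) \<le> 0"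
      using n FE by (intro mult_nonpos_nonneg) auto
    hence "sqrt (27/2 * A) \<le> 0" using P by (rule order_trans[rotated])
    hence "A = 0" using A0 by simp
    moreover have "D^2 * b \<ge> 0" using b by simp
    ultimately have "D^2 * b = 0" unfolding A_def using zero_le_power2[of "m \<bullet> B"] by linarith
    hence "b = 0" using D0 by simp
    thus False using n F0 E0 by simp
  qed
  define l where "l = (2 * E + b + F) / 3"
  have lb: "l - b = (F - 2 * (b - E)) / 3" by (simp add: l_def field_simps)
  hence l: "l > b" using pos by simp
  have "27/2 * A \<le> (F - 2 * (b - E))^2 * (F + b - E)"
  proof -
    have "(sqrt (27/2 * A))^2 \<le> ((F - 2 * (b - E)) * sqrt (F + b - E))^2"
      using P A0 by (intro power_mono) auto
    moreover have "F + b - E \<ge> 0" using FE by simp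
    ultimately show ?thesis using A0 by (simp add: power_mult_distrib)
  qed
  moreover have "(l^2 - 2 * E * l + N) * (l - b) = - (2 / 27) * ((F - 2 * (b - E))^2 * (F + b - E))"
  proof -
    have "l^2 - 2 * E * l + N = - (2 / 9) * ((F - 2 * (b - E)) * (F + b - E))"
    proof -
      have "9 * (l^2 - 2 * E * l + N) + 2 * ((F - 2 * (b - E)) * (F + b - E)) = 3 * (F^2 - (b - E)^2 - 3 * (E^2 - N))"
        unfolding l_def by (simp add: field_simps power2_eq_square)
      thus ?thesis unfolding F2 by simp
    qed
    thus ?thesis unfolding lb by (simp add: power2_eq_square)
  qed
  ultimately have "(l^2 - 2 * E * l + N) * (l - b) + A \<le> 0" by linarith
  hence "D * sqrt (1 - w \<bullet> w) + m \<bullet> w + ((1 - w \<bullet> w) * b + (w \<bullet> B)^2) / 2 \<le> E"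
    unfolding N_def A_def b_def using l w by (intro multiplier_bound) (auto simp: b_def)
  hence "0 \<le> U \<bullet> nst w (mag U) + pst w (mag U)"
    unfolding nst_mag D_def m_def B_def E_def b_def by argo
  also have "\<dots> \<le> U \<bullet> nst w C + pst w C" by (rule nst_ge_nst_mag[OF w])
  finally show ?thesis .
qed

text \<open>The energy enters the functional with coefficient 1, so lowering the energy by
  \<epsilon> lowers its value by \<epsilon>. A nonnegative value at the lowered state is a margin at
  the original one.\<close>

lemma Psi_eps_nonneg_imp:
  assumes "dens U > 0" "qfun U \<ge> \<epsilon>" "Psi_eps \<epsilon> U \<ge> 0" "norm w < 1"
  shows "U \<bullet> nst w C + pst w C \<ge> \<epsilon>"
proof -
  define U' where "U' = (dens U, mom U, mag U, ener U - \<epsilon>)"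
  have "U' \<bullet> nst w C + pst w C \<ge> 0"
    by (rule Psi_nonneg_imp) (use assms in \<open>auto simp: U'_def qfun_def Psi_eps_def\<close>)
  thus ?thesis unfolding inner_nst by (simp add: U'_def)
qed

section \<open>Polynomial spaces\<close>

lemma finite_le_sum [simp]: "finite {(i, j). i + j \<le> (k::nat)}"
  by (rule finite_subset[of _ "{..k} \<times> {..k}"]) auto

lemma poly2_lin:
  assumes "f \<in> poly2 k" "g \<in> poly2 k"
  shows "(\<lambda>x. a * f x + b * g x) \<in> poly2 k"
proof -
  obtain c d where f: "f = (\<lambda>x. \<Sum>(i, j)\<in>{(i, j). i + j \<le> k}. c i j * x$1 ^ i * x$2 ^ j)"
    and g: "g = (\<lambda>x. \<Sum>(i, j)\<in>{(i, j). i + j \<le> k}. d i j * x$1 ^ i * x$2 ^ j)"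
    using assms unfolding poly2_def by auto
  have "(\<lambda>x. a * f x + b * g x) = (\<lambda>x. \<Sum>(i, j)\<in>{(i, j). i + j \<le> k}. (a * c i j + b * d i j) * x$1 ^ i * x$2 ^ j)"
    unfolding f g by (auto simp: sum_distrib_left sum.distrib[symmetric] case_prod_unfold algebra_simps intro!: sum.cong)
  thus ?thesis unfolding poly2_def by (intro CollectI exI[of _ "\<lambda>i j. a * c i j + b * d i j"]) simp
qed

lemma poly2_const: "(\<lambda>x. a) \<in> poly2 k"
proof -
  define c where "c = (\<lambda>(i::nat) (j::nat). if i = 0 \<and> j = 0 then a else 0)"
  have "(\<Sum>(i, j)\<in>{(i, j). i + j \<le> k}. c i j * x$1 ^ i * x$2 ^ j) = a" for x :: pt
  proof -
    have "(\<Sum>(i, j)\<in>{(i, j). i + j \<le> k}. c i j * x$1 ^ i * x$2 ^ j)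
       = (\<Sum>(i, j)\<in>{(0, 0)}. c i j * x$1 ^ i * x$2 ^ j)"
      by (rule sum.mono_neutral_right) (auto simp: c_def split: if_splits)
    thus ?thesis by (simp add: c_def)
  qed
  thus ?thesis unfolding poly2_def by (intro CollectI exI[of _ c]) auto
qed

lemma poly2_affine: "f \<in> poly2 k \<Longrightarrow> (\<lambda>x. a * f x + b) \<in> poly2 k"
  using poly2_lin[OF _ poly2_const[of 1], of f k a b] by simp

lemma poly2_differentiable:
  assumes "f \<in> poly2 k" shows "f differentiable (at x)"
proof -
  obtain c where f: "f = (\<lambda>x. \<Sum>(i, j)\<in>{(i, j). i + j \<le> k}. c i j * x$1 ^ i * x$2 ^ j)"
    using assms unfolding poly2_def by auto
  have "(\<lambda>x::pt. x$i) differentiable (at x)" for i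
    by (intro bounded_linear_imp_differentiable bounded_linear_vec_nth)
  thus ?thesis unfolding f case_prod_unfold
    using finite_le_sum[of k]
    by (intro differentiable_sum differentiable_mult differentiable_power) (auto simp: case_prod_unfold)
qed

lemma poly2_continuous: "f \<in> poly2 k \<Longrightarrow> continuous_on A f"
  by (intro continuous_at_imp_continuous_on ballI differentiable_imp_continuous_within poly2_differentiable)

lemma polyfun_roots_zero:
  fixes c :: "nat \<Rightarrow> real"
  assumes "finite A" "card A > n" "\<And>x. x \<in> A \<Longrightarrow> (\<Sum>i\<le>n. c i * x ^ i) = 0" "i \<le> n"
  shows "c i = 0"
proof (rule ccontr)
  assume "c i \<noteq> 0"
  hence r: "finite {x. (\<Sum>i\<le>n. c i * x ^ i) = 0}" "card {x. (\<Sum>i\<le>n. c i * x ^ i) = 0} \<le> n"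
    using polyfun_rootbound[of n c] assms(4) by blast+
  have "card A \<le> card {x. (\<Sum>i\<le>n. c i * x ^ i) = 0}"
    by (rule card_mono[OF r(1)]) (use assms(3) in auto)
  thus False using r assms(2) by simp
qed

text \<open>One variable at a time: for fixed second coordinate the polynomial has more roots than
  its degree, and so have its coefficients as polynomials in the second coordinate. This yields the
  finitely many separating functionals for \<open>riesz_finite\<close>.\<close>

lemma poly2_grid_zero:
  assumes f: "f \<in> poly2 k" and A: "finite A" "card A > k" and B: "finite B" "card B > k"
    and z: "\<And>a b. a \<in> A \<Longrightarrow> b \<in> B \<Longrightarrow> f (vector [a, b]) = 0"
  shows "f = (\<lambda>x. 0)"
proof -
  obtain c where f: "f = (\<lambda>x. \<Sum>(i, j)\<in>{(i, j). i + j \<le> k}. c i j * x$1 ^ i * x$2 ^ j)"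
    using f unfolding poly2_def by auto
  \<comment> \<open>Coefficients extended by zero from the triangle i + j <= k to a square, so that
    the double sum can be iterated.\<close>
  define d where "d = (\<lambda>i j. if i + j \<le> k then c i j else 0)"
  have f': "f x = (\<Sum>i\<le>k. (\<Sum>j\<le>k. d i j * x$2 ^ j) * x$1 ^ i)" for x
  proof -
    have "f x = (\<Sum>(i, j)\<in>{..k} \<times> {..k}. d i j * x$1 ^ i * x$2 ^ j)"
      unfolding f by (rule sum.mono_neutral_cong_left) (auto simp: d_def split: if_splits)
    also have "\<dots> = (\<Sum>i\<le>k. \<Sum>j\<le>k. d i j * x$1 ^ i * x$2 ^ j)"
      by (simp add: sum.cartesian_product)
    finally show ?thesis by (simp add: sum_distrib_left sum_distrib_right mult_ac)
  qed
  have "d i j = 0" if ij: "i \<le> k" "j \<le> k" for i j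
  proof (rule polyfun_roots_zero[OF B, where c = "d i"])
    fix b assume b: "b \<in> B"
    show "(\<Sum>j\<le>k. d i j * b ^ j) = 0"
    proof (rule polyfun_roots_zero[OF A, where c = "\<lambda>i. \<Sum>j\<le>k. d i j * b ^ j"])
      fix a assume a: "a \<in> A"
      show "(\<Sum>i\<le>k. (\<Sum>j\<le>k. d i j * b ^ j) * a ^ i) = 0"
        using z[OF a b] unfolding f' by simp
    qed (rule ij)
  qed (rule ij)
  thus ?thesis by (intro ext) (simp add: f')
qed

lemma poly2_open_zero:
  assumes f: "f \<in> poly2 k" and S: "open S" "S \<noteq> {}" and z: "\<And>x. x \<in> S \<Longrightarrow> f x = 0"
  shows "f = (\<lambda>x. 0)"
proof -
  obtain p where "p \<in> S" using S by auto
  then obtain e where e: "e > 0" "ball p e \<subseteq> S" using S open_contains_ball by blast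
  have inS: "vector [a, b] \<in> S" if "a \<in> {p$1..p$1 + e/3}" "b \<in> {p$2..p$2 + e/3}" for a b
  proof -
    have "dist p (vector [a, b]) \<le> (\<Sum>i\<in>UNIV. dist (p$i) ((vector [a, b] :: pt)$i))"
      unfolding dist_vec_def by (rule L2_set_le_sum) simp
    also have "\<dots> \<le> e/3 + e/3"
      unfolding sum_2 using that by (intro add_mono) (auto simp: dist_real_def)
    also have "\<dots> < e" using e by simp
    finally show ?thesis using e by auto
  qed
  have "infinite {p$i..p$i + e/3}" for i using e by (simp add: infinite_Icc_iff)
  hence "\<exists>B. finite B \<and> card B = Suc k \<and> B \<subseteq> {p$i..p$i + e/3}" for i
    by (rule infinite_arbitrarily_large)
  then obtain A B where "finite A" "card A = Suc k" "A \<subseteq> {p$1..p$1 + e/3}"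
     "finite B" "card B = Suc k" "B \<subseteq> {p$2..p$2 + e/3}" by meson
  thus ?thesis by (intro poly2_grid_zero[OF f, of A B]) (auto intro!: z inS)
qed

text \<open>Lets a quadrature rule for univariate polynomials act on traces along an edge.\<close>

lemma poly2_segment:
  assumes "f \<in> poly2 k"
  obtains q :: "real poly" where "degree q \<le> k" "\<And>t. f (p + t *\<^sub>R d) = poly q t"
proof -
  obtain c where f: "f = (\<lambda>x. \<Sum>(i, j)\<in>{(i, j). i + j \<le> k}. c i j * x$1 ^ i * x$2 ^ j)"
    using assms unfolding poly2_def by auto
  define q where "q = (\<Sum>(i, j)\<in>{(i, j). i + j \<le> k}. smult (c i j) ([:p$1, d$1:] ^ i * [:p$2, d$2:] ^ j))"
  have "degree q \<le> k"
    unfolding q_def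
  proof (rule degree_sum_le, simp, clarify)
    fix i j assume ij: "i + j \<le> k"
    have l: "degree ([:a, b:] ^ n) \<le> n" for a b :: real and n
      using degree_power_le[of "[:a, b:]" n] by (auto split: if_splits)
    have "degree (smult (c i j) ([:p$1, d$1:] ^ i * [:p$2, d$2:] ^ j)) \<le> degree ([:p$1, d$1:] ^ i * [:p$2, d$2:] ^ j)"
      by (rule degree_smult_le)
    also have "\<dots> \<le> degree ([:p$1, d$1:] ^ i) + degree ([:p$2, d$2:] ^ j)" by (rule degree_mult_le)
    also have "\<dots> \<le> i + j" by (intro add_mono l)
    finally show "degree (smult (c i j) ([:p$1, d$1:] ^ i * [:p$2, d$2:] ^ j)) \<le> k" using ij by simp
  qed
  moreover have "f (p + t *\<^sub>R d) = poly q t" for t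
    unfolding f q_def by (simp add: poly_sum case_prod_unfold mult_ac)
  ultimately show ?thesis using that by blast
qed

lemma partial_real:
  assumes "f \<in> poly2 k"
  shows "((\<lambda>t. f (x + t *\<^sub>R axis i 1)) has_field_derivative partial i f (x + s *\<^sub>R axis i 1)) (at s)"
proof -
  have F: "(f has_derivative frechet_derivative f (at (x + s *\<^sub>R axis i 1))) (at (x + s *\<^sub>R axis i 1))"
    using poly2_differentiable[OF assms] by (simp add: frechet_derivative_works)
  have "((\<lambda>t. x + t *\<^sub>R axis i (1::real)) has_derivative (\<lambda>h. h *\<^sub>R axis i 1)) (at s)"
    by (auto intro!: derivative_eq_intros)
  from has_derivative_compose[OF this F]
  have "((\<lambda>t. f (x + t *\<^sub>R axis i 1)) has_derivative (\<lambda>h. frechet_derivative f (at (x + s *\<^sub>R axis i 1)) (h *\<^sub>R axis i 1))) (at s)" .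
  moreover have "frechet_derivative f (at (x + s *\<^sub>R axis i 1)) (h *\<^sub>R axis i 1) = partial i f (x + s *\<^sub>R axis i 1) * h" for h
    using linear_cmul[OF linear_frechet_derivative[OF poly2_differentiable[OF assms]]] by (simp add: partial_def)
  ultimately show ?thesis by (simp add: has_field_derivative_def)
qed

section \<open>Riesz representation\<close>

text \<open>Induction on the number of functionals \<open>L i\<close> that separate the points of \<open>V\<close>: the kernel of one of
  them has codimension at most one.\<close>

lemma riesz_finite:
  fixes L :: "'i \<Rightarrow> ('a \<Rightarrow> 'b::real_vector) \<Rightarrow> real" and S :: "('a \<Rightarrow> 'b) \<Rightarrow> ('a \<Rightarrow> 'b) \<Rightarrow> real"
  assumes "finite I"
    and "(\<lambda>x. 0) \<in> V"
    and "\<And>f g c. f \<in> V \<Longrightarrow> g \<in> V \<Longrightarrow> (\<lambda>x. f x + c *\<^sub>R g x) \<in> V"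
    and "\<And>i f g c. i \<in> I \<Longrightarrow> f \<in> V \<Longrightarrow> g \<in> V \<Longrightarrow> L i (\<lambda>x. f x + c *\<^sub>R g x) = L i f + c * L i g"
    and "\<And>f. f \<in> V \<Longrightarrow> (\<And>i. i \<in> I \<Longrightarrow> L i f = 0) \<Longrightarrow> f = (\<lambda>x. 0)"
    and "\<And>f g h c. f \<in> V \<Longrightarrow> g \<in> V \<Longrightarrow> h \<in> V \<Longrightarrow> S (\<lambda>x. f x + c *\<^sub>R g x) h = S f h + c * S g h"
    and "\<And>f g. f \<in> V \<Longrightarrow> g \<in> V \<Longrightarrow> S f g = S g f"
    and "\<And>f. f \<in> V \<Longrightarrow> f \<noteq> (\<lambda>x. 0) \<Longrightarrow> S f f > 0"
    and "\<And>f g c. f \<in> V \<Longrightarrow> g \<in> V \<Longrightarrow> J (\<lambda>x. f x + c *\<^sub>R g x) = J f + c * J g"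
  shows "\<exists>w\<in>V. \<forall>v\<in>V. S w v = J v"
  using assms
proof (induction I arbitrary: V J rule: finite_induct)
  case empty
  hence V: "v = (\<lambda>x. 0)" if "v \<in> V" for v using that by blast
  have "J (\<lambda>x. 0 + 1 *\<^sub>R (0::'b)) = J (\<lambda>x. 0) + 1 * J (\<lambda>x. 0)" by (rule empty.prems(8)) (rule empty.prems(1))+
  hence J0: "J (\<lambda>x. 0) = 0" by simp
  have "S (\<lambda>x. 0 + 1 *\<^sub>R (0::'b)) (\<lambda>x. 0) = S (\<lambda>x. 0) (\<lambda>x. 0) + 1 * S (\<lambda>x. 0) (\<lambda>x. 0)"
    by (rule empty.prems(5)) (rule empty.prems(1))+
  hence S0: "S (\<lambda>x. 0) (\<lambda>x. 0) = 0" by simp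
  show ?case
  proof (intro bexI[of _ "\<lambda>x. 0"] ballI)
    fix v assume "v \<in> V"
    hence v: "v = (\<lambda>x. 0)" by (rule V)
    show "S (\<lambda>x. 0) v = J v" unfolding v S0 J0 ..
  qed (rule empty.prems(1))
next
  case (insert i I)
  note zero = insert.prems(1) and cl = insert.prems(2) and L = insert.prems(3) and sep = insert.prems(4)
    and lin = insert.prems(5) and sym = insert.prems(6) and pos = insert.prems(7) and J = insert.prems(8)
  define V' where "V' = {v \<in> V. L i v = 0}"
  have sub: "f \<in> V" "L i f = 0" if "f \<in> V'" for f using that by (auto simp: V'_def)
  have "L i (\<lambda>x. 0 + 1 *\<^sub>R (0::'b)) = L i (\<lambda>x. 0) + 1 * L i (\<lambda>x. 0)" by (rule L) (auto intro: zero)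
  hence L0: "L i (\<lambda>x. 0) = 0" by simp
  have cl': "(\<lambda>x. f x + c *\<^sub>R g x) \<in> V'" if "f \<in> V'" "g \<in> V'" for f g c
    using cl[of f g c] L[of i f g c] that by (simp add: V'_def)
  have riesz': "\<exists>w\<in>V'. \<forall>v\<in>V'. S w v = K v"
    if K: "\<And>f g c. f \<in> V \<Longrightarrow> g \<in> V \<Longrightarrow> K (\<lambda>x. f x + c *\<^sub>R g x) = K f + c * K g" for K
  proof (rule insert.IH)
    show "(\<lambda>x. 0) \<in> V'" using zero L0 by (simp add: V'_def)
    show "f = (\<lambda>x. 0)" if "f \<in> V'" "\<And>j. j \<in> I \<Longrightarrow> L j f = 0" for f
      using sep[of f] that by (auto simp: V'_def)
  qed (use cl' L lin sym pos K sub in auto)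
  have rJ: "\<exists>w\<in>V'. \<forall>v\<in>V'. S w v = J v" by (rule riesz'[of J]) (rule J)
  show ?case
  proof (cases "\<exists>u\<in>V. L i u \<noteq> 0")
    case False
    hence "V' = V" by (auto simp: V'_def)
    thus ?thesis using rJ by auto
  next
    case True
    then obtain u where u: "u \<in> V" "L i u \<noteq> 0" by auto
    \<comment> \<open>The representer \<open>u'\<close> is the orthogonal projection of
      \<open>u\<close> onto \<open>V'\<close>. Then \<open>e\<close> = u - u' spans the orthogonal
      complement of \<open>V'\<close> in \<open>V\<close>, and the representer of \<open>J\<close>
      on \<open>V\<close> is the one on \<open>V'\<close> plus the multiple of \<open>e\<close>
      fixed by \<open>J e\<close>.\<close>
    have "\<exists>w\<in>V'. \<forall>v\<in>V'. S w v = S v u" by (rule riesz'[of "\<lambda>v. S v u"]) (auto intro: lin u)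
    then obtain u' where u': "u' \<in> V'" "\<And>v. v \<in> V' \<Longrightarrow> S u' v = S v u" by auto
    define e where "e = (\<lambda>x. u x + (- 1) *\<^sub>R u' x)"
    have e: "e \<in> V" unfolding e_def by (rule cl[OF u(1) sub(1)[OF u'(1)]])
    have Le: "L i e \<noteq> 0" unfolding e_def using L[of i u u' "-1"] u sub u' by simp
    have orth: "S e v = 0" if v: "v \<in> V'" for v
      unfolding e_def using lin[of u u' v "-1"] sym[of v u] u u' sub v by auto
    have e0: "e \<noteq> (\<lambda>x. 0)" using Le L0 by auto
    obtain w' where w': "w' \<in> V'" "\<And>v. v \<in> V' \<Longrightarrow> S w' v = J v" using rJ by auto
    define c where "c = J e / S e e"
    define w where "w = (\<lambda>x. w' x + c *\<^sub>R e x)"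
    have w: "w \<in> V" unfolding w_def by (rule cl[OF sub(1)[OF w'(1)] e])
    have "S w v = J v" if v: "v \<in> V" for v
    proof -
      define a where "a = L i v / L i e"
      define v' where "v' = (\<lambda>x. v x + (- a) *\<^sub>R e x)"
      have v'V: "v' \<in> V" unfolding v'_def by (rule cl[OF v e])
      moreover have "L i v' = 0"
        unfolding v'_def using L[of i v e "- a"] v e Le by (simp add: a_def)
      ultimately have v': "v' \<in> V'" by (simp add: V'_def)
      have vv: "v = (\<lambda>x. v' x + a *\<^sub>R e x)" unfolding v'_def by auto
      note Sv = lin[OF v'V e, of _ a, folded vv]
      have w'V: "w' \<in> V" using sub w' by blast
      have "S w v = S w' v + c * S e v" unfolding w_def by (rule lin[OF w'V e v])
      moreover have "S w' v = S v' w' + a * S e w'" unfolding sym[OF w'V v] by (rule Sv[OF w'V])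
      moreover have "S e v = S v' e + a * S e e" unfolding sym[OF e v] by (rule Sv[OF e])
      moreover have "S v' e = 0" unfolding sym[OF v'V e] by (rule orth[OF v'])
      moreover have "S e w' = 0" by (rule orth[OF w'(1)])
      moreover have "S v' w' = J v'" unfolding sym[OF v'V w'V] by (rule w'(2)[OF v'])
      moreover have "c * S e e = J e" using pos[OF e e0] by (simp add: c_def)
      moreover have "J v = J v' + a * J e" by (rule J[OF v'V e, of a, folded vv])
      ultimately show ?thesis by (simp add: algebra_simps)
    qed
    thus ?thesis using w by blast
  qed
qed

section \<open>Divergence-free polynomial states on one cell\<close>

lemma poly2_sum:
  assumes "finite A" "\<And>i. i \<in> A \<Longrightarrow> f i \<in> poly2 k"
  shows "(\<lambda>x. \<Sum>i\<in>A. c i * f i x) \<in> poly2 k"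
  using assms
proof (induction A rule: finite_induct)
  case empty thus ?case by (simp add: poly2_const)
next
  case (insert i A)
  have "(\<lambda>x. c i * f i x + 1 * (\<Sum>i\<in>A. c i * f i x)) \<in> poly2 k"
    by (rule poly2_lin) (use insert in auto)
  thus ?case using insert by simp
qed

lemma partial_lin:
  fixes f g :: "pt \<Rightarrow> 'b::real_normed_vector"
  assumes "f differentiable (at x)" "g differentiable (at x)"
  shows "partial i (\<lambda>x. f x + c *\<^sub>R g x) x = partial i f x + c *\<^sub>R partial i g x"
proof -
  have "((\<lambda>x. f x + c *\<^sub>R g x) has_derivative
      (\<lambda>h. frechet_derivative f (at x) h + c *\<^sub>R frechet_derivative g (at x) h)) (at x)"
    using assms by (intro has_derivative_add has_derivative_scaleR_right) (simp_all add: frechet_derivative_works)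
  from frechet_derivative_at[OF this, symmetric] show ?thesis by (simp add: partial_def)
qed

lemma partial_const [simp]: "partial i (\<lambda>x. a) x = 0"
  by (simp add: partial_def)

lemma partial_affine:
  fixes f :: "pt \<Rightarrow> real"
  assumes "f differentiable (at x)"
  shows "partial i (\<lambda>x. c * f x + a) x = c * partial i f x"
  using partial_lin[OF differentiable_const[of a] assms, of i c] by (simp add: add.commute)

text \<open>One factor of \<open>Wh\<close>, which is a product over the cells; averages,
  representation and the limiter can therefore be treated cell by cell.\<close>

definition div_free_poly :: "pt set \<Rightarrow> nat \<Rightarrow> (pt \<Rightarrow> state) set" where
  "div_free_poly X k = {p. (\<forall>b\<in>Basis. (\<lambda>x. p x \<bullet> b) \<in> poly2 k) \<and>
     (\<forall>x\<in>X. partial 1 (\<lambda>y. mag (p y) $ 1) x + partial 2 (\<lambda>y. mag (p y) $ 2) x = 0)}"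

lemma Wh_iff: "u \<in> Wh M k \<longleftrightarrow> (\<forall>K. u K \<in> div_free_poly (cell M K) k)"
  by (simp add: Wh_def div_free_poly_def)

lemma div_free_poly_inner: "p \<in> div_free_poly X k \<Longrightarrow> (\<lambda>x. p x \<bullet> c) \<in> poly2 k"
proof -
  assume "p \<in> div_free_poly X k"
  hence "(\<lambda>x. \<Sum>b\<in>Basis. (c \<bullet> b) * (p x \<bullet> b)) \<in> poly2 k"
    by (intro poly2_sum) (auto simp: div_free_poly_def)
  moreover have "p x \<bullet> c = (\<Sum>b\<in>Basis. (c \<bullet> b) * (p x \<bullet> b))" for x
    by (subst euclidean_inner) (simp add: mult.commute)
  ultimately show ?thesis by simp
qed

lemma mag_nth: "mag U $ i = U \<bullet> (0, 0, axis i 1, 0)"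
  by (simp add: mag_def inner_prod_def inner_axis)

lemma div_free_poly_mag: "p \<in> div_free_poly X k \<Longrightarrow> (\<lambda>x. mag (p x) $ i) \<in> poly2 k"
  unfolding mag_nth by (rule div_free_poly_inner)

lemma div_free_poly_differentiable: "p \<in> div_free_poly X k \<Longrightarrow> p differentiable (at x)"
  by (subst differentiable_componentwise_within) (auto intro: poly2_differentiable div_free_poly_inner)

lemma div_free_poly_continuous: "p \<in> div_free_poly X k \<Longrightarrow> continuous_on A p"
  by (intro continuous_at_imp_continuous_on ballI differentiable_imp_continuous_within div_free_poly_differentiable)

lemma div_free_poly_const: "(\<lambda>x. c) \<in> div_free_poly X k"
  by (simp add: div_free_poly_def poly2_const)

lemma div_free_poly_lin:
  assumes "f \<in> div_free_poly X k" "g \<in> div_free_poly X k" shows "(\<lambda>x. f x + c *\<^sub>R g x) \<in> div_free_poly X k"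
proof -
  have "(\<lambda>x. (f x + c *\<^sub>R g x) \<bullet> b) \<in> poly2 k" for b
    using poly2_lin[OF div_free_poly_inner[OF assms(1)] div_free_poly_inner[OF assms(2)], of 1 b c b] by (simp add: inner_add_left)
  moreover have "partial i (\<lambda>y. mag (f y + c *\<^sub>R g y) $ j) x
      = partial i (\<lambda>y. mag (f y) $ j) x + c * partial i (\<lambda>y. mag (g y) $ j) x" for i j x
    using partial_lin[OF poly2_differentiable[OF div_free_poly_mag[OF assms(1)]] poly2_differentiable[OF div_free_poly_mag[OF assms(2)]]]
    by (simp add: mag_def)
  moreover have "partial 1 (\<lambda>y. mag (f y) $ 1) x + c * partial 1 (\<lambda>y. mag (g y) $ 1) x
     + (partial 2 (\<lambda>y. mag (f y) $ 2) x + c * partial 2 (\<lambda>y. mag (g y) $ 2) x) = 0" if "x \<in> X" for x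
  proof -
    have "partial 1 (\<lambda>y. mag (f y) $ 1) x + partial 2 (\<lambda>y. mag (f y) $ 2) x = 0"
      and "partial 1 (\<lambda>y. mag (g y) $ 1) x + partial 2 (\<lambda>y. mag (g y) $ 2) x = 0"
      using assms that by (simp_all add: div_free_poly_def)
    moreover have "partial 1 (\<lambda>y. mag (f y) $ 1) x + c * partial 1 (\<lambda>y. mag (g y) $ 1) x
     + (partial 2 (\<lambda>y. mag (f y) $ 2) x + c * partial 2 (\<lambda>y. mag (g y) $ 2) x)
     = (partial 1 (\<lambda>y. mag (f y) $ 1) x + partial 2 (\<lambda>y. mag (f y) $ 2) x)
     + c * (partial 1 (\<lambda>y. mag (g y) $ 1) x + partial 2 (\<lambda>y. mag (g y) $ 2) x)"
      by (simp add: algebra_simps)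
    ultimately show ?thesis by simp
  qed
  ultimately show ?thesis by (simp add: div_free_poly_def)
qed

text \<open>Every step of the limiter acts on \<open>u - a\<close>, with \<open>a\<close> the cell average, by such a map.\<close>
definition diag_map :: "real \<Rightarrow> real \<Rightarrow> real \<Rightarrow> real \<Rightarrow> state \<Rightarrow> state" where
  "diag_map c1 c2 c3 c4 U = (c1 * dens U, c2 *\<^sub>R mom U, c3 *\<^sub>R mag U, c4 * ener U)"

lemma linear_diag_map: "linear (diag_map c1 c2 c3 c4)"
  by (rule linearI) (auto simp: diag_map_def dens_def mom_def mag_def ener_def algebra_simps)

lemma diag_map_Basis:
  assumes "b \<in> Basis"
  obtains e where "\<And>U. diag_map c1 c2 c3 c4 U \<bullet> b = e * (U \<bullet> b)"
proof -
  have "\<exists>e. \<forall>U. diag_map c1 c2 c3 c4 U \<bullet> b = e * (U \<bullet> b)"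
    using assms unfolding Basis_prod_def
    by (auto simp: diag_map_def inner_prod_def dens_def mom_def mag_def ener_def intro: exI[of _ c1] exI[of _ c2] exI[of _ c3] exI[of _ c4])
  thus ?thesis using that by blast
qed

text \<open>The divergence constraint survives because all magnetic components carry the same factor
  \<open>c3\<close> and the added constant has no derivative. Scaling them separately would destroy
  it.\<close>

lemma div_free_poly_diag_map:
  assumes f: "f \<in> div_free_poly X k"
  shows "(\<lambda>x. diag_map c1 c2 c3 c4 (f x - a) + a) \<in> div_free_poly X k"
proof -
  have "(\<lambda>x. (diag_map c1 c2 c3 c4 (f x - a) + a) \<bullet> b) \<in> poly2 k" if b: "b \<in> Basis" for b
  proof -
    obtain e where e: "\<And>U. diag_map c1 c2 c3 c4 U \<bullet> b = e * (U \<bullet> b)" using diag_map_Basis[OF b] by blast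
    have "(\<lambda>x. e * (f x \<bullet> b) + (a \<bullet> b - e * (a \<bullet> b))) \<in> poly2 k"
      by (rule poly2_affine[OF div_free_poly_inner[OF f]])
    moreover have "(diag_map c1 c2 c3 c4 (f x - a) + a) \<bullet> b = e * (f x \<bullet> b) + (a \<bullet> b - e * (a \<bullet> b))" for x
      unfolding inner_add_left e by (simp add: inner_diff_left algebra_simps)
    ultimately show ?thesis by simp
  qed
  moreover have "partial i (\<lambda>y. mag (diag_map c1 c2 c3 c4 (f y - a) + a) $ j) x = c3 * partial i (\<lambda>y. mag (f y) $ j) x" for i j x
  proof -
    have "mag (diag_map c1 c2 c3 c4 (f y - a) + a) $ j = c3 * (mag (f y) $ j) + (mag a $ j - c3 * mag a $ j)" for y
      by (simp add: diag_map_def mag_def algebra_simps)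
    thus ?thesis by (simp add: partial_affine[OF poly2_differentiable[OF div_free_poly_mag[OF f]]])
  qed
  ultimately show ?thesis using f by (simp add: div_free_poly_def flip: distrib_left)
qed

lemma cont_set_integrable:
  fixes f :: "pt \<Rightarrow> 'b::{banach, second_countable_topology}"
  assumes "compact X" "continuous_on X f"
  shows "set_integrable lebesgue X f"
proof -
  have "integrable lborel (\<lambda>x. indicator X x *\<^sub>R f x)" by (rule borel_integrable_compact[OF assms])
  thus ?thesis unfolding set_integrable_def
    by (subst integrable_completion) (auto dest: borel_measurable_integrable)
qed

lemma set_integral_zero_interior:
  fixes g :: "pt \<Rightarrow> real"
  assumes X: "compact X" and g: "continuous_on UNIV g" "\<And>x. g x \<ge> 0"
    and z: "(LINT x:X|lebesgue. g x) \<le> 0" and x: "x \<in> interior X"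
  shows "g x = 0"
proof -
  obtain a b where ab: "x \<in> box a b" "cbox a b \<subseteq> interior X"
    using open_contains_cbox x open_interior by (metis (no_types, lifting))
  have i: "set_integrable lebesgue X g" "set_integrable lebesgue (cbox a b) g"
    by (rule cont_set_integrable; use X g in \<open>auto intro: continuous_on_subset\<close>)+
  have "(LINT x:cbox a b|lebesgue. g x) \<le> (LINT x:X|lebesgue. g x)"
    unfolding set_lebesgue_integral_def
    by (rule integral_mono) (use i ab g interior_subset in \<open>auto simp: set_integrable_def indicator_def split: if_splits\<close>)
  moreover have "(LINT x:cbox a b|lebesgue. g x) = integral (cbox a b) g"
    by (rule set_lebesgue_integral_eq_integral(2)[OF i(2)])
  moreover have "integral (cbox a b) g \<ge> 0"
    by (rule integral_nonneg) (use g i set_lebesgue_integral_eq_integral(1)[OF i(2)] in auto)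
  ultimately have "integral (cbox a b) g = 0" using z by simp
  hence "(g has_integral 0) (cbox a b)"
    using set_lebesgue_integral_eq_integral(1)[OF i(2)] by (simp add: has_integral_iff)
  moreover have "x \<in> cbox a b" using ab(1) box_subset_cbox[of a b] by blast
  moreover have "box a b \<noteq> {}" using ab(1) by blast
  ultimately show ?thesis
    using has_integral_0_cbox_imp_0[of a b g x] continuous_on_subset[OF g(1)] g(2) by blast
qed

lemma div_free_poly_ext:
  assumes "f \<in> div_free_poly X k" "S \<noteq> {}" "open S" "\<And>x. x \<in> S \<Longrightarrow> f x = 0"
  shows "f = (\<lambda>x. 0)"
proof -
  have "(\<lambda>x. f x \<bullet> b) = (\<lambda>x. 0)" for b
    by (rule poly2_open_zero[OF div_free_poly_inner[OF assms(1)] assms(3,2)]) (use assms in auto)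
  hence "f x \<bullet> b = 0" for x b by (rule fun_cong)
  thus ?thesis by (intro ext) (metis inner_eq_zero_iff)
qed

lemma div_free_poly_inner_integrable:
  assumes "compact X" "f \<in> div_free_poly X k" "g \<in> div_free_poly X k"
  shows "set_integrable lebesgue X (\<lambda>x. f x \<bullet> g x)"
  using assms by (intro cont_set_integrable continuous_intros div_free_poly_continuous) auto

lemma div_free_poly_pos:
  assumes X: "compact X" "interior X \<noteq> {}" and f: "f \<in> div_free_poly X k" and z: "(LINT x:X|lebesgue. f x \<bullet> f x) \<le> 0"
  shows "f = (\<lambda>x. 0)"
proof (rule div_free_poly_ext[OF f X(2) open_interior])
  fix x assume x: "x \<in> interior X"
  have "f x \<bullet> f x = 0"
    by (rule set_integral_zero_interior[OF X(1) _ _ z x]) (auto intro!: continuous_intros div_free_poly_continuous[OF f])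
  thus "f x = 0" by simp
qed

lemma div_free_poly_riesz:
  assumes X: "compact X" "interior X \<noteq> {}"
    and J: "\<And>f g c. f \<in> div_free_poly X k \<Longrightarrow> g \<in> div_free_poly X k \<Longrightarrow> J (\<lambda>x. f x + c *\<^sub>R g x) = J f + c * J g"
  shows "\<exists>w\<in>div_free_poly X k. \<forall>v\<in>div_free_poly X k. (LINT x:X|lebesgue. w x \<bullet> v x) = J v"
proof -
  \<comment> \<open>Point values on a grid of (k + 1)^2 integer points separate polynomials of
    degree at most k. The polynomials live on the whole plane, so the grid is chosen independently
    of \<open>X\<close>.\<close>
  define G where "G = real ` {..k}"
  have G: "finite G" "card G > k" unfolding G_def by (auto simp: card_image)
  define L where "L = (\<lambda>(a, b, e) (f :: pt \<Rightarrow> state). f (vector [a, b]) \<bullet> (e :: state))"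
  show ?thesis
  proof (rule riesz_finite[where I = "G \<times> G \<times> Basis" and L = L and S = "\<lambda>f g. LINT x:X|lebesgue. f x \<bullet> g x"])
    show "finite (G \<times> G \<times> (Basis :: state set))" using G by auto
    show "(\<lambda>x. 0) \<in> div_free_poly X k" by (rule div_free_poly_const)
    show "(\<lambda>x. f x + c *\<^sub>R g x) \<in> div_free_poly X k" if "f \<in> div_free_poly X k" "g \<in> div_free_poly X k" for f g c
      using that by (rule div_free_poly_lin)
    show "L i (\<lambda>x. f x + c *\<^sub>R g x) = L i f + c * L i g" for i f g c
      by (simp add: L_def case_prod_unfold inner_add_left)
    show "f = (\<lambda>x. 0)" if f: "f \<in> div_free_poly X k" and z: "\<And>i. i \<in> G \<times> G \<times> Basis \<Longrightarrow> L i f = 0" for f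
    proof -
      have "(\<lambda>x. f x \<bullet> b) = (\<lambda>x. 0)" if b: "b \<in> Basis" for b
      proof (rule poly2_grid_zero[OF div_free_poly_inner[OF f] G G])
        fix s t assume "s \<in> G" "t \<in> G"
        thus "f (vector [s, t]) \<bullet> b = 0" using z[of "(s, t, b)"] b by (simp add: L_def)
      qed
      hence fb: "f x \<bullet> b = 0" if "b \<in> Basis" for x b using fun_cong[of "\<lambda>x. f x \<bullet> b" "\<lambda>x. 0" x] that by blast
      show "f = (\<lambda>x. 0)"
      proof
        fix x
        show "f x = 0"
        proof (rule euclidean_eqI)
          fix b :: state assume "b \<in> Basis"
          thus "f x \<bullet> b = 0 \<bullet> b" using fb[of b x] by (simp only: inner_zero_left)
        qed
      qed
    qed
    show "(LINT x:X|lebesgue. (f x + c *\<^sub>R g x) \<bullet> h x) = (LINT x:X|lebesgue. f x \<bullet> h x) + c * (LINT x:X|lebesgue. g x \<bullet> h x)"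
      if "f \<in> div_free_poly X k" "g \<in> div_free_poly X k" "h \<in> div_free_poly X k" for f g h c
    proof -
      have i: "set_integrable lebesgue X (\<lambda>x. f x \<bullet> h x)" "set_integrable lebesgue X (\<lambda>x. g x \<bullet> h x)"
        using that X by (auto intro: div_free_poly_inner_integrable)
      have "(LINT x:X|lebesgue. f x \<bullet> h x + c * (g x \<bullet> h x)) = (LINT x:X|lebesgue. f x \<bullet> h x) + (LINT x:X|lebesgue. c * (g x \<bullet> h x))"
        by (rule set_integral_add(2)) (use i in auto)
      thus ?thesis by (simp add: inner_add_left)
    qed
    show "(LINT x:X|lebesgue. f x \<bullet> g x) = (LINT x:X|lebesgue. g x \<bullet> f x)" for f g :: "pt \<Rightarrow> state"
      by (simp add: inner_commute)
    show "0 < (LINT x:X|lebesgue. f x \<bullet> f x)" if "f \<in> div_free_poly X k" "f \<noteq> (\<lambda>x. 0)" for f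
      using div_free_poly_pos[OF X that(1)] that(2) by force
  qed (rule J)
qed

lemma div_free_poly_unique:
  assumes X: "compact X" "interior X \<noteq> {}" and w: "w \<in> div_free_poly X k" "w' \<in> div_free_poly X k"
    and eq: "\<And>v. v \<in> div_free_poly X k \<Longrightarrow> (LINT x:X|lebesgue. w x \<bullet> v x) = (LINT x:X|lebesgue. w' x \<bullet> v x)"
  shows "w = w'"
proof -
  define d where "d = (\<lambda>x. w x + (- 1) *\<^sub>R w' x)"
  have d: "d \<in> div_free_poly X k" unfolding d_def by (rule div_free_poly_lin[OF w])
  have "(LINT x:X|lebesgue. d x \<bullet> d x) = (LINT x:X|lebesgue. w x \<bullet> d x - w' x \<bullet> d x)"
    by (simp add: d_def inner_diff_left)
  also have "\<dots> = (LINT x:X|lebesgue. w x \<bullet> d x) - (LINT x:X|lebesgue. w' x \<bullet> d x)"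
    by (rule set_integral_diff(2)) (use X w d in \<open>auto intro: div_free_poly_inner_integrable\<close>)
  also have "\<dots> = 0" using eq[OF d] by simp
  finally have "d = (\<lambda>x. 0)" using div_free_poly_pos[OF X d] by simp
  hence "d x = 0" for x by (rule fun_cong)
  thus ?thesis by (auto simp: d_def)
qed

section \<open>Cell averages and the limiter\<close>

lemma mesh_cell:
  assumes "valid_mesh M"
  shows "polygonal_cell (cell M K) (edges M K)" "compact (cell M K)" "interior (cell M K) \<noteq> {}"
    "finite (edges M K)" "negligible (frontier (cell M K))" "area M K > 0"
proof -
  show P: "polygonal_cell (cell M K) (edges M K)" using assms by (simp add: valid_mesh_def)
  thus c: "compact (cell M K)" and i: "interior (cell M K) \<noteq> {}" and f: "finite (edges M K)"
    by (auto simp: polygonal_cell_def)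
  have "negligible (segm e)" for e
  proof -
    have "interior (closed_segment (fst e) (snd e)) = {}" by (rule interior_closed_segment_ge2) simp
    thus ?thesis unfolding segm_def by (simp add: negligible_convex_interior)
  qed
  moreover have "frontier (cell M K) = (\<Union>e\<in>edges M K. segm e)" using P by (simp add: polygonal_cell_def)
  ultimately show "negligible (frontier (cell M K))" using f by (auto intro!: negligible_Union)
  have "\<not> negligible (interior (cell M K))" using i by (simp add: open_not_negligible)
  hence "\<not> negligible (cell M K)" using negligible_subset interior_subset by blast
  hence "measure lebesgue (cell M K) \<noteq> 0"
    using negligible_iff_measure0[OF lmeasurable_compact[OF c]] by simp
  thus "area M K > 0" unfolding area_def using measure_nonneg[of lebesgue "cell M K"] by linarith
qed

lemma cell_avg_inner:
  assumes "set_integrable lebesgue (cell M K) (u K)"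
  shows "cell_avg M u K \<bullet> c = (1 / area M K) * (LINT x:cell M K|lebesgue. u K x \<bullet> c)"
proof -
  have "(LINT x:cell M K|lebesgue. u K x) \<bullet> c = (LINT x:cell M K|lebesgue. u K x \<bullet> c)"
    using integral_inner_left[of c lebesgue "\<lambda>x. indicator (cell M K) x *\<^sub>R u K x"] assms
    by (simp add: set_lebesgue_integral_def set_integrable_def)
  thus ?thesis by (simp add: cell_avg_def)
qed

lemma div_free_poly_integrable: "compact X \<Longrightarrow> p \<in> div_free_poly X k \<Longrightarrow> set_integrable lebesgue X p"
  by (intro cont_set_integrable div_free_poly_continuous) auto

lemma cell_avg_quad:
  assumes M: "valid_mesh M" and R: "valid_quads M k R" and u: "u K \<in> div_free_poly (cell M K) k"
  shows "cell_avg M u K = (\<Sum>e\<in>edges M K. \<Sum>q<k+1. ewt R K e q *\<^sub>R u K (edge_pt R e q)) +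
          (\<Sum>q<inum R K. iwt R K q *\<^sub>R u K (ipt R K q))"
proof (rule euclidean_eqI)
  fix b :: state assume "b \<in> Basis"
  have f: "(\<lambda>x. u K x \<bullet> b) \<in> poly2 k" by (rule div_free_poly_inner[OF u])
  have "cell_avg M u K \<bullet> b = (1 / area M K) * (LINT x:cell M K|lebesgue. u K x \<bullet> b)"
    by (rule cell_avg_inner[where u = u and K = K and M = M, OF div_free_poly_integrable[OF mesh_cell(2)[OF M] u]])
  also have "\<dots> = (\<Sum>e\<in>edges M K. \<Sum>q<k+1. ewt R K e q * (u K (edge_pt R e q) \<bullet> b)) +
          (\<Sum>q<inum R K. iwt R K q * (u K (ipt R K q) \<bullet> b))"
    using R f unfolding valid_quads_def by blast
  finally show "cell_avg M u K \<bullet> b = ((\<Sum>e\<in>edges M K. \<Sum>q<k+1. ewt R K e q *\<^sub>R u K (edge_pt R e q)) +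
          (\<Sum>q<inum R K. iwt R K q *\<^sub>R u K (ipt R K q))) \<bullet> b"
    unfolding inner_add_left inner_sum_left inner_scaleR_left .
qed

lemma cell_avg_local: "cell_avg M u K = cell_avg M (\<lambda>_. u K) K"
  by (simp add: cell_avg_def)

text \<open>The special quadrature with its edge and remaining nodes merged into one index set. All
  that matters here is that a cell average is a convex combination of values at nodes where the
  limiter acts.\<close>

definition positive_rule :: "'c mesh \<Rightarrow> nat \<Rightarrow> 'c quads \<Rightarrow> 'c \<Rightarrow> 'i set \<Rightarrow> ('i \<Rightarrow> real) \<Rightarrow> ('i \<Rightarrow> pt) \<Rightarrow> bool" where
  "positive_rule M k R K I W X \<longleftrightarrow> finite I \<and> (\<forall>i\<in>I. W i > 0) \<and> sum W I = 1 \<and> X ` I \<subseteq> nodes M k R K \<and>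
     (\<forall>p\<in>div_free_poly (cell M K) k. cell_avg M (\<lambda>_. p) K = (\<Sum>i\<in>I. W i *\<^sub>R p (X i)))"

lemma positive_ruleD:
  assumes "positive_rule M k R K I W X"
  shows "finite I" "\<And>i. i \<in> I \<Longrightarrow> W i > 0" "sum W I = 1" "X ` I \<subseteq> nodes M k R K"
    "\<And>p. p \<in> div_free_poly (cell M K) k \<Longrightarrow> cell_avg M (\<lambda>_. p) K = (\<Sum>i\<in>I. W i *\<^sub>R p (X i))"
  using assms unfolding positive_rule_def by blast+

lemma ex_positive_rule:
  assumes M: "valid_mesh M" and R: "valid_quads M k R"
  shows "\<exists>(I :: (edge \<times> nat + nat) set) W X. positive_rule M k R K I W X"
proof -
  define I where "I = (edges M K \<times> {..<k+1}) <+> {..<inum R K}"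
  define W where "W = case_sum (\<lambda>(e, q). ewt R K e q) (iwt R K)"
  define X where "X = case_sum (\<lambda>(e, q). edge_pt R e q) (ipt R K)"
  have fin: "finite (edges M K)" by (rule mesh_cell(4)[OF M])
  have S: "(\<Sum>i\<in>I. W i *\<^sub>R g (X i)) = (\<Sum>e\<in>edges M K. \<Sum>q<k+1. ewt R K e q *\<^sub>R g (edge_pt R e q)) +
          (\<Sum>q<inum R K. iwt R K q *\<^sub>R g (ipt R K q))" for g :: "pt \<Rightarrow> 'v::real_vector"
    unfolding I_def using fin
    by (subst sum.Plus) (auto simp: W_def X_def sum.cartesian_product case_prod_unfold simp del: sum.lessThan_Suc lessThan_Suc)
  have "positive_rule M k R K I W X"
    unfolding positive_rule_def
  proof (intro conjI ballI)
    show "finite I" using fin by (simp add: I_def)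
    show "W i > 0" if "i \<in> I" for i
      using that R unfolding valid_quads_def by (auto simp: I_def W_def)
    show "sum W I = 1"
      using S[of "\<lambda>_. 1::real"] R unfolding valid_quads_def by simp
    show "X ` I \<subseteq> nodes M k R K"
      unfolding nodes_def special_nodes_def I_def X_def by auto
    show "cell_avg M (\<lambda>_. p) K = (\<Sum>i\<in>I. W i *\<^sub>R p (X i))" if "p \<in> div_free_poly (cell M K) k" for p
      unfolding S by (rule cell_avg_quad[OF M R]) (rule that)
  qed
  thus ?thesis by blast
qed

lemma finite_nodes: "valid_mesh M \<Longrightarrow> finite (nodes M k R K)"
  using mesh_cell(4)[of M K] by (auto simp: nodes_def special_nodes_def volume_nodes_def)

lemma dens_lin: "linear dens" and ener_lin: "linear ener" and mom_lin: "linear mom" and mag_lin: "linear mag"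
  by (auto intro!: linearI simp: dens_def ener_def mom_def mag_def)

lemmas state_linear = linear_add[OF dens_lin] linear_add[OF ener_lin] linear_add[OF mom_lin] linear_add[OF mag_lin]
  linear_diff[OF dens_lin] linear_diff[OF ener_lin] linear_diff[OF mom_lin] linear_diff[OF mag_lin]
  linear_cmul[OF dens_lin] linear_cmul[OF ener_lin] linear_cmul[OF mom_lin] linear_cmul[OF mag_lin]

lemma state_eqI: "dens U = dens V \<Longrightarrow> mom U = mom V \<Longrightarrow> mag U = mag V \<Longrightarrow> ener U = ener V \<Longrightarrow> U = V"
  by (auto simp: dens_def ener_def mom_def mag_def intro!: prod_eqI)

lemma diag_map_sel [simp]:
  "dens (diag_map a b c d U) = a * dens U" "mom (diag_map a b c d U) = b *\<^sub>R mom U"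
  "mag (diag_map a b c d U) = c *\<^sub>R mag U" "ener (diag_map a b c d U) = d * ener U"
  by (simp_all add: diag_map_def)

text \<open>The deviation from the average has mean zero, and a linear map keeps it so.\<close>

lemma cell_avg_diag_map:
  assumes M: "valid_mesh M" and R: "valid_quads M k R"
    and p: "p \<in> div_free_poly (cell M K) k" and a: "cell_avg M (\<lambda>_. p) K = a"
  shows "cell_avg M (\<lambda>_ x. diag_map c1 c2 c3 c4 (p x - a) + a) K = a"
proof -
  obtain I :: "(edge \<times> nat + nat) set" and W X where pr: "positive_rule M k R K I W X"
    using ex_positive_rule[OF M R] by blast
  note I = positive_ruleD[OF pr]
  interpret d: linear "diag_map c1 c2 c3 c4" by (rule linear_diag_map)
  have s: "(\<Sum>i\<in>I. W i *\<^sub>R a) = a" using I(3) by (simp flip: scaleR_sum_left)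
  have "(\<Sum>i\<in>I. W i *\<^sub>R (p (X i) - a)) = 0"
    unfolding scaleR_diff_right sum_subtractf s I(5)[OF p, symmetric] a by simp
  hence "(\<Sum>i\<in>I. W i *\<^sub>R diag_map c1 c2 c3 c4 (p (X i) - a)) = 0"
    using d.sum[of "\<lambda>i. W i *\<^sub>R (p (X i) - a)" I] by (simp only: d.scaleR d.zero)
  thus ?thesis using I(5)[OF div_free_poly_diag_map[OF p, of c1 c2 c3 c4 a]] s
    by (simp add: scaleR_add_right sum.distrib)
qed

section \<open>The three scaling steps\<close>

text \<open>Serves both the density and the \<open>qfun\<close> step: \<open>A\<close> is the value
  at the cell average and \<open>m\<close> the minimum over the nodes. The factor is the largest in
  [0, 1] that lifts even the minimum to \<epsilon>, with the value 1 when the denominator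
  vanishes.\<close>

lemma theta_bound:
  fixes A m \<epsilon> y :: real
  assumes "m \<le> A" "\<epsilon> \<le> A" "m \<le> y"
  defines "\<theta> \<equiv> (if A - m = 0 then 1 else min 1 ((A - \<epsilon>) / (A - m)))"
  shows "0 \<le> \<theta>" "\<theta> \<le> 1" "\<epsilon> \<le> \<theta> * (y - A) + A"
proof -
  show 0: "0 \<le> \<theta>" and "\<theta> \<le> 1" using assms by (auto simp: \<theta>_def)
  have "\<theta> * (A - m) \<le> A - \<epsilon>"
  proof (cases "A - m = 0")
    case False
    hence "\<theta> \<le> (A - \<epsilon>) / (A - m)" "A - m > 0" using assms by (auto simp: \<theta>_def)
    thus ?thesis by (simp add: pos_le_divide_eq)
  qed (use assms in simp)
  moreover have "\<theta> * (A - y) \<le> \<theta> * (A - m)" using 0 assms by (intro mult_left_mono) auto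
  ultimately show "\<epsilon> \<le> \<theta> * (y - A) + A" by (simp add: algebra_simps)
qed

lemma qfun_eq: "qfun U = ener U - norm (dens U, mom U)"
  by (simp add: qfun_def norm_Pair)

text \<open>Concavity: \<open>qfun\<close> is linear minus a norm. It shows in particular that the
  node minimum of \<open>qfun\<close> does not exceed its value at the cell average, as
  \<open>theta_bound\<close> demands.\<close>

lemma qfun_sum:
  assumes "\<And>i. i \<in> I \<Longrightarrow> W i \<ge> 0"
  shows "(\<Sum>i\<in>I. W i * qfun (U i)) \<le> qfun (\<Sum>i\<in>I. W i *\<^sub>R U i)"
proof -
  have "(dens (\<Sum>i\<in>I. W i *\<^sub>R U i), mom (\<Sum>i\<in>I. W i *\<^sub>R U i)) = (\<Sum>i\<in>I. W i *\<^sub>R (dens (U i), mom (U i)))"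
    by (intro prod_eqI) (simp_all add: fst_sum snd_sum linear_sum[OF dens_lin] linear_sum[OF mom_lin] state_linear)
  hence "norm (dens (\<Sum>i\<in>I. W i *\<^sub>R U i), mom (\<Sum>i\<in>I. W i *\<^sub>R U i)) \<le> (\<Sum>i\<in>I. norm (W i *\<^sub>R (dens (U i), mom (U i))))"
    by (simp only: norm_sum)
  also have "\<dots> = (\<Sum>i\<in>I. W i * norm (dens (U i), mom (U i)))"
    using assms by (intro sum.cong) (auto simp del: scaleR_Pair)
  finally show ?thesis
    unfolding qfun_eq linear_sum[OF ener_lin] state_linear by (simp add: right_diff_distrib sum_subtractf)
qed

lemma qfun_convex:
  assumes "0 \<le> t" "t \<le> 1" "qfun U \<ge> \<epsilon>" "qfun V \<ge> \<epsilon>"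
  shows "qfun ((1 - t) *\<^sub>R U + t *\<^sub>R V) \<ge> \<epsilon>"
proof -
  have "(\<Sum>i\<in>{False, True}. (if i then t else 1 - t) * qfun (if i then V else U))
     \<le> qfun (\<Sum>i\<in>{False, True}. (if i then t else 1 - t) *\<^sub>R (if i then V else U))"
    by (rule qfun_sum) (use assms in auto)
  hence "(1 - t) * qfun U + t * qfun V \<le> qfun ((1 - t) *\<^sub>R U + t *\<^sub>R V)" by simp
  moreover have "(1 - t) * \<epsilon> + t * \<epsilon> \<le> (1 - t) * qfun U + t * qfun V"
    using assms by (intro add_mono mult_left_mono) auto
  ultimately show ?thesis by (simp add: algebra_simps)
qed

lemma continuous_Psi_eps: "continuous_on A (Psi_eps \<epsilon>)"
  unfolding Psi_eps_def[abs_def] Psi_def Phi_def state_sel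
  unfolding dens_def mom_def mag_def ener_def
  by (intro continuous_intros)

text \<open>If \<open>Psi_eps \<epsilon> U\<close> is negative, the intermediate value theorem on
  the segment from \<open>a\<close> to \<open>U\<close> supplies a root, so the choice operator is
  not void; every root has the listed properties.\<close>

lemma theta_tilde:
  assumes a: "Psi_eps \<epsilon> a \<ge> 0"
  shows "0 \<le> theta_tilde \<epsilon> a U" "theta_tilde \<epsilon> a U \<le> 1"
    "Psi_eps \<epsilon> ((1 - theta_tilde \<epsilon> a U) *\<^sub>R a + theta_tilde \<epsilon> a U *\<^sub>R U) \<ge> 0"
proof -
  have "0 \<le> theta_tilde \<epsilon> a U \<and> theta_tilde \<epsilon> a U \<le> 1 \<and>
    Psi_eps \<epsilon> ((1 - theta_tilde \<epsilon> a U) *\<^sub>R a + theta_tilde \<epsilon> a U *\<^sub>R U) \<ge> 0"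
  proof (cases "Psi_eps \<epsilon> U \<ge> 0")
    case False
    define g where "g = (\<lambda>t::real. Psi_eps \<epsilon> ((1 - t) *\<^sub>R a + t *\<^sub>R U))"
    have "continuous_on {0..1} g"
      unfolding g_def by (rule continuous_on_compose2[OF continuous_Psi_eps[of UNIV]]) (auto intro!: continuous_intros)
    moreover have "g 1 \<le> 0" "0 \<le> g 0" using a False by (auto simp: g_def)
    ultimately obtain t where t: "0 \<le> t" "t \<le> 1" "g t = 0" using IVT2'[of g 1 0 0] by auto
    have "t \<noteq> 1" using t(3) False by (auto simp: g_def)
    hence "\<exists>t. 0 \<le> t \<and> t < 1 \<and> Psi_eps \<epsilon> ((1 - t) *\<^sub>R a + t *\<^sub>R U) = 0"
      using t by (intro exI[of _ t]) (auto simp: g_def)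
    from someI_ex[OF this] show ?thesis using False by (simp add: theta_tilde_def)
  qed (simp add: theta_tilde_def)
  thus "0 \<le> theta_tilde \<epsilon> a U" "theta_tilde \<epsilon> a U \<le> 1"
    "Psi_eps \<epsilon> ((1 - theta_tilde \<epsilon> a U) *\<^sub>R a + theta_tilde \<epsilon> a U *\<^sub>R U) \<ge> 0" by auto
qed

lemma limit_eq:
  "limit1 S \<epsilon> a u x = diag_map (theta1 S \<epsilon> a u) 1 1 1 (u x - a) + a"
  "limit2 S \<epsilon> a u x = diag_map (theta2 S \<epsilon> a u) (theta2 S \<epsilon> a u) 1 (theta2 S \<epsilon> a u) (u x - a) + a"
  "limit3 S \<epsilon> a u x = diag_map (theta3 S \<epsilon> a u) (theta3 S \<epsilon> a u) (theta3 S \<epsilon> a u) (theta3 S \<epsilon> a u) (u x - a) + a"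
  by (auto intro!: state_eqI simp: limit1_def limit2_def limit3_def Let_def state_linear)

text \<open>Each scaling is towards the cell average, which stays fixed, and each preserves what the
  earlier ones achieved. Membership of the final node values is tested on the half spaces, where a
  segment needs checking only at its ends; convexity of \<open>G_eps \<epsilon>\<close> is not
  invoked for the last step.\<close>

lemma cell_limiter:
  fixes M :: "('c::finite) mesh"
  assumes M: "valid_mesh M" and R: "valid_quads M k R" and p: "p \<in> div_free_poly (cell M K) k"
    and a: "cell_avg M (\<lambda>_. p) K = a" "a \<in> G_eps \<epsilon>" and \<epsilon>: "\<epsilon> > 0" and S: "S = nodes M k R K"
    and r: "r = limit3 S \<epsilon> a (limit2 S \<epsilon> a (limit1 S \<epsilon> a p))"
  shows "r \<in> div_free_poly (cell M K) k" "cell_avg M (\<lambda>_. r) K = a" "\<And>x. x \<in> S \<Longrightarrow> r x \<in> Gstar"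
proof -
  define p1 where "p1 = limit1 S \<epsilon> a p"
  define p2 where "p2 = limit2 S \<epsilon> a p1"
  have r: "r = limit3 S \<epsilon> a p2" by (simp add: r p1_def p2_def)
  have p1: "p1 \<in> div_free_poly (cell M K) k" "cell_avg M (\<lambda>_. p1) K = a"
    unfolding p1_def limit_eq(1)[abs_def] by (intro div_free_poly_diag_map p cell_avg_diag_map[OF M R] a(1))+
  have p2: "p2 \<in> div_free_poly (cell M K) k" "cell_avg M (\<lambda>_. p2) K = a"
    unfolding p2_def limit_eq(2)[abs_def] by (intro div_free_poly_diag_map p1 cell_avg_diag_map[OF M R])+
  show "r \<in> div_free_poly (cell M K) k" "cell_avg M (\<lambda>_. r) K = a"
    unfolding r limit_eq(3)[abs_def] by (intro div_free_poly_diag_map p2 cell_avg_diag_map[OF M R])+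
  obtain I :: "(edge \<times> nat + nat) set" and W X where pr: "positive_rule M k R K I W X"
    using ex_positive_rule[OF M R] by blast
  note I = positive_ruleD[OF pr]
  have fin: "finite S" unfolding S by (rule finite_nodes[OF M])
  note IS = I(4)[folded S]
  have ne: "S \<noteq> {}" using I(3) IS by force
  have Min_le: "Min (g ` S) \<le> (\<Sum>i\<in>I. W i * g (X i))" for g :: "pt \<Rightarrow> real"
  proof -
    have "(\<Sum>i\<in>I. W i * Min (g ` S)) \<le> (\<Sum>i\<in>I. W i * g (X i))"
      using I(1,2) IS fin by (intro sum_mono mult_left_mono Min_le) (auto intro: less_imp_le)
    thus ?thesis using I(3) by (simp flip: sum_distrib_right)
  qed
  have a': "dens a \<ge> \<epsilon>" "qfun a \<ge> \<epsilon>" "Psi_eps \<epsilon> a \<ge> 0" using a(2) by (auto simp: G_eps_def)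
  have d1: "dens (p1 x) \<ge> \<epsilon>" if x: "x \<in> S" for x
  proof -
    have "Min ((\<lambda>x. dens (p x)) ` S) \<le> dens a"
      using Min_le[of "\<lambda>x. dens (p x)"] I(5)[OF p] a(1) by (simp add: linear_sum[OF dens_lin] state_linear)
    moreover have "Min ((\<lambda>x. dens (p x)) ` S) \<le> dens (p x)" using fin x by simp
    ultimately have "\<epsilon> \<le> theta1 S \<epsilon> a p * (dens (p x) - dens a) + dens a"
      unfolding theta1_def Let_def by (intro theta_bound(3) a')
    thus ?thesis by (simp add: p1_def limit1_def)
  qed
  define \<theta> where "\<theta> = theta2 S \<epsilon> a p1"
  have qa: "Min ((\<lambda>x. qfun (p1 x)) ` S) \<le> qfun a"
  proof -
    have "(\<Sum>i\<in>I. W i * qfun (p1 (X i))) \<le> qfun a"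
      using qfun_sum[of I W "\<lambda>i. p1 (X i)"] I(2) I(5)[OF p1(1)] p1(2) by (simp add: less_imp_le)
    thus ?thesis using Min_le[of "\<lambda>x. qfun (p1 x)"] by simp
  qed
  have \<theta>: "0 \<le> \<theta>" "\<theta> \<le> 1" and q\<theta>: "x \<in> S \<Longrightarrow> \<epsilon> \<le> \<theta> * (qfun (p1 x) - qfun a) + qfun a" for x
    unfolding \<theta>_def theta2_def Let_def
    using theta_bound(1,2)[OF qa a'(2) order_refl] theta_bound(3)[OF qa a'(2), of "qfun (p1 x)"] fin by auto
  have d2: "dens (p2 x) \<ge> \<epsilon>" "qfun (p2 x) \<ge> \<epsilon>" if x: "x \<in> S" for x
  proof -
    have "(1 - \<theta>) * \<epsilon> + \<theta> * \<epsilon> \<le> (1 - \<theta>) * dens a + \<theta> * dens (p1 x)"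
      using \<theta> a' d1[OF x] by (intro add_mono mult_left_mono) auto
    thus "dens (p2 x) \<ge> \<epsilon>" by (simp add: p2_def limit2_def Let_def \<theta>_def[symmetric] algebra_simps)
    \<comment> \<open>Step 2 leaves the magnetic field unscaled, so \<open>p2 x\<close> itself is
      not on the segment from \<open>a\<close> to \<open>p1 x\<close>; but \<open>qfun\<close> does
      not see the magnetic field.\<close>
    have "qfun (p2 x) = qfun ((1 - \<theta>) *\<^sub>R a + \<theta> *\<^sub>R p1 x)"
      unfolding qfun_eq state_linear
      by (simp add: p2_def limit2_def Let_def \<theta>_def[symmetric] algebra_simps)
    moreover have "(1 - \<theta>) * qfun a + \<theta> * qfun (p1 x) \<le> qfun ((1 - \<theta>) *\<^sub>R a + \<theta> *\<^sub>R p1 x)"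
      using qfun_sum[of "{False, True}" "\<lambda>i. if i then \<theta> else 1 - \<theta>" "\<lambda>i. if i then p1 x else a"] \<theta> by simp
    ultimately show "qfun (p2 x) \<ge> \<epsilon>" using q\<theta>[OF x] by (simp add: algebra_simps)
  qed
  fix x assume x: "x \<in> S"
  define t where "t = theta3 S \<epsilon> a p2"
  define s where "s = theta_tilde \<epsilon> a (p2 x)"
  have s: "0 \<le> s" "s \<le> 1" "Psi_eps \<epsilon> ((1 - s) *\<^sub>R a + s *\<^sub>R p2 x) \<ge> 0"
    unfolding s_def by (rule theta_tilde[OF a'(3)])+
  \<comment> \<open>The factor of step 3 is a minimum over all nodes, so \<open>r x\<close> lies
    between \<open>a\<close> and the point with parameter \<open>s\<close> at which
    \<open>Psi_eps\<close> is known to be nonnegative.\<close>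
  have t: "0 \<le> t" "t \<le> s"
    unfolding t_def s_def theta3_def using fin ne x theta_tilde(1)[OF a'(3)] by (auto simp: Min_ge_iff)
  have rx: "r x = (1 - t) *\<^sub>R a + t *\<^sub>R p2 x" by (simp add: r limit3_def t_def[symmetric] algebra_simps)
  have dm: "dens ((1 - c) *\<^sub>R a + c *\<^sub>R p2 x) \<ge> \<epsilon>" if "0 \<le> c" "c \<le> 1" for c
  proof -
    have "(1 - c) * \<epsilon> + c * \<epsilon> \<le> (1 - c) * dens a + c * dens (p2 x)"
      using that a' d2[OF x] by (intro add_mono mult_left_mono) auto
    thus ?thesis by (simp add: state_linear algebra_simps)
  qed
  have "dens (r x) > 0" using dm[of t] t s \<epsilon> by (simp add: rx)
  moreover have "r x \<bullet> nst w C + pst w C > 0" if w: "norm w < 1" for w C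
  proof -
    have 0: "a \<bullet> nst w C + pst w C \<ge> \<epsilon>" by (rule Psi_eps_nonneg_imp) (use a' \<epsilon> w in auto)
    have 1: "((1 - s) *\<^sub>R a + s *\<^sub>R p2 x) \<bullet> nst w C + pst w C \<ge> \<epsilon>"
      by (rule Psi_eps_nonneg_imp[OF _ _ s(3) w]) (use dm[of s] s \<epsilon> qfun_convex[OF s(1,2) a'(2) d2(2)[OF x]] in auto)
    \<comment> \<open>The slope of the functional along the segment. Its value is at least
      \<epsilon> at parameters 0 and \<open>s\<close>, hence at \<open>t\<close> in between.\<close>
    define l where "l = p2 x \<bullet> nst w C - a \<bullet> nst w C"
    have "a \<bullet> nst w C + pst w C + s * l \<ge> \<epsilon>" using 1 by (simp add: l_def inner_add_left algebra_simps)
    moreover have "t * l \<ge> min 0 (s * l)"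
    proof (cases "l \<ge> 0")
      case False
      hence "s * l \<le> t * l" using t by (intro mult_right_mono_neg) auto
      thus ?thesis by simp
    qed (use t in auto)
    ultimately have "a \<bullet> nst w C + pst w C + t * l \<ge> \<epsilon>" using 0 by (auto simp: min_def split: if_splits)
    moreover have "r x \<bullet> nst w C + pst w C = a \<bullet> nst w C + pst w C + t * l"
      by (simp add: rx l_def inner_add_left algebra_simps)
    ultimately show ?thesis using \<epsilon> by simp
  qed
  ultimately show "r x \<in> Gstar" by (simp add: Gstar_def)
qed

lemma limiter_Gh:
  fixes M :: "('c::finite) mesh"
  assumes eos: "eos H" and cold: "no_cold_energy H" and M: "valid_mesh M" and R: "valid_quads M k R"
    and eps: "eps_rule H M k eps" and u: "u \<in> Gh_bar H M k"
  shows "limiter M k R eps u \<in> Gh H M k R"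
proof -
  have uV: "u K \<in> div_free_poly (cell M K) k" and uA: "cell_avg M u K \<in> admissible H" for K
    using u by (auto simp: Gh_bar_def Wh_iff)
  show ?thesis
  proof (cases "k = 0")
    case False
    have e: "eps u > 0" "cell_avg M u K \<in> G_eps (eps u)" for K using eps u by (auto simp: eps_rule_def)
    define w where "w = limiter M k R eps u"
    have w: "w K = (let S = nodes M k R K; \<epsilon> = eps u; a = cell_avg M u K in
        limit3 S \<epsilon> a (limit2 S \<epsilon> a (limit1 S \<epsilon> a (u K))))" for K
      using False by (simp add: w_def limiter_def)
    have "w K \<in> div_free_poly (cell M K) k" "cell_avg M (\<lambda>_. w K) K = cell_avg M u K"
       "\<And>x. x \<in> nodes M k R K \<Longrightarrow> w K x \<in> Gstar" for K
      using cell_limiter[OF M R uV cell_avg_local[symmetric] e(2) e(1) refl w[unfolded Let_def]] by blast+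
    thus ?thesis unfolding w_def[symmetric]
      using uA Gstar_imp_admissible[OF eos cold] by (auto simp: Gh_def Gh_bar_def Wh_iff cell_avg_local[of M w])
  next
    case True
    \<comment> \<open>For degree 0 the limiter is the identity, but a constant agrees with its
      average, which is admissible.\<close>
    have "u K x = cell_avg M u K" for K x
    proof -
      obtain I :: "(edge \<times> nat + nat) set" and W X where pr: "positive_rule M k R K I W X"
        using ex_positive_rule[OF M R] by blast
      note I = positive_ruleD[OF pr]
      have "u K y = u K x" for y
      proof (rule euclidean_eqI)
        fix b :: state
        have "(\<lambda>x. u K x \<bullet> b) \<in> poly2 0" using div_free_poly_inner[OF uV] True by simp
        then obtain c where c: "(\<lambda>x. u K x \<bullet> b) = (\<lambda>x. c)" unfolding poly2_def by auto
        show "u K y \<bullet> b = u K x \<bullet> b" using fun_cong[OF c, of x] fun_cong[OF c, of y] by simp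
      qed
      hence "(\<Sum>i\<in>I. W i *\<^sub>R u K (X i)) = (\<Sum>i\<in>I. W i *\<^sub>R u K x)" by (intro sum.cong refl arg_cong2[of _ _ _ _ scaleR])
      hence "cell_avg M (\<lambda>_. u K) K = (\<Sum>i\<in>I. W i *\<^sub>R u K x)" using I(5)[OF uV] by (rule trans[rotated])
      also have "\<dots> = u K x" using I(3) by (simp flip: scaleR_sum_left)
      finally have "cell_avg M (\<lambda>_. u K) K = u K x" .
      thus ?thesis by (subst cell_avg_local) (rule sym)
    qed
    hence "u K x \<in> admissible H" for K x using uA[of K] by (rule ssubst)
    thus ?thesis using u True by (simp add: limiter_def Gh_def)
  qed
qed

section \<open>The discontinuous Galerkin operator and the projection\<close>

lemma dg_form_local: "dg_form H M k R K U u = dg_form H M k R K U (\<lambda>_. u K)"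
  by (simp add: dg_form_def)

lemma dg_form_lin:
  assumes "f \<in> div_free_poly X k" "g \<in> div_free_poly X k"
  shows "dg_form H M k R K U (\<lambda>_ x. f x + c *\<^sub>R g x)
    = dg_form H M k R K U (\<lambda>_. f) + c * dg_form H M k R K U (\<lambda>_. g)"
proof -
  have p: "partial i (\<lambda>x. f x + c *\<^sub>R g x) x = partial i f x + c *\<^sub>R partial i g x" for i x
    by (rule partial_lin) (use assms div_free_poly_differentiable in blast)+
  show ?thesis
    unfolding dg_form_def Let_def p
    by (simp add: inner_add_right sum.distrib sum_distrib_left distrib_left del: sum.lessThan_Suc)
       (simp add: sum_distrib_left sum_negf algebra_simps del: sum.lessThan_Suc)
qed

text \<open>\<open>Lh\<close> and \<open>proj_Wh\<close> are definite descriptions, so existence and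
  uniqueness must both be secured before anything can be said about them. Test functions that vanish
  on all cells but one decouple the cells.\<close>

lemma ex1_riesz_Wh:
  fixes M :: "('c::finite) mesh"
  assumes M: "valid_mesh M"
    and J: "\<And>K f g c. f \<in> div_free_poly (cell M K) k \<Longrightarrow> g \<in> div_free_poly (cell M K) k \<Longrightarrow> J K (\<lambda>x. f x + c *\<^sub>R g x) = J K f + c * J K g"
  shows "\<exists>!w. w \<in> Wh M k \<and> (\<forall>u\<in>Wh M k. \<forall>K. (LINT x:cell M K|lebesgue. w K x \<bullet> u K x) = J K (u K))"
proof -
  note C = mesh_cell(2,3)[OF M]
  have "\<forall>K. \<exists>w. w \<in> div_free_poly (cell M K) k \<and> (\<forall>v\<in>div_free_poly (cell M K) k. (LINT x:cell M K|lebesgue. w x \<bullet> v x) = J K v)"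
  proof
    fix K
    have "\<exists>w\<in>div_free_poly (cell M K) k. \<forall>v\<in>div_free_poly (cell M K) k. (LINT x:cell M K|lebesgue. w x \<bullet> v x) = J K v"
      by (rule div_free_poly_riesz[OF C]) (rule J)
    thus "\<exists>w. w \<in> div_free_poly (cell M K) k \<and> (\<forall>v\<in>div_free_poly (cell M K) k. (LINT x:cell M K|lebesgue. w x \<bullet> v x) = J K v)"
      by blast
  qed
  then obtain w where w: "w K \<in> div_free_poly (cell M K) k"
    "\<And>v. v \<in> div_free_poly (cell M K) k \<Longrightarrow> (LINT x:cell M K|lebesgue. w K x \<bullet> v x) = J K v" for K
    by (auto dest!: choice)
  show ?thesis
  proof (rule ex1I[of _ w])
    show "w \<in> Wh M k \<and> (\<forall>u\<in>Wh M k. \<forall>K. (LINT x:cell M K|lebesgue. w K x \<bullet> u K x) = J K (u K))"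
      using w by (simp add: Wh_iff)
    fix w' assume w': "w' \<in> Wh M k \<and> (\<forall>u\<in>Wh M k. \<forall>K. (LINT x:cell M K|lebesgue. w' K x \<bullet> u K x) = J K (u K))"
    show "w' = w"
    proof
      fix K
      show "w' K = w K"
      proof (rule div_free_poly_unique[OF C])
        show "w' K \<in> div_free_poly (cell M K) k" "w K \<in> div_free_poly (cell M K) k" using w' w by (auto simp: Wh_iff)
        fix v assume v: "v \<in> div_free_poly (cell M K) k"
        define u where "u = (\<lambda>L. if L = K then v else (\<lambda>x. 0))"
        have "u \<in> Wh M k" using v by (simp add: Wh_iff u_def div_free_poly_const)
        hence "(LINT x:cell M K|lebesgue. w' K x \<bullet> u K x) = J K (u K)" using w' by blast
        thus "(LINT x:cell M K|lebesgue. w' K x \<bullet> v x) = (LINT x:cell M K|lebesgue. w K x \<bullet> v x)"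
          using w(2)[OF v] by (simp add: u_def)
      qed
    qed
  qed
qed

lemma Lh_Wh:
  fixes M :: "('c::finite) mesh"
  assumes M: "valid_mesh M"
  shows "Lh H M k R U \<in> Wh M k"
    "u \<in> Wh M k \<Longrightarrow> (LINT x:cell M K|lebesgue. Lh H M k R U K x \<bullet> u K x) = dg_form H M k R K U u"
proof -
  have "\<exists>!w. w \<in> Wh M k \<and> (\<forall>u\<in>Wh M k. \<forall>K. (LINT x:cell M K|lebesgue. w K x \<bullet> u K x) = dg_form H M k R K U (\<lambda>_. u K))"
    by (rule ex1_riesz_Wh[OF M]) (rule dg_form_lin)
  hence "\<exists>!w. w \<in> Wh M k \<and> (\<forall>u\<in>Wh M k. \<forall>K. (LINT x:cell M K|lebesgue. w K x \<bullet> u K x) = dg_form H M k R K U u)"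
    by (simp add: dg_form_local[symmetric])
  from theI'[OF this, folded Lh_def] show "Lh H M k R U \<in> Wh M k"
    "u \<in> Wh M k \<Longrightarrow> (LINT x:cell M K|lebesgue. Lh H M k R U K x \<bullet> u K x) = dg_form H M k R K U u"
    by blast+
qed

text \<open>Constants belong to \<open>Wh\<close>, and their derivatives vanish, so the volume term
  of the form drops out and only the edge fluxes are left.\<close>

lemma cell_avg_Lh:
  fixes M :: "('c::finite) mesh"
  assumes M: "valid_mesh M"
  shows "area M K * (cell_avg M (Lh H M k R U) K \<bullet> c) =
     - (\<Sum>e\<in>edges M K. elen e * (\<Sum>q<k+1. gwt R q *
          (let x = edge_pt R e q; n = nrm M K e; Ui = U K x; Ue = trace_ext M U K e x in
             (num_flux H Ui Ue n + ((1/2) * ndot n (mag Ue - mag Ui)) *\<^sub>R source H Ui) \<bullet> c)))"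
proof -
  have c: "(\<lambda>K x. c) \<in> Wh M k" by (simp add: Wh_iff div_free_poly_const)
  have i: "set_integrable lebesgue (cell M K) (Lh H M k R U K)"
    using div_free_poly_integrable[OF mesh_cell(2)[OF M, of K], of "Lh H M k R U K" k] Lh_Wh(1)[OF M, of H k R U] by (simp add: Wh_iff)
  have "area M K * (cell_avg M (Lh H M k R U) K \<bullet> c) = (LINT x:cell M K|lebesgue. Lh H M k R U K x \<bullet> c)"
    using cell_avg_inner[where u = "Lh H M k R U" and K = K and M = M and c = c, OF i] mesh_cell(6)[OF M, of K] by simp
  also have "\<dots> = dg_form H M k R K U (\<lambda>K x. c)" using Lh_Wh(2)[OF M c] by simp
  finally show ?thesis by (simp add: dg_form_def)
qed

section \<open>The L2 projection of the initial data\<close>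

text \<open>The domain may contain an arbitrary part of the cell boundaries. These are null sets, so
  it is still Lebesgue measurable, by completeness.\<close>

lemma mesh_domain:
  fixes M :: "('c::finite) mesh"
  assumes "valid_mesh M"
  shows "interior (cell M K) \<subseteq> domain M" "domain M \<in> sets lebesgue"
proof -
  have d: "(\<Union>K. interior (cell M K)) \<subseteq> domain M" "domain M \<subseteq> (\<Union>K. cell M K)"
    using assms by (auto simp: valid_mesh_def)
  thus "interior (cell M K) \<subseteq> domain M" by auto
  have "domain M - (\<Union>K. interior (cell M K)) \<subseteq> (\<Union>K. frontier (cell M K))"
  proof (rule subsetI)
    fix x assume x: "x \<in> domain M - (\<Union>K. interior (cell M K))"
    hence "x \<in> (\<Union>K. cell M K)" using d(2) by (meson DiffD1 subsetD)
    then obtain K where "x \<in> cell M K" by (rule UN_E)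
    hence "x \<in> frontier (cell M K)" using x closure_subset[of "cell M K"] by (auto simp: frontier_def)
    thus "x \<in> (\<Union>K. frontier (cell M K))" by blast
  qed
  moreover have "negligible (\<Union>K. frontier (cell M K))"
    by (rule negligible_Union) (use mesh_cell(5)[OF assms] in auto)
  ultimately have "negligible (domain M - (\<Union>K. interior (cell M K)))" by (rule negligible_subset[rotated])
  hence "domain M - (\<Union>K. interior (cell M K)) \<in> sets lebesgue" by (rule negligible_imp_sets)
  moreover have "(\<Union>K. interior (cell M K)) \<in> sets lebesgue" by (auto intro!: sets.finite_UN)
  ultimately have "(domain M - (\<Union>K. interior (cell M K))) \<union> (\<Union>K. interior (cell M K)) \<in> sets lebesgue" by (rule sets.Un)
  thus "domain M \<in> sets lebesgue" using d by (simp add: Un_absorb2)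
qed

text \<open>The data are controlled only on the domain, which may miss boundary points of the cell.
  Integrability is shown on the interior from 2 |f| |v| <= |f|^2 + |v|^2 and carried over the
  negligible boundary.\<close>

lemma L2_inner_integrable:
  fixes M :: "('c::finite) mesh"
  assumes M: "valid_mesh M" and f: "f \<in> L2fun (domain M)" and v: "v \<in> div_free_poly (cell M K) k"
  shows "set_integrable lebesgue (cell M K) (\<lambda>x. f x \<bullet> v x)"
proof -
  define S where "S = interior (cell M K)"
  have S: "S \<in> sets lebesgue" "S \<subseteq> domain M" "S \<subseteq> cell M K"
    using mesh_domain(1)[OF M, of K] interior_subset[of "cell M K"] by (auto simp: S_def)
  have fm: "f \<in> borel_measurable (lebesgue_on S)"
    using f S(2) by (auto simp: L2fun_def intro: measurable_restrict_mono)
  have f2: "set_integrable lebesgue S (\<lambda>x. (norm (f x))^2)"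
  proof -
    have "set_integrable lebesgue (domain M) (\<lambda>x. (norm (f x))^2)"
      using f mesh_domain(2)[OF M] by (simp add: L2fun_def integrable_restrict_space set_integrable_def)
    thus ?thesis by (rule set_integrable_subset) (use S in auto)
  qed
  have v2: "set_integrable lebesgue S (\<lambda>x. v x \<bullet> v x)"
    by (rule set_integrable_subset[OF div_free_poly_inner_integrable[OF mesh_cell(2)[OF M] v v]]) (use S in auto)
  have vm: "v \<in> borel_measurable (lebesgue_on S)"
    by (rule continuous_imp_measurable_on_sets_lebesgue[OF div_free_poly_continuous[OF v] S(1)])
  have "set_integrable lebesgue S (\<lambda>x. f x \<bullet> v x)"
    unfolding set_integrable_def
  proof (rule Bochner_Integration.integrable_bound)
    show "integrable lebesgue (\<lambda>x. indicator S x *\<^sub>R ((norm (f x))^2 + v x \<bullet> v x))"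
      using set_integral_add(1)[OF f2 v2] by (simp add: set_integrable_def)
    have "(\<lambda>x. f x \<bullet> v x) \<in> borel_measurable (lebesgue_on S)" using fm vm by measurable
    thus "(\<lambda>x. indicator S x *\<^sub>R (f x \<bullet> v x)) \<in> borel_measurable lebesgue"
      using S(1) by (simp add: borel_measurable_restrict_space_iff)
    have "\<bar>f x \<bullet> v x\<bar> \<le> (norm (f x))^2 + v x \<bullet> v x" for x
    proof -
      have "\<bar>f x \<bullet> v x\<bar> \<le> norm (f x) * norm (v x)" by (rule Cauchy_Schwarz_ineq2)
      moreover have "2 * (norm (f x) * norm (v x)) \<le> (norm (f x))^2 + (norm (v x))^2"
        using sum_squares_bound[of "norm (f x)" "norm (v x)"] by simp
      moreover have "0 \<le> norm (f x) * norm (v x)" by simp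
      ultimately show ?thesis unfolding power2_norm_eq_inner[of "v x", symmetric] by linarith
    qed
    thus "AE x in lebesgue. norm (indicator S x *\<^sub>R (f x \<bullet> v x)) \<le> norm (indicator S x *\<^sub>R ((norm (f x))^2 + v x \<bullet> v x))"
      by (intro AE_I2) (auto simp: indicator_def)
  qed
  moreover have "negligible (cell M K - S)"
    using mesh_cell(5)[OF M, of K] compact_imp_closed[OF mesh_cell(2)[OF M, of K]]
    by (simp add: frontier_def S_def)
  ultimately show ?thesis
    using S(3) by (elim absolutely_integrable_spike_set) (auto elim: negligible_subset)
qed

lemma proj_Wh:
  fixes M :: "('c::finite) mesh"
  assumes M: "valid_mesh M" and f: "f \<in> L2fun (domain M)"
  shows "proj_Wh M k f \<in> Wh M k"
    "v \<in> div_free_poly (cell M K) k \<Longrightarrow> (LINT x:cell M K|lebesgue. proj_Wh M k f K x \<bullet> v x) = (LINT x:cell M K|lebesgue. f x \<bullet> v x)"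
proof -
  define J where "J = (\<lambda>K v. LINT x:cell M K|lebesgue. f x \<bullet> v x)"
  note int = L2_inner_integrable[OF M f]
  have J: "J K (\<lambda>x. g x + c *\<^sub>R h x) = J K g + c * J K h"
    if "g \<in> div_free_poly (cell M K) k" "h \<in> div_free_poly (cell M K) k" for K g h c
    using set_integral_add(2)[OF int[OF that(1)] set_integrable_mult_right[OF int[OF that(2)], of c]]
    by (simp add: J_def inner_add_right)
  have diff: "(LINT x:cell M K|lebesgue. (f x - w K x) \<bullet> u K x) = J K (u K) - (LINT x:cell M K|lebesgue. w K x \<bullet> u K x)"
    if "w \<in> Wh M k" "u \<in> Wh M k" for w u K
    unfolding J_def inner_diff_left
    by (rule set_integral_diff(2)) (use that int[of "u K" K k] div_free_poly_inner_integrable[OF mesh_cell(2)[OF M, of K], of "w K" k "u K"] in \<open>simp_all add: Wh_iff\<close>)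
  have eq: "(\<forall>u\<in>Wh M k. (\<Sum>K\<in>UNIV. LINT x:cell M K|lebesgue. (f x - w K x) \<bullet> u K x) = 0)
     \<longleftrightarrow> (\<forall>u\<in>Wh M k. \<forall>K. (LINT x:cell M K|lebesgue. w K x \<bullet> u K x) = J K (u K))" if w: "w \<in> Wh M k" for w
  proof
    assume *: "\<forall>u\<in>Wh M k. (\<Sum>K\<in>UNIV. LINT x:cell M K|lebesgue. (f x - w K x) \<bullet> u K x) = 0"
    show "\<forall>u\<in>Wh M k. \<forall>K. (LINT x:cell M K|lebesgue. w K x \<bullet> u K x) = J K (u K)"
    proof (intro ballI allI)
      fix u K assume u: "u \<in> Wh M k"
      define z where "z = (\<lambda>L. if L = K then u K else (\<lambda>x. 0))"
      have z: "z \<in> Wh M k" using u by (simp add: Wh_iff z_def div_free_poly_const)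
      have "(\<Sum>L\<in>UNIV. LINT x:cell M L|lebesgue. (f x - w L x) \<bullet> z L x)
         = (\<Sum>L\<in>{K}. LINT x:cell M L|lebesgue. (f x - w L x) \<bullet> z L x)"
        by (rule sum.mono_neutral_right) (auto simp: z_def)
      hence "(LINT x:cell M K|lebesgue. (f x - w K x) \<bullet> z K x) = 0" using * z by simp
      thus "(LINT x:cell M K|lebesgue. w K x \<bullet> u K x) = J K (u K)"
        using diff[OF w z, of K] by (simp add: z_def)
    qed
  next
    assume *: "\<forall>u\<in>Wh M k. \<forall>K. (LINT x:cell M K|lebesgue. w K x \<bullet> u K x) = J K (u K)"
    show "\<forall>u\<in>Wh M k. (\<Sum>K\<in>UNIV. LINT x:cell M K|lebesgue. (f x - w K x) \<bullet> u K x) = 0"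
      using * diff[OF w] by (intro ballI sum.neutral) simp
  qed
  have "\<exists>!w. w \<in> Wh M k \<and> (\<forall>u\<in>Wh M k. \<forall>K. (LINT x:cell M K|lebesgue. w K x \<bullet> u K x) = J K (u K))"
    by (rule ex1_riesz_Wh[OF M]) (rule J)
  hence "\<exists>!w. w \<in> Wh M k \<and> (\<forall>u\<in>Wh M k. (\<Sum>K\<in>UNIV. LINT x:cell M K|lebesgue. (f x - w K x) \<bullet> u K x) = 0)"
    using eq by (simp cong: conj_cong)
  from theI'[OF this, folded proj_Wh_def]
  have P: "proj_Wh M k f \<in> Wh M k" "\<forall>u\<in>Wh M k. (\<Sum>K\<in>UNIV. LINT x:cell M K|lebesgue. (f x - proj_Wh M k f K x) \<bullet> u K x) = 0"
    by blast+
  show "proj_Wh M k f \<in> Wh M k" by (rule P)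
  have Q: "\<forall>u\<in>Wh M k. \<forall>K. (LINT x:cell M K|lebesgue. proj_Wh M k f K x \<bullet> u K x) = J K (u K)"
    using P eq by blast
  show "(LINT x:cell M K|lebesgue. proj_Wh M k f K x \<bullet> v x) = (LINT x:cell M K|lebesgue. f x \<bullet> v x)"
    if v: "v \<in> div_free_poly (cell M K) k"
  proof -
    define z where "z = (\<lambda>L. if L = K then v else (\<lambda>x. 0))"
    have z: "z \<in> Wh M k" using v by (simp add: Wh_iff z_def div_free_poly_const)
    hence "(LINT x:cell M K|lebesgue. proj_Wh M k f K x \<bullet> z K x) = J K (z K)" using Q by blast
    thus ?thesis by (simp add: z_def J_def)
  qed
qed

lemma set_integral_pos:
  fixes g :: "pt \<Rightarrow> real"
  assumes i: "set_integrable lebesgue X g" and X: "closed X" "negligible (frontier X)" "interior X \<noteq> {}"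
    and g: "\<And>x. x \<in> interior X \<Longrightarrow> g x > 0"
  shows "(LINT x:X|lebesgue. g x) > 0"
proof -
  define h where "h = (\<lambda>x. indicator X x *\<^sub>R g x)"
  have h: "integrable lebesgue h" using i by (simp add: set_integrable_def h_def)
  have "AE x in lebesgue. x \<notin> frontier X"
    using X(2) by (simp add: negligible_iff_null_sets AE_not_in)
  hence "AE x in lebesgue. h x \<ge> 0"
    by eventually_elim (use X(1) g in \<open>auto simp: h_def indicator_def frontier_def intro: less_imp_le\<close>)
  moreover have "\<not> (AE x in lebesgue. h x = 0)"
  proof
    assume "AE x in lebesgue. h x = 0"
    hence "AE x in lebesgue. x \<notin> interior X"
    proof eventually_elim
      case (elim x)
      show ?case
      proof
        assume "x \<in> interior X"
        hence "h x > 0" using g interior_subset[of X] by (auto simp: h_def indicator_def)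
        thus False using elim by simp
      qed
    qed
    hence "interior X \<in> null_sets lebesgue" by (subst (asm) AE_iff_null_sets[symmetric]) auto
    hence "negligible (interior X)" by (simp add: negligible_iff_null_sets)
    thus False using X(3) by (simp add: open_not_negligible)
  qed
  ultimately have "integral\<^sup>L lebesgue h \<noteq> 0" "integral\<^sup>L lebesgue h \<ge> 0"
    using integral_nonneg_eq_0_iff_AE[OF h] integral_nonneg_AE by blast+
  hence "integral\<^sup>L lebesgue h > 0" by simp
  thus ?thesis by (simp add: set_lebesgue_integral_def h_def)
qed

text \<open>Testing with constants shows that the projection has the cell averages of the data. The
  half space functionals are affine and positive on the data in the interior of the cell, hence
  positive on the average.\<close>

lemma proj_Gh_bar:
  fixes M :: "('c::finite) mesh"
  assumes eos: "eos H" and cold: "no_cold_energy H" and M: "valid_mesh M"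
    and f: "f \<in> L2fun (domain M)" "\<And>x. x \<in> domain M \<Longrightarrow> f x \<in> admissible H"
  shows "proj_Wh M k f \<in> Gh_bar H M k"
proof -
  have W: "proj_Wh M k f \<in> Wh M k" by (rule proj_Wh[OF M f(1)])
  have "cell_avg M (proj_Wh M k f) K \<in> admissible H" for K
  proof -
    note C = mesh_cell[OF M, of K]
    define a where "a = cell_avg M (proj_Wh M k f) K"
    have i: "set_integrable lebesgue (cell M K) (proj_Wh M k f K)"
      using div_free_poly_integrable[OF C(2), of "proj_Wh M k f K" k] W by (simp add: Wh_iff)
    have a: "area M K * (a \<bullet> c) = (LINT x:cell M K|lebesgue. f x \<bullet> c)" for c
      using cell_avg_inner[where u = "proj_Wh M k f" and M = M and K = K and c = c, OF i] C(6)
        proj_Wh(2)[where v = "\<lambda>x. c" and K = K and k = k, OF M f(1) div_free_poly_const] by (simp add: a_def)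
    have fi: "set_integrable lebesgue (cell M K) (\<lambda>x. f x \<bullet> c)" for c
      using L2_inner_integrable[OF M f(1) div_free_poly_const[where k = k]] .
    have pos: "area M K * (a \<bullet> c + s) > 0" if "\<And>U. U \<in> admissible H \<Longrightarrow> U \<bullet> c + s > 0" for c s
    proof -
      have si: "set_integrable lebesgue (cell M K) (\<lambda>x. s)"
        by (rule cont_set_integrable[OF C(2)]) auto
      have "(LINT x:cell M K|lebesgue. f x \<bullet> c + s) = area M K * (a \<bullet> c) + (LINT x:cell M K|lebesgue. s)"
        using set_integral_add(2)[OF fi si] a by simp
      also have "(LINT x:cell M K|lebesgue. s) = area M K * s"
        using lmeasurable_compact[OF C(2)] by (simp add: area_def set_lebesgue_integral_def fmeasurable_def)
      finally have "(LINT x:cell M K|lebesgue. f x \<bullet> c + s) = area M K * (a \<bullet> c + s)" by (simp add: distrib_left)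
      moreover have "(LINT x:cell M K|lebesgue. f x \<bullet> c + s) > 0"
        by (rule set_integral_pos[OF set_integral_add(1)[OF fi si] compact_imp_closed[OF C(2)] C(5) C(3)])
          (rule that, rule f(2), rule subsetD[OF mesh_domain(1)[OF M]])
      ultimately show ?thesis by simp
    qed
    have "dens a > 0"
    proof -
      have d: "dens U = U \<bullet> (1, 0, 0, 0)" for U by (simp add: dens_def inner_prod_def)
      have "area M K * (a \<bullet> (1, 0, 0, 0) + 0) > 0"
        by (rule pos, unfold d[symmetric] add_0_right, rule source_bound(3)[OF eos, where w = 0]) auto
      thus ?thesis using C(6) by (simp add: d zero_less_mult_iff)
    qed
    moreover have "a \<bullet> nst w E + pst w E > 0" if "norm w < 1" for w E
      using pos[OF source_bound(2)[OF eos _ that]] C(6) by (simp add: zero_less_mult_iff)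
    ultimately show ?thesis using Gstar_imp_admissible[OF eos cold] by (simp add: Gstar_def a_def)
  qed
  thus ?thesis using W by (simp add: Gh_bar_def)
qed

section \<open>The divergence theorem for polynomials on polygons\<close>

text \<open>A set \<open>S\<close> of reals with finitely many boundary points is traversed from the left: its indicator
  is minus the sum of the signs \<open>\<sigma>\<close> (the outward direction) of the boundary points passed so far.\<close>

locale crossing =
  fixes S Z :: "real set" and \<sigma> :: "real \<Rightarrow> real" and a b :: real
  assumes fin: "finite Z" and S_sub: "S \<subseteq> {a<..<b}" and Z_sub: "Z \<subseteq> {a<..<b}"
    and conn: "\<And>x y. x \<le> y \<Longrightarrow> {x..y} \<inter> Z = {} \<Longrightarrow> x \<in> S \<longleftrightarrow> y \<in> S"
    and sgn: "\<And>z. z \<in> Z \<Longrightarrow> \<sigma> z = 1 \<or> \<sigma> z = -1"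
    and side: "\<And>z. z \<in> Z \<Longrightarrow> eventually (\<lambda>s. z + s * \<sigma> z \<notin> S \<and> z - s * \<sigma> z \<in> S) (at_right 0)"
begin

lemma indicator_eq:
  assumes "x \<notin> Z"
  shows "indicator S x = - (\<Sum>z\<in>{z\<in>Z. z < x}. \<sigma> z)"
  using assms
proof (induction "card {z\<in>Z. z < x}" arbitrary: x rule: less_induct)
  case less
  show ?case
  proof (cases "{z\<in>Z. z < x} = {}")
    case True
    have "{min a x..x} \<inter> Z = {}" using True less.prems by force
    hence "min a x \<in> S \<longleftrightarrow> x \<in> S" by (intro conn) auto
    hence "x \<notin> S" using S_sub by auto
    thus ?thesis using True by (simp only: indicator_simps sum.empty) simp
  next
    case False
    define z where "z = Max {z\<in>Z. z < x}"
    have finx: "finite {z\<in>Z. z < x}" using fin by simp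
    have "z \<in> {z\<in>Z. z < x}" unfolding z_def by (rule Max_in[OF finx False])
    hence z: "z \<in> Z" "z < x" by auto
    have zmax: "y \<le> z" if "y \<in> Z" "y < x" for y unfolding z_def using that finx by (intro Max_ge) auto
    \<comment> \<open>Choose \<open>s\<close> so small that \<open>z\<close> is the only boundary
      point between z - s and z + s, and z + s is still left of \<open>x\<close>. Passing
      \<open>z\<close> changes the indicator by -\<sigma>.\<close>
    have e1: "eventually (\<lambda>s. \<forall>y\<in>{y\<in>Z. y < z}. s < z - y) (at_right 0)"
      using fin by (intro eventually_ball_finite) (auto simp: eventually_at_right_field intro!: exI[of _ "z - y" for y])
    have e2: "eventually (\<lambda>s. s < x - z) (at_right 0)"
      using z by (auto simp: eventually_at_right_field intro!: exI[of _ "x - z"])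
    have e3: "eventually (\<lambda>s. s > 0) (at_right (0::real))" by (rule eventually_at_right_less)
    from e1 e2 e3 side[OF z(1)] have "eventually (\<lambda>s. (\<forall>y\<in>{y\<in>Z. y < z}. s < z - y) \<and> s < x - z \<and> s > 0
       \<and> (z + s * \<sigma> z \<notin> S \<and> z - s * \<sigma> z \<in> S)) (at_right 0)"
      by eventually_elim auto
    hence "\<exists>s. (\<forall>y\<in>{y\<in>Z. y < z}. s < z - y) \<and> s < x - z \<and> s > 0
       \<and> (z + s * \<sigma> z \<notin> S \<and> z - s * \<sigma> z \<in> S)"
      by (rule eventually_happens'[rotated]) simp
    then obtain s where s: "\<And>y. y \<in> Z \<Longrightarrow> y < z \<Longrightarrow> s < z - y" "s < x - z" "s > 0"
       "z + s * \<sigma> z \<notin> S" "z - s * \<sigma> z \<in> S"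
      by blast
    have set1: "{y\<in>Z. y < z - s} = {y\<in>Z. y < z}" using s(1,3) by force
    have set2: "{y\<in>Z. y < x} = insert z {y\<in>Z. y < z}" using z zmax by force
    have nz: "z - s \<notin> Z" using s(1)[of "z - s"] s(3) by auto
    have "indicator S (z - s) = - (\<Sum>y\<in>{y\<in>Z. y < z - s}. \<sigma> y)"
    proof (rule less.hyps[OF _ nz])
      show "card {y\<in>Z. y < z - s} < card {y\<in>Z. y < x}" unfolding set1 set2 using fin by simp
    qed
    hence 1: "indicator S (z - s) = - (\<Sum>y\<in>{y\<in>Z. y < z}. \<sigma> y)" unfolding set1 .
    have "{z + s..x} \<inter> Z = {}"
    proof -
      have "y \<notin> Z" if "y \<in> {z + s..x}" for y
        using zmax[of y] that less.prems s(3) by (cases "y = x") auto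
      thus ?thesis by blast
    qed
    hence "z + s \<in> S \<longleftrightarrow> x \<in> S" using s by (intro conn) auto
    hence 2: "indicator S x = (indicator S (z + s) :: real)" by (simp add: indicator_def)
    have "indicator S (z + s) = indicator S (z - s) - \<sigma> z"
      using sgn[OF z(1)] s(4,5) by (auto simp: indicator_def)
    moreover have "(\<Sum>y\<in>{y\<in>Z. y < x}. \<sigma> y) = \<sigma> z + (\<Sum>y\<in>{y\<in>Z. y < z}. \<sigma> y)"
      unfolding set2 using fin by (subst sum.insert) auto
    ultimately show ?thesis using 1 2 by linarith
  qed
qed

lemma sum_sgn: "(\<Sum>z\<in>Z. \<sigma> z) = 0"
proof -
  have "b \<notin> Z" "b \<notin> S" "{z\<in>Z. z < b} = Z" using S_sub Z_sub by auto
  thus ?thesis using indicator_eq[of b] by simp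
qed

text \<open>By \<open>indicator_eq\<close> the integral is a combination of integrals from a
  boundary point \<open>z\<close> to the common end \<open>b\<close>. The resulting multiples of
  \<open>F b\<close> cancel by \<open>sum_sgn\<close>.\<close>

lemma integral:
  fixes F f :: "real \<Rightarrow> real"
  assumes F: "\<And>x. (F has_field_derivative f x) (at x)" and f: "continuous_on UNIV f"
    and S: "S \<in> sets borel"
  shows "(\<integral>x. indicator S x * f x \<partial>lborel) = (\<Sum>z\<in>Z. \<sigma> z * F z)"
proof -
  have fc: "isCont f x" for x using f by (simp add: continuous_on_eq_continuous_at)
  have I: "integrable lborel (\<lambda>x. indicator {z..b} x * f x)" for z
    using borel_integrable_compact[of "{z..b}" f] continuous_on_subset[OF f] by simp
  have "(\<integral>x. indicator S x * f x \<partial>lborel) = (\<integral>x. (\<Sum>z\<in>Z. - \<sigma> z * (indicator {z..b} x * f x)) \<partial>lborel)"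
  proof (rule integral_cong_AE)
    show "(\<lambda>x. indicator S x * f x) \<in> borel_measurable lborel"
      using S borel_measurable_continuous_onI[OF f] by measurable
    show "(\<lambda>x. \<Sum>z\<in>Z. - \<sigma> z * (indicator {z..b} x * f x)) \<in> borel_measurable lborel"
      using borel_measurable_continuous_onI[OF f] by measurable
    have "AE x in lborel. x \<notin> Z" using fin by (intro AE_not_in finite_imp_null_set_lborel)
    thus "AE x in lborel. indicator S x * f x = (\<Sum>z\<in>Z. - \<sigma> z * (indicator {z..b} x * f x))"
    proof eventually_elim
      case (elim x)
      show ?case
      proof (cases "x \<le> b")
        case True
        have "(\<Sum>z\<in>Z. - \<sigma> z * (indicator {z..b} x * f x)) = (\<Sum>z\<in>{z\<in>Z. z < x}. - \<sigma> z * f x)"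
          by (rule sum.mono_neutral_cong_right) (use fin True elim in \<open>auto simp: indicator_def order_less_le\<close>)
        also have "\<dots> = indicator S x * f x" unfolding indicator_eq[OF elim] by (simp add: sum_distrib_right sum_negf)
        finally show ?thesis ..
      next
        case False
        hence "x \<notin> S" "\<And>z. x \<notin> {z..b}" using S_sub by auto
        thus ?thesis by simp
      qed
    qed
  qed
  also have "\<dots> = (\<Sum>z\<in>Z. - \<sigma> z * (\<integral>x. indicator {z..b} x * f x \<partial>lborel))"
    using I by (subst Bochner_Integration.integral_sum) auto
  also have "\<dots> = (\<Sum>z\<in>Z. - \<sigma> z * (F b - F z))"
  proof (rule sum.cong[OF refl])
    fix z assume "z \<in> Z"
    hence "z \<le> b" using Z_sub by auto
    hence "(\<integral>x. f x * indicator {z..b} x \<partial>lborel) = F b - F z"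
      by (rule integral_FTC_Icc_real) (use F fc in auto)
    thus "- \<sigma> z * (\<integral>x. indicator {z..b} x * f x \<partial>lborel) = - \<sigma> z * (F b - F z)" by (simp add: mult.commute)
  qed
  also have "\<dots> = (\<Sum>z\<in>Z. \<sigma> z * F z) - (\<Sum>z\<in>Z. \<sigma> z) * F b"
    by (simp add: algebra_simps sum_subtractf sum_distrib_left)
  finally show ?thesis by (simp add: sum_sgn)
qed

end

section \<open>Slicing a polygon by lines parallel to an axis\<close>

lemma poly2_partial_continuous:
  assumes "f \<in> poly2 k"
  shows "continuous_on A (partial i f)"
proof -
  obtain c where f: "f = (\<lambda>x. \<Sum>(i, j)\<in>{(i, j). i + j \<le> k}. c i j * x$1 ^ i * x$2 ^ j)"
    using assms unfolding poly2_def by auto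
  define d where "d = (\<lambda>(x::pt) (h::pt). \<Sum>(i, j)\<in>{(i, j). i + j \<le> k}. c i j * (real i * h$1 * x$1 ^ (i - 1)) * x$2 ^ j
     + c i j * x$1 ^ i * (real j * h$2 * x$2 ^ (j - 1)) :: real)"
  have nth: "((\<lambda>x::pt. x$m) has_derivative (\<lambda>h. h$m)) (at x)" for m x
    by (rule bounded_linear_imp_has_derivative[OF bounded_linear_vec_nth])
  have D: "(f has_derivative d x) (at x)" for x
    unfolding f d_def case_prod_unfold
    by (rule has_derivative_sum) (auto intro!: derivative_eq_intros nth simp: algebra_simps)
  have "partial i f x = d x (axis i 1)" for x
    using frechet_derivative_at[OF D] by (simp add: partial_def)
  hence "partial i f = (\<lambda>x. d x (axis i 1))" by auto
  thus ?thesis unfolding d_def case_prod_unfold by (auto intro!: continuous_intros)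
qed

text \<open>Both coordinate directions are treated at once: \<open>i\<close> is the direction of
  integration along a slice, \<open>j\<close> the coordinate that labels the slices.\<close>

lemma vec2_decomp:
  fixes x :: pt assumes "i \<noteq> j"
  shows "x = x$i *\<^sub>R axis i 1 + x$j *\<^sub>R axis j 1" "x \<bullet> y = x$i * y$i + x$j * y$j"
    "(\<forall>m. P m) \<longleftrightarrow> P i \<and> P j"
proof -
  have "(i = 1 \<and> j = 2) \<or> (i = 2 \<and> j = 1)" using assms exhaust_2[of i] exhaust_2[of j] by auto
  thus "x = x$i *\<^sub>R axis i 1 + x$j *\<^sub>R axis j 1" "x \<bullet> y = x$i * y$i + x$j * y$j"
    "(\<forall>m. P m) \<longleftrightarrow> P i \<and> P j"
    by (elim disjE conjE; simp add: vec_eq_iff forall_2 axis_def inner_vec_def sum_2 conj_commute)+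
qed

text \<open>Checked on boxes, which determine Lebesgue measure. It transports the product measure,
  and with it Fubini's theorem, to \<open>pt\<close>, with either coordinate taken first.\<close>

lemma lborel_vec2:
  assumes ij: "i \<noteq> (j::2)"
  shows "(lborel :: pt measure) = distr lborel lborel (\<lambda>(x, y). x *\<^sub>R axis i 1 + y *\<^sub>R axis j 1)"
proof (rule lborel_eqI)
  let ?\<phi> = "\<lambda>(x, y). x *\<^sub>R axis i 1 + y *\<^sub>R axis j 1 :: pt"
  have m: "?\<phi> \<in> borel_measurable borel"
    by (intro borel_measurable_continuous_onI) (auto simp: case_prod_unfold intro!: continuous_intros)
  have B: "(Basis :: pt set) = {axis i 1, axis j 1}"
    unfolding Basis_vec_def using ij exhaust_2[of i] exhaust_2[of j] by (auto simp: UNIV_2)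
  have ax: "axis i (1::real) \<noteq> axis j 1" using ij by (simp add: axis_eq_axis)
  fix l u :: pt assume lu: "\<And>b. b \<in> Basis \<Longrightarrow> l \<bullet> b \<le> u \<bullet> b"
  have le: "l$i \<le> u$i" "l$j \<le> u$j" using lu[of "axis i 1"] lu[of "axis j 1"] by (auto simp: B inner_axis)
  have "?\<phi> -` box l u = box (l$i, l$j) (u$i, u$j)"
  proof -
    have "axis j (1::real) $ i = 0" "axis i (1::real) $ j = 0" using ij by (auto simp: axis_def)
    thus ?thesis by (auto simp: mem_box B inner_axis Basis_prod_def)
  qed
  hence "emeasure (distr lborel lborel ?\<phi>) (box l u) = emeasure lborel (box (l$i, l$j) (u$i, u$j))"
    using m by (subst emeasure_distr) auto
  also have "\<dots> = ennreal ((u$i - l$i) * (u$j - l$j))"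
    using le by (subst emeasure_lborel_box) (auto simp: Basis_prod_def prod.union_disjoint)
  also have "(u$i - l$i) * (u$j - l$j) = (\<Prod>b\<in>Basis. (u - l) \<bullet> b)"
    unfolding B using ax by (simp add: inner_axis)
  finally show "emeasure (distr lborel lborel ?\<phi>) (box l u) = ennreal (\<Prod>b\<in>Basis. (u - l) \<bullet> b)" .
qed simp

lemma set_integral_slices:
  fixes g :: "pt \<Rightarrow> real"
  assumes ij: "i \<noteq> (j::2)" and P: "compact P" and g: "continuous_on UNIV g"
  shows "(LINT x:P|lebesgue. g x) = (\<integral>y. (\<integral>x. indicator P (x *\<^sub>R axis i 1 + y *\<^sub>R axis j 1)
      * g (x *\<^sub>R axis i 1 + y *\<^sub>R axis j 1) \<partial>lborel) \<partial>lborel)" (is ?eq)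
    and "integrable lborel (\<lambda>y. \<integral>x. indicator P (x *\<^sub>R axis i 1 + y *\<^sub>R axis j 1)
      * g (x *\<^sub>R axis i 1 + y *\<^sub>R axis j 1) \<partial>lborel)" (is ?int)
proof -
  let ?\<phi> = "\<lambda>(x, y). x *\<^sub>R axis i 1 + y *\<^sub>R axis j 1 :: pt"
  define h where "h = (\<lambda>x. indicator P x * g x)"
  have m: "?\<phi> \<in> borel_measurable borel"
    by (intro borel_measurable_continuous_onI) (auto simp: case_prod_unfold intro!: continuous_intros)
  have h: "integrable lborel h"
    unfolding h_def using borel_integrable_compact[OF P continuous_on_subset[OF g]] by simp
  hence hm: "h \<in> borel_measurable borel" by auto
  have "integrable (distr lborel lborel ?\<phi>) h" using h by (subst lborel_vec2[OF ij, symmetric])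
  hence "integrable lborel (\<lambda>z. h (?\<phi> z))" using m hm by (subst (asm) integrable_distr_eq) auto
  hence ih: "integrable (lborel \<Otimes>\<^sub>M lborel) (\<lambda>(x, y). h (x *\<^sub>R axis i 1 + y *\<^sub>R axis j 1))"
    by (simp add: lborel_prod case_prod_unfold)
  have "(LINT x:P|lebesgue. g x) = integral\<^sup>L lborel h"
    unfolding set_lebesgue_integral_def h_def[symmetric] real_scaleR_def
    using hm by (intro integral_completion) (auto simp: h_def)
  also have "\<dots> = integral\<^sup>L lborel (\<lambda>z. h (?\<phi> z))"
    by (subst lborel_vec2[OF ij], subst integral_distr) (use m hm in auto)
  also have "\<dots> = integral\<^sup>L (lborel \<Otimes>\<^sub>M lborel) (\<lambda>z. h (?\<phi> z))" by (simp add: lborel_prod)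
  also have "\<dots> = integral\<^sup>L (lborel \<Otimes>\<^sub>M lborel) (\<lambda>(x, y). h (x *\<^sub>R axis i 1 + y *\<^sub>R axis j 1))"
    by (simp add: case_prod_unfold)
  also have "\<dots> = (\<integral>y. (\<integral>x. h (x *\<^sub>R axis i 1 + y *\<^sub>R axis j 1) \<partial>lborel) \<partial>lborel)"
    by (rule lborel_pair.integral_snd[symmetric]) (rule ih)
  finally show ?eq unfolding h_def .
  show ?int using lborel_pair.integrable_snd[OF ih] unfolding h_def .
qed

lemma segm_iff: "x \<in> segm e \<longleftrightarrow> (\<exists>t. 0 \<le> t \<and> t \<le> 1 \<and> x = fst e + t *\<^sub>R (snd e - fst e))"
  unfolding segm_def in_segment by (auto simp: algebra_simps)

lemma open_segm_iff:
  assumes "fst e \<noteq> snd e"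
  shows "x \<in> open_segm e \<longleftrightarrow> (\<exists>t. 0 < t \<and> t < 1 \<and> x = fst e + t *\<^sub>R (snd e - fst e))"
  unfolding open_segm_def in_segment using assms by (auto simp: algebra_simps)

text \<open>A small ball around \<open>z\<close> meets the boundary of \<open>P\<close> only on the
  line through \<open>e\<close>. Each open half ball is connected and free of boundary points, so it
  lies entirely inside or entirely outside; the outward normal settles one side.\<close>

lemma edge_local:
  assumes P: "polygonal_cell P es" and e: "e \<in> es" and n: "outward_unit_normal P e n" and z: "z \<in> open_segm e"
  shows "\<exists>r>0. \<forall>w. norm w < r \<longrightarrow> (w \<bullet> n > 0 \<longrightarrow> z + w \<notin> P) \<and> (w \<bullet> n < 0 \<longrightarrow> z + w \<in> P)"
proof -
  have cP: "closed P" "closure (interior P) = P" and fe: "finite es" "fst e \<noteq> snd e"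
    and fr: "frontier P = (\<Union>e\<in>es. segm e)"
    and dj: "\<And>e'. e' \<in> es \<Longrightarrow> e \<noteq> e' \<Longrightarrow> open_segm e \<inter> segm e' = {}"
    using P e by (auto simp: polygonal_cell_def compact_imp_closed)
  have nd: "norm n = 1" "n \<bullet> (snd e - fst e) = 0" "eventually (\<lambda>s. z + s *\<^sub>R n \<notin> P) (at_right 0)"
    using n z by (auto simp: outward_unit_normal_def)
  have nn: "n \<bullet> n = 1" using nd(1) by (simp add: norm_eq_1)
  define C where "C = (\<Union>e'\<in>es - {e}. segm e')"
  have "closed C" unfolding C_def segm_def using fe by (intro closed_UN) auto
  moreover have "z \<notin> C" using dj z by (auto simp: C_def)
  ultimately obtain r where r: "r > 0" "ball z r \<subseteq> - C"
    using open_contains_ball[of "- C"] by (auto simp: open_Compl)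
  have line: "n \<bullet> x = n \<bullet> z" if x: "x \<in> segm e" for x
  proof -
    obtain t s where "x = fst e + t *\<^sub>R (snd e - fst e)" "z = fst e + s *\<^sub>R (snd e - fst e)"
      using x z unfolding segm_iff open_segm_iff[OF fe(2)] by blast
    thus ?thesis using nd(2) by (simp add: inner_add_right)
  qed
  have frl: "n \<bullet> x = n \<bullet> z" if "x \<in> frontier P" "x \<in> ball z r" for x
  proof -
    have "x \<in> segm e" using that r(2) unfolding fr C_def by blast
    thus ?thesis by (rule line)
  qed
  define Hp where "Hp = ball z r \<inter> {x. n \<bullet> x > n \<bullet> z}"
  define Hm where "Hm = ball z r \<inter> {x. n \<bullet> x < n \<bullet> z}"
  have conn: "connected Hp" "connected Hm"
    unfolding Hp_def Hm_def by (intro convex_connected convex_Int convex_ball convex_halfspace_gt convex_halfspace_lt)+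
  have dfr: "Hp \<inter> frontier P = {}" "Hm \<inter> frontier P = {}"
    using frl unfolding Hp_def Hm_def by fastforce+
  have "eventually (\<lambda>s. z + s *\<^sub>R n \<notin> P \<and> 0 < s \<and> s < r) (at_right 0)"
    using nd(3) r(1) by (intro eventually_conj) (auto simp: eventually_at_right_less eventually_at_right_field)
  from eventually_happens'[OF _ this] obtain s where s: "z + s *\<^sub>R n \<notin> P" "0 < s" "s < r" by auto
  have "z + s *\<^sub>R n \<in> Hp" using s nn nd(1) by (simp add: Hp_def dist_norm inner_add_right)
  hence Hp: "Hp \<inter> P = {}" using connected_Int_frontier[OF conn(1), of P] dfr(1) s(1) by blast
  have zP: "z \<in> closure (interior P)"
  proof -
    have "z \<in> segm e" using z unfolding segm_iff open_segm_iff[OF fe(2)] using less_imp_le by blast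
    hence "z \<in> frontier P" using e fr by blast
    thus ?thesis using cP frontier_subset_closed by blast
  qed
  \<comment> \<open>If the other half ball were outside too, \<open>P\<close> would be contained in
    a line near \<open>z\<close>, contrary to \<open>P\<close> being the closure of its
    interior.\<close>
  have "Hm \<inter> P \<noteq> {}"
  proof
    assume Hm: "Hm \<inter> P = {}"
    have "ball z r \<inter> interior P \<noteq> {}"
      using zP r(1) by (metis Int_commute centre_in_ball closure_iff_nhds_not_empty open_ball order_refl)
    then obtain y where y: "y \<in> ball z r \<inter> interior P" by blast
    have "open (ball z r \<inter> interior P)" by (simp add: open_Int)
    then obtain d where d: "d > 0" "ball y d \<subseteq> ball z r \<inter> interior P" using y open_contains_ball by blast
    have eq: "n \<bullet> x = n \<bullet> z" if "x \<in> ball z r \<inter> interior P" for x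
    proof -
      have "x \<notin> Hp" "x \<notin> Hm" "x \<in> ball z r" using that Hp Hm interior_subset[of P] by blast+
      thus ?thesis unfolding Hp_def Hm_def by auto
    qed
    have "y + (d / 2) *\<^sub>R n \<in> ball y d" using d(1) nd(1) by (simp add: dist_norm)
    hence "n \<bullet> (y + (d / 2) *\<^sub>R n) = n \<bullet> z" using eq d(2) by blast
    moreover have "n \<bullet> y = n \<bullet> z" by (rule eq[OF y])
    ultimately show False using d(1) nn by (simp add: inner_add_right)
  qed
  hence Hm: "Hm \<subseteq> P" using connected_Int_frontier[OF conn(2), of P] dfr(2) by blast
  show ?thesis
  proof (intro exI[of _ r] conjI allI impI r(1))
    fix w :: pt assume w: "norm w < r"
    show "z + w \<notin> P" if "w \<bullet> n > 0"
    proof -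
      have "z + w \<in> Hp" using w that by (simp add: Hp_def dist_norm inner_add_right inner_commute)
      thus ?thesis using Hp by blast
    qed
    show "z + w \<in> P" if "w \<bullet> n < 0"
    proof -
      have "z + w \<in> Hm" using w that by (simp add: Hm_def dist_norm inner_add_right inner_commute)
      thus ?thesis using Hm by blast
    qed
  qed
qed

text \<open>The strict inequalities exclude slices through an end point, which form a null set, and
  edges parallel to the slices.\<close>

definition crosses :: "2 \<Rightarrow> edge \<Rightarrow> real \<Rightarrow> bool" where
  "crosses j e y \<longleftrightarrow> fst e $ j < y \<and> y < snd e $ j \<or> snd e $ j < y \<and> y < fst e $ j"

definition cross_pt :: "2 \<Rightarrow> edge \<Rightarrow> real \<Rightarrow> pt" where
  "cross_pt j e y = fst e + ((y - fst e $ j) / (snd e $ j - fst e $ j)) *\<^sub>R (snd e - fst e)"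

lemma cross_pt_nth: "crosses j e y \<Longrightarrow> cross_pt j e y $ j = y"
  by (auto simp: crosses_def cross_pt_def)

lemma cross_pt_open:
  assumes "crosses j e y" shows "cross_pt j e y \<in> open_segm e"
proof -
  have "0 < (y - fst e $ j) / (snd e $ j - fst e $ j)" "(y - fst e $ j) / (snd e $ j - fst e $ j) < 1"
    using assms by (auto simp: crosses_def zero_less_divide_iff divide_less_eq)
  moreover have "fst e \<noteq> snd e" using assms by (auto simp: crosses_def)
  ultimately show ?thesis by (auto simp: open_segm_iff cross_pt_def)
qed

text \<open>In the plane the unit normal is the direction of the edge turned by a right angle. This
  is the change of measure from arc length on the edge to the slice label.\<close>

lemma normal_nth:
  assumes ij: "i \<noteq> (j::2)" and n: "norm (n::pt) = 1" "n \<bullet> d = 0"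
  shows "\<bar>n$i\<bar> * norm d = \<bar>d$j\<bar>"
proof -
  have nn: "n$i * n$i + n$j * n$j = 1" using n(1) vec2_decomp(2)[OF ij, of n n] by (simp add: norm_eq_1)
  have nd: "n$i * d$i = - (n$j * d$j)" using n(2) vec2_decomp(2)[OF ij, of n d] by simp
  have "(\<bar>n$i\<bar> * norm d)^2 = n$i * n$i * (d$i * d$i + d$j * d$j)"
    by (simp only: power_mult_distrib power2_abs power2_norm_eq_inner vec2_decomp(2)[OF ij, of d d])
       (simp add: power2_eq_square)
  also have "\<dots> = (n$i * d$i) * (n$i * d$i) + n$i * n$i * (d$j * d$j)" by (simp add: algebra_simps)
  also have "\<dots> = (n$i * n$i + n$j * n$j) * (d$j * d$j)" unfolding nd by (simp add: algebra_simps)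
  finally have "(\<bar>n$i\<bar> * norm d)^2 = \<bar>d$j\<bar>^2" unfolding nn by (simp add: power2_eq_square)
  thus ?thesis by (rule power2_eq_imp_eq) auto
qed

text \<open>A slice that avoids all vertices meets the boundary transversally at the crossing points
  of the edges. Leaving the cell there in the positive direction corresponds to a positive normal
  component, so the signs of \<open>crossing\<close> are those of the normal.\<close>

lemma slice_integral:
  assumes ij: "i \<noteq> (j::2)" and P: "polygonal_cell P es" and n: "\<And>e. e \<in> es \<Longrightarrow> outward_unit_normal P e (n e)"
    and f: "f \<in> poly2 k" and y: "\<And>e. e \<in> es \<Longrightarrow> fst e $ j \<noteq> y \<and> snd e $ j \<noteq> y"
  shows "(\<integral>x. indicator P (x *\<^sub>R axis i 1 + y *\<^sub>R axis j 1) * partial i f (x *\<^sub>R axis i 1 + y *\<^sub>R axis j 1) \<partial>lborel)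
    = (\<Sum>e\<in>es. if crosses j e y then sgn (n e $ i) * f (cross_pt j e y) else 0)"
proof -
  have cP: "compact P" and fe: "finite es"
    and fr: "frontier P = (\<Union>e\<in>es. segm e)"
    and dj: "\<And>e e'. e \<in> es \<Longrightarrow> e' \<in> es \<Longrightarrow> e \<noteq> e' \<Longrightarrow> open_segm e \<inter> segm e' = {}"
    using P by (auto simp: polygonal_cell_def)
  define \<phi> where "\<phi> = (\<lambda>x. x *\<^sub>R axis i 1 + y *\<^sub>R axis j 1 :: pt)"
  have axij: "axis j (1::real) $ i = 0" "axis i (1::real) $ j = 0" using ij by (auto simp: axis_def)
  have \<phi>: "\<phi> x $ i = x" "\<phi> x $ j = y" for x by (simp_all add: \<phi>_def axij)
  have \<phi>_eq: "v = \<phi> (v$i)" if "v$j = y" for v using vec2_decomp(1)[OF ij, of v] that by (simp add: \<phi>_def)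
  have \<phi>_cont: "continuous_on A \<phi>" for A unfolding \<phi>_def by (intro continuous_intros)
  define cr where "cr = {e\<in>es. crosses j e y}"
  have cr: "finite cr" using fe by (simp add: cr_def)
  define xe where "xe = (\<lambda>e. cross_pt j e y $ i)"
  have cp: "cross_pt j e y = \<phi> (xe e)" if "e \<in> cr" for e
    unfolding xe_def by (rule \<phi>_eq) (use that cross_pt_nth in \<open>auto simp: cr_def\<close>)
  have op: "\<phi> (xe e) \<in> open_segm e" if "e \<in> cr" for e
    unfolding cp[OF that, symmetric] by (rule cross_pt_open) (use that in \<open>simp add: cr_def\<close>)
  have sub: "open_segm e \<subseteq> segm e" for e unfolding open_segm_def segm_def by (rule segment_open_subset_closed)
  have inj: "inj_on xe cr"
  proof (rule inj_onI, rule ccontr)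
    fix e e' assume *: "e \<in> cr" "e' \<in> cr" "xe e = xe e'" "e \<noteq> e'"
    have "\<phi> (xe e) \<in> open_segm e" "\<phi> (xe e) \<in> segm e'"
      using op[OF *(1)] op[OF *(2)] *(3) subsetD[OF sub, of "\<phi> (xe e)" e'] by simp_all
    thus False using dj[of e e'] * by (auto simp: cr_def)
  qed
  define Z where "Z = xe ` cr"
  define S where "S = {x. \<phi> x \<in> P}"
  \<comment> \<open>Well defined because distinct edges cross the slice at distinct points: an open
    edge is disjoint from every other edge.\<close>
  define \<sigma> where "\<sigma> = (\<lambda>z. sgn (n (the_inv_into cr xe z) $ i))"
  have \<sigma>: "\<sigma> (xe e) = sgn (n e $ i)" if "e \<in> cr" for e
    unfolding \<sigma>_def using the_inv_into_f_f[OF inj that] by simp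
  have nz: "n e $ i \<noteq> 0" if "e \<in> cr" for e
  proof -
    have "\<bar>n e $ i\<bar> * norm (snd e - fst e) = \<bar>(snd e - fst e) $ j\<bar>"
      by (rule normal_nth[OF ij]) (use n that in \<open>auto simp: outward_unit_normal_def cr_def\<close>)
    moreover have "(snd e - fst e) $ j \<noteq> 0" using that by (auto simp: cr_def crosses_def)
    ultimately show ?thesis by auto
  qed
  obtain b where b: "\<And>x. x \<in> P \<Longrightarrow> norm x < b"
    using compact_imp_bounded[OF cP] by (metis bounded_pos_less)
  have S_sub: "S \<subseteq> {-b<..<b}"
  proof
    fix x assume "x \<in> S"
    hence "\<bar>\<phi> x $ i\<bar> < b" using b[of "\<phi> x"] component_le_norm_cart[of "\<phi> x" i] by (simp add: S_def)
    thus "x \<in> {-b<..<b}" by (auto simp: \<phi>)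
  qed
  \<comment> \<open>Since the slice contains no end point, a boundary point on it is interior to its
    edge, and that edge is not parallel to the slice.\<close>
  have frZ: "x \<in> Z" if x: "\<phi> x \<in> frontier P" for x
  proof -
    obtain e where e: "e \<in> es" "\<phi> x \<in> segm e" using x unfolding fr by (rule UN_E)
    then obtain t where t: "0 \<le> t" "t \<le> 1" "\<phi> x = fst e + t *\<^sub>R (snd e - fst e)" by (auto simp: segm_iff)
    define d where "d = (snd e - fst e) $ j"
    have yt: "y = fst e $ j + t * d" using \<phi>(2)[of x] unfolding t(3) by (simp add: d_def)
    have "t \<noteq> 0" "t \<noteq> 1" "d \<noteq> 0" using y[OF e(1)] yt by (auto simp: d_def)
    hence t1: "0 < t" "t < 1" "d \<noteq> 0" using t by auto
    have "0 < t * d \<and> t * d < d \<or> d < t * d \<and> t * d < 0"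
      using t1 by (cases "d > 0") (auto simp: mult_less_cancel_right2 mult_less_0_iff zero_less_mult_iff not_less)
    moreover have "snd e $ j = fst e $ j + d" by (simp add: d_def)
    ultimately have c: "crosses j e y" unfolding crosses_def yt by auto
    have "(y - fst e $ j) / (snd e $ j - fst e $ j) = t" using yt t1 by (simp add: d_def)
    hence "cross_pt j e y = \<phi> x" unfolding cross_pt_def t(3) by simp
    hence "xe e = x" by (simp add: xe_def \<phi>)
    thus ?thesis using c e by (auto simp: Z_def cr_def)
  qed
  have ZS: "Z \<subseteq> S"
  proof
    fix z assume "z \<in> Z"
    then obtain e where "e \<in> cr" "z = xe e" by (auto simp: Z_def)
    hence "\<phi> z \<in> frontier P" using op[of e] sub[of e] fr by (auto simp: cr_def)
    thus "z \<in> S" using frontier_subset_closed[OF compact_imp_closed[OF cP]] by (auto simp: S_def)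
  qed
  interpret crossing S Z \<sigma> "-b" b
  proof
    show "finite Z" using cr by (simp add: Z_def)
    show "S \<subseteq> {-b<..<b}" by fact
    thus "Z \<subseteq> {-b<..<b}" using ZS by blast
    show "x \<in> S \<longleftrightarrow> x' \<in> S" if x: "x \<le> x'" "{x..x'} \<inter> Z = {}" for x x'
    proof -
      have c: "connected (\<phi> ` {x..x'})" by (intro connected_continuous_image \<phi>_cont) simp
      have "\<phi> ` {x..x'} \<inter> frontier P = {}" using frZ x(2) by blast
      hence "\<phi> ` {x..x'} \<inter> P = {} \<or> \<phi> ` {x..x'} \<subseteq> P" using connected_Int_frontier[OF c, of P] by blast
      moreover have "\<phi> x \<in> \<phi> ` {x..x'}" "\<phi> x' \<in> \<phi> ` {x..x'}" using x(1) by auto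
      ultimately show ?thesis unfolding S_def by blast
    qed
    fix z assume "z \<in> Z"
    then obtain e where e: "e \<in> cr" "z = xe e" by (auto simp: Z_def)
    have s: "\<sigma> z = sgn (n e $ i)" using \<sigma> e by simp
    show "\<sigma> z = 1 \<or> \<sigma> z = -1" unfolding s using nz[OF e(1)] by (auto simp: sgn_real_def)
    have "\<exists>r>0. \<forall>w. norm w < r \<longrightarrow> (w \<bullet> n e > 0 \<longrightarrow> \<phi> z + w \<notin> P) \<and> (w \<bullet> n e < 0 \<longrightarrow> \<phi> z + w \<in> P)"
      by (rule edge_local[OF P _ n]) (use e op in \<open>auto simp: cr_def\<close>)
    then obtain r where r: "r > 0" "\<And>w. norm w < r \<Longrightarrow> w \<bullet> n e > 0 \<Longrightarrow> \<phi> z + w \<notin> P"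
      "\<And>w. norm w < r \<Longrightarrow> w \<bullet> n e < 0 \<Longrightarrow> \<phi> z + w \<in> P" by blast
    have "z + s * \<sigma> z \<notin> S \<and> z - s * \<sigma> z \<in> S" if s0: "0 < s" "s < r" for s
    proof -
      have add: "\<phi> (z + c) = \<phi> z + c *\<^sub>R axis i 1" for c by (simp add: \<phi>_def algebra_simps)
      have nw: "norm ((s * \<sigma> z) *\<^sub>R axis i (1::real)) < r" "norm ((- (s * \<sigma> z)) *\<^sub>R axis i (1::real)) < r"
        using s0 nz[OF e(1)] by (auto simp: s abs_mult abs_sgn_eq)
      have pos: "s * \<sigma> z * n e $ i > 0"
        unfolding s using s0 nz[OF e(1)] by (auto simp: sgn_real_def zero_less_mult_iff mult_less_0_iff)
      have "\<phi> (z + s * \<sigma> z) \<notin> P" unfolding add by (rule r(2)[OF nw(1)]) (use pos in \<open>simp add: inner_axis'\<close>)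
      moreover have "\<phi> (z + - (s * \<sigma> z)) \<in> P" unfolding add by (rule r(3)[OF nw(2)]) (use pos in \<open>simp add: inner_axis'\<close>)
      ultimately show ?thesis by (simp add: S_def)
    qed
    thus "eventually (\<lambda>s. z + s * \<sigma> z \<notin> S \<and> z - s * \<sigma> z \<in> S) (at_right 0)"
      using r(1) unfolding eventually_at_right_field by blast
  qed
  have "closed S" unfolding S_def
    using continuous_closed_vimage[OF compact_imp_closed[OF cP], of \<phi>] \<phi>_cont[of UNIV]
    by (simp add: vimage_def continuous_on_eq_continuous_at)
  hence Sb: "S \<in> sets borel" by simp
  have "(\<integral>x. indicator S x * partial i f (\<phi> x) \<partial>lborel) = (\<Sum>z\<in>Z. \<sigma> z * f (\<phi> z))"
  proof (rule integral[OF _ _ Sb])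
    show "((\<lambda>x. f (\<phi> x)) has_field_derivative partial i f (\<phi> x)) (at x)" for x
      using partial_real[OF f, of "y *\<^sub>R axis j 1" i x] by (simp add: \<phi>_def add.commute)
    show "continuous_on UNIV (\<lambda>x. partial i f (\<phi> x))"
      by (rule continuous_on_compose2[OF poly2_partial_continuous[OF f, of UNIV] \<phi>_cont]) auto
  qed
  also have "\<dots> = (\<Sum>e\<in>cr. \<sigma> (xe e) * f (\<phi> (xe e)))" unfolding Z_def by (simp add: sum.reindex[OF inj])
  also have "\<dots> = (\<Sum>e\<in>cr. sgn (n e $ i) * f (cross_pt j e y))" by (rule sum.cong) (simp_all add: \<sigma> cp)
  also have "\<dots> = (\<Sum>e\<in>es. if crosses j e y then sgn (n e $ i) * f (cross_pt j e y) else 0)"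
    unfolding cr_def by (rule sum.inter_filter[OF fe])
  finally show ?thesis unfolding S_def \<phi>_def indicator_def by simp
qed

text \<open>Substitution of y = \<open>fst e $ j + d $ j * t\<close>, with elen * n_i = sgn(n_i)
  |d_j| by \<open>normal_nth\<close>. For an edge parallel to the slices both sides are zero, as
  then n_i = 0.\<close>

lemma edge_integral:
  assumes ij: "i \<noteq> (j::2)" and e: "fst e \<noteq> snd e" and n: "norm n = 1" "n \<bullet> (snd e - fst e) = 0"
    and f: "f \<in> poly2 k"
  shows "has_bochner_integral lborel (\<lambda>y. if crosses j e y then sgn (n $ i) * f (cross_pt j e y) else 0)
    (elen e * n $ i * integral {0..1} (\<lambda>t. f (fst e + t *\<^sub>R (snd e - fst e))))"
proof -
  define d where "d = snd e - fst e"
  define g where "g = (\<lambda>t. f (fst e + t *\<^sub>R d))"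
  have len: "\<bar>n $ i\<bar> * elen e = \<bar>d $ j\<bar>"
    using normal_nth[OF ij n] by (simp add: elen_def dist_norm d_def norm_minus_commute)
  have en: "elen e > 0" using e by (simp add: elen_def)
  show ?thesis
  proof (cases "d $ j = 0")
    case True
    hence "n $ i = 0" using len en by simp
    moreover have "\<not> crosses j e y" for y using True by (auto simp: crosses_def d_def)
    ultimately show ?thesis by (simp add: has_bochner_integral_zero)
  next
    case False
    have gc: "continuous_on A g" for A
      unfolding g_def by (rule continuous_on_compose2[OF poly2_continuous[OF f, of UNIV]]) (auto intro!: continuous_intros)
    have gm: "g \<in> borel_measurable borel" by (rule borel_measurable_continuous_onI[OF gc])
    have gi: "set_integrable lborel {0..1} g" by (rule borel_integrable_atLeastAtMost') (rule gc)
    have "has_bochner_integral lborel (\<lambda>t. indicator {0..1} t * g t) (integral {0..1} g)"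
      using gi set_borel_integral_eq_integral(2)[OF gi]
      by (simp add: has_bochner_integral_iff set_integrable_def set_lebesgue_integral_def)
    moreover have "AE t in lborel. indicator {0..1} t * g t = indicator {0<..<1} t * g t"
    proof -
      have "AE t in lborel. t \<notin> {0, 1::real}" by (intro AE_not_in finite_imp_null_set_lborel) simp
      thus ?thesis by eventually_elim (auto simp: indicator_def)
    qed
    moreover have "(\<lambda>t. indicator {0..1} t * g t) \<in> borel_measurable lborel"
      "(\<lambda>t. indicator {0<..<1} t * g t) \<in> borel_measurable lborel" using gm by measurable
    ultimately have "has_bochner_integral lborel (\<lambda>t. indicator {0<..<1} t * g t) (integral {0..1} g)"
      using has_bochner_integral_cong_AE by blast
    hence "has_bochner_integral lborel (\<lambda>t. sgn (n $ i) * (indicator {0<..<1} t * g t)) (sgn (n $ i) * integral {0..1} g)"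
      by (rule has_bochner_integral_mult_right)
    moreover have "sgn (n $ i) * (indicator {0<..<1} t * g t) =
      (if crosses j e (fst e $ j + d $ j * t) then sgn (n $ i) * f (cross_pt j e (fst e $ j + d $ j * t)) else 0)" for t
    proof -
      have sd: "snd e $ j = fst e $ j + d $ j" by (simp add: d_def)
      have "crosses j e (fst e $ j + d $ j * t) \<longleftrightarrow> 0 < d $ j * t \<and> d $ j * t < d $ j * 1 \<or> d $ j * 1 < d $ j * t \<and> d $ j * t < 0"
        unfolding crosses_def sd by auto
      also have "\<dots> \<longleftrightarrow> 0 < t \<and> t < 1"
      proof (cases "d $ j > 0")
        case True
        thus ?thesis unfolding mult_less_cancel_left zero_less_mult_iff mult_less_0_iff by auto
      next
        case nless: False
        thus ?thesis using False unfolding mult_less_cancel_left zero_less_mult_iff mult_less_0_iff by auto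
      qed
      finally have c: "crosses j e (fst e $ j + d $ j * t) \<longleftrightarrow> 0 < t \<and> t < 1" .
      have "cross_pt j e (fst e $ j + d $ j * t) = fst e + t *\<^sub>R d"
        unfolding cross_pt_def sd using False by (simp add: d_def)
      thus ?thesis unfolding c by (simp add: indicator_def g_def)
    qed
    ultimately have "has_bochner_integral lborel
      (\<lambda>t. if crosses j e (fst e $ j + d $ j * t) then sgn (n $ i) * f (cross_pt j e (fst e $ j + d $ j * t)) else 0)
      (sgn (n $ i) * integral {0..1} g)"
      by simp
    hence A: "has_bochner_integral lborel (\<lambda>y. if crosses j e y then sgn (n $ i) * f (cross_pt j e y) else 0)
       (\<bar>d $ j\<bar> * (sgn (n $ i) * integral {0..1} g))"
      using False by (subst lborel_has_bochner_integral_real_affine_iff[of "d $ j" _ _ "fst e $ j"]) (auto simp flip: mult.assoc)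
    have eq: "\<bar>d $ j\<bar> * (sgn (n $ i) * integral {0..1} g) = elen e * n $ i * integral {0..1} g"
      unfolding len[symmetric] by (simp add: sgn_real_def)
    show ?thesis using A[unfolded eq] unfolding g_def d_def .
  qed
qed

lemma divergence_poly:
  assumes P: "polygonal_cell P es" and n: "\<And>e. e \<in> es \<Longrightarrow> outward_unit_normal P e (n e)" and f: "f \<in> poly2 k"
  shows "(LINT x:P|lebesgue. partial i f x)
    = (\<Sum>e\<in>es. elen e * n e $ i * integral {0..1} (\<lambda>t. f (fst e + t *\<^sub>R (snd e - fst e))))"
proof -
  \<comment> \<open>Arithmetic in the index type \<open>2\<close> is modulo 2, so this is the other
    coordinate.\<close>
  define j :: 2 where "j = i + 1"
  have ij: "i \<noteq> j" by (simp add: j_def)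
  have cP: "compact P" and fe: "finite es" and ne: "\<And>e. e \<in> es \<Longrightarrow> fst e \<noteq> snd e"
    using P by (auto simp: polygonal_cell_def)
  define h where "h = (\<lambda>y. \<Sum>e\<in>es. if crosses j e y then sgn (n e $ i) * f (cross_pt j e y) else 0)"
  define G where "G = (\<lambda>y. \<integral>x. indicator P (x *\<^sub>R axis i 1 + y *\<^sub>R axis j 1) * partial i f (x *\<^sub>R axis i 1 + y *\<^sub>R axis j 1) \<partial>lborel)"
  have hb: "has_bochner_integral lborel h (\<Sum>e\<in>es. elen e * n e $ i * integral {0..1} (\<lambda>t. f (fst e + t *\<^sub>R (snd e - fst e))))"
    unfolding h_def
    by (intro has_bochner_integral_sum edge_integral[OF ij _ _ _ f] ne) (use n in \<open>auto simp: outward_unit_normal_def\<close>)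
  have "(LINT x:P|lebesgue. partial i f x) = (\<integral>y. G y \<partial>lborel)"
    unfolding G_def by (rule set_integral_slices(1)[OF ij cP poly2_partial_continuous[OF f]])
  also have "\<dots> = (\<integral>y. h y \<partial>lborel)"
  proof (rule integral_cong_AE)
    show "h \<in> borel_measurable lborel" using hb by (auto simp: has_bochner_integral_iff)
    show "G \<in> borel_measurable lborel"
      unfolding G_def by (rule borel_measurable_integrable) (rule set_integral_slices(2)[OF ij cP poly2_partial_continuous[OF f]])
    have "AE y in lborel. y \<notin> (\<lambda>e. fst e $ j) ` es \<union> (\<lambda>e. snd e $ j) ` es"
      using fe by (intro AE_not_in finite_imp_null_set_lborel) auto
    thus "AE y in lborel. G y = h y"
      by eventually_elim (unfold G_def h_def, rule slice_integral[OF ij P n f], auto)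
  qed
  finally show ?thesis using hb by (simp add: has_bochner_integral_iff)
qed

section \<open>Preservation of admissibility\<close>

text \<open>The k + 1 Gauss points are exact up to degree 2k + 1, and the trace has degree at most
  k; no quadrature error enters the cancellation of the edge remainders.\<close>

lemma gauss_edge:
  assumes R: "valid_quads M k R" and f: "f \<in> poly2 k"
  shows "integral {0..1} (\<lambda>t. f (fst e + t *\<^sub>R (snd e - fst e))) = (\<Sum>q<k+1. gwt R q * f (edge_pt R e q))"
proof -
  obtain p :: "real poly" where p: "degree p \<le> k" "\<And>t. f (fst e + t *\<^sub>R (snd e - fst e)) = poly p t"
    using poly2_segment[OF f, of "fst e" "snd e - fst e"] by metis
  have "integral {0..1} (poly p) = (\<Sum>q<k+1. gwt R q * poly p (gpt R q))"
    using R p(1) unfolding valid_quads_def gauss_quadrature_def by auto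
  thus ?thesis unfolding p(2) edge_pt_def .
qed

lemma divergence_quad:
  fixes M :: "('c::finite) mesh"
  assumes M: "valid_mesh M" and R: "valid_quads M k R" and f: "f \<in> poly2 k"
  shows "(LINT x:cell M K|lebesgue. partial i f x)
    = (\<Sum>e\<in>edges M K. elen e * (\<Sum>q<k+1. gwt R q * (nrm M K e $ i * f (edge_pt R e q))))"
proof -
  have "(LINT x:cell M K|lebesgue. partial i f x) = (\<Sum>e\<in>edges M K. elen e * nrm M K e $ i * (\<Sum>q<k+1. gwt R q * f (edge_pt R e q)))"
    unfolding gauss_edge[OF R f, symmetric]
    by (rule divergence_poly[OF mesh_cell(1)[OF M] _ f]) (use M in \<open>simp add: valid_mesh_def\<close>)
  thus ?thesis by (simp add: sum_distrib_left mult_ac del: sum.lessThan_Suc)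
qed

text \<open>The divergence theorem for constants. It removes the \<open>pst\<close> part of the edge
  remainder.\<close>

lemma sum_normals:
  fixes M :: "('c::finite) mesh"
  assumes M: "valid_mesh M" and R: "valid_quads M k R"
  shows "(\<Sum>e\<in>edges M K. elen e * (\<Sum>q<k+1. gwt R q * ndot (nrm M K e) w)) = 0"
proof -
  have "(\<Sum>e\<in>edges M K. elen e * (\<Sum>q<k+1. gwt R q * (nrm M K e $ i * c))) = 0" for i and c :: real
    using divergence_quad[OF M R poly2_const[of c k], of K i, symmetric] by (simp add: set_lebesgue_integral_def)
  hence "(\<Sum>e\<in>edges M K. elen e * (\<Sum>q<k+1. gwt R q * (nrm M K e $ 1 * w $ 1)))
    + (\<Sum>e\<in>edges M K. elen e * (\<Sum>q<k+1. gwt R q * (nrm M K e $ 2 * w $ 2))) = 0" by simp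
  thus ?thesis by (simp only: ndot_def distrib_left sum.distrib)
qed

text \<open>The cell-wise divergence constraint in integrated form. It removes the part of the edge
  remainder with the interior magnetic trace.\<close>

lemma sum_normal_mag:
  fixes M :: "('c::finite) mesh"
  assumes M: "valid_mesh M" and R: "valid_quads M k R" and p: "p \<in> div_free_poly (cell M K) k"
  shows "(\<Sum>e\<in>edges M K. elen e * (\<Sum>q<k+1. gwt R q * ndot (nrm M K e) (mag (p (edge_pt R e q))))) = 0"
proof -
  note f = div_free_poly_mag[OF p]
  have i: "set_integrable lebesgue (cell M K) (partial i (\<lambda>y. mag (p y) $ m))" for i m
    by (rule cont_set_integrable[OF mesh_cell(2)[OF M] poly2_partial_continuous[OF f]])
  have "(LINT x:cell M K|lebesgue. partial 1 (\<lambda>y. mag (p y) $ 1) x) + (LINT x:cell M K|lebesgue. partial 2 (\<lambda>y. mag (p y) $ 2) x)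
    = (LINT x:cell M K|lebesgue. partial 1 (\<lambda>y. mag (p y) $ 1) x + partial 2 (\<lambda>y. mag (p y) $ 2) x)"
    by (rule set_integral_add(2)[symmetric]) (rule i)+
  also have "\<dots> = 0"
  proof -
    have "indicator (cell M K) x *\<^sub>R (partial 1 (\<lambda>y. mag (p y) $ 1) x + partial 2 (\<lambda>y. mag (p y) $ 2) x) = (0::real)" for x
      using p by (auto simp: div_free_poly_def indicator_def)
    thus ?thesis unfolding set_lebesgue_integral_def by (simp only: Bochner_Integration.integral_zero)
  qed
  finally show ?thesis
    unfolding divergence_quad[OF M R f] ndot_def distrib_left sum.distrib by simp
qed

section \<open>One forward Euler step\<close>

text \<open>The flux bound for \<open>Ue\<close> is absorbed by the viscosity term, and the one for
  \<open>Ui\<close> adds up with the other half of the viscosity to one copy of the functional. What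
  is left is half the jump of the normal field times \<open>w \<bullet> C\<close>; the source term
  cancels it and leaves half the jump times the quantity bounded in \<open>source_bound\<close>,
  that is, at most \<sigma> times the functional.\<close>

lemma point_ineq:
  assumes eos: "eos H" and Ui: "Ui \<in> admissible H" and Ue: "Ue \<in> admissible H"
    and n: "norm n = 1" and w: "norm w < 1"
  defines "\<sigma> \<equiv> (1/2) * \<bar>ndot n (mag Ui - mag Ue)\<bar> / sqrt (rho_of H Ui * enth_of H Ui)"
  shows "(num_flux H Ui Ue n + ((1/2) * ndot n (mag Ue - mag Ui)) *\<^sub>R source H Ui) \<bullet> nst w C
     < (1 + \<sigma>) * (Ui \<bullet> nst w C + pst w C) - (ndot n w * pst w C - ndot n (mag Ui) * (w \<bullet> C))"
proof -
  define c where "c = nst w C"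
  define s where "s = pst w C"
  define y where "y = w \<bullet> C"
  define r where "r = source H Ui \<bullet> c + y"
  define X where "X = Ui \<bullet> c + s"
  define S where "S = sqrt (rho_of H Ui * enth_of H Ui)"
  define bi where "bi = ndot n (mag Ui)"
  define be where "be = ndot n (mag Ue)"
  have nd: "ndot n (mag Ui - mag Ue) = bi - be" "ndot n (mag Ue - mag Ui) = be - bi"
    by (simp_all add: ndot_def bi_def be_def algebra_simps)
  have r: "\<bar>r\<bar> \<le> X / S" using source_bound(1)[OF eos Ui w, of C] by (simp add: r_def X_def S_def c_def s_def y_def)
  have "\<bar>(be - bi) / 2 * r\<bar> \<le> \<bar>(be - bi) / 2\<bar> * (X / S)"
    unfolding abs_mult by (intro mult_left_mono r) simp
  also have "\<dots> = \<sigma> * X" unfolding \<sigma>_def nd S_def by (simp add: abs_minus_commute)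
  finally have 1: "(be - bi) / 2 * r \<le> \<sigma> * X" by linarith
  have 2: "nflux H n Ui \<bullet> c + ndot n w * s - bi * y < X"
    using admissible_flux_ineq(1)[OF eos Ui w n, of C] by (simp add: c_def s_def y_def bi_def X_def)
  have 3: "nflux H n Ue \<bullet> c + ndot n w * s - be * y < Ue \<bullet> c + s"
    using admissible_flux_ineq(1)[OF eos Ue w n, of C] by (simp add: c_def s_def y_def be_def)
  have "(num_flux H Ui Ue n + ((1/2) * ndot n (mag Ue - mag Ui)) *\<^sub>R source H Ui) \<bullet> c
    = (nflux H n Ui \<bullet> c + nflux H n Ue \<bullet> c - Ue \<bullet> c + Ui \<bullet> c) / 2 + ((be - bi) / 2 * r - (be - bi) / 2 * y)"
    unfolding num_flux_def nd r_def
    by (simp add: inner_add_left inner_diff_left algebra_simps add_divide_distrib diff_divide_distrib)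
  also have "\<dots> < (X - ndot n w * s + bi * y + (s - ndot n w * s + be * y) + Ui \<bullet> c) / 2 + (\<sigma> * X - (be - bi) / 2 * y)"
    using 1 2 3 by argo
  also have "\<dots> = (1 + \<sigma>) * X - (ndot n w * s - bi * y)" unfolding X_def by (simp add: field_simps)
  finally show ?thesis unfolding c_def s_def y_def bi_def X_def .
qed

lemma point_ineq_dens:
  assumes eos: "eos H" and Ui: "Ui \<in> admissible H" and Ue: "Ue \<in> admissible H" and n: "norm n = 1"
  shows "dens (num_flux H Ui Ue n + b *\<^sub>R source H Ui) < dens Ui"
proof -
  have "\<bar>dens (nflux H n Ui)\<bar> < dens Ui" "\<bar>dens (nflux H n Ue)\<bar> < dens Ue"
    using admissible_flux_ineq(2)[OF eos _ _ n, where w = 0] Ui Ue by auto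
  moreover have "dens (source H Ui) = 0" by (simp add: source_def Let_def)
  ultimately show ?thesis by (simp add: num_flux_def state_linear field_simps)
qed

text \<open>Stated for an arbitrary affine functional, so that it covers the half spaces as well as
  the density. Each edge node of the special quadrature pays for the flux through that node; the
  remainders \<open>y\<close> are allowed at single nodes because they cancel in the sum.\<close>

lemma update_pos:
  fixes M :: "('c::finite) mesh"
  assumes M: "valid_mesh M" and R: "valid_quads M k R" and U: "U \<in> Wh M k" and \<tau>: "\<tau> > 0"
    and int: "\<And>q. q < inum R K \<Longrightarrow> U K (ipt R K q) \<bullet> c + s \<ge> 0"
    and ext: "\<And>e q. e \<in> edges M K \<Longrightarrow> q < k + 1 \<Longrightarrow> (let x = edge_pt R e q; n = nrm M K e; Ui = U K x; Ue = trace_ext M U K e x in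
        \<tau> * elen e * gwt R q * ((num_flux H Ui Ue n + ((1/2) * ndot n (mag Ue - mag Ui)) *\<^sub>R source H Ui) \<bullet> c + y e q)
        < area M K * ewt R K e q * (Ui \<bullet> c + s))"
    and y: "(\<Sum>e\<in>edges M K. elen e * (\<Sum>q<k+1. gwt R q * y e q)) = 0"
  shows "(cell_avg M U K + \<tau> *\<^sub>R cell_avg M (Lh H M k R U) K) \<bullet> c + s > 0"
proof -
  define A where "A = area M K"
  have A: "A > 0" using mesh_cell(6)[OF M] by (simp add: A_def)
  note C = mesh_cell[OF M, of K]
  define F where "F = (\<lambda>e q. let x = edge_pt R e q; n = nrm M K e; Ui = U K x; Ue = trace_ext M U K e x in
             (num_flux H Ui Ue n + ((1/2) * ndot n (mag Ue - mag Ui)) *\<^sub>R source H Ui) \<bullet> c)"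
  define X where "X = (\<lambda>e q. U K (edge_pt R e q) \<bullet> c + s)"
  define Y where "Y = (\<lambda>q. U K (ipt R K q) \<bullet> c + s)"
  have FX: "\<tau> * elen e * gwt R q * (F e q + y e q) < A * ewt R K e q * X e q" if "e \<in> edges M K" "q < k + 1" for e q
    using ext[OF that] by (simp add: Let_def F_def X_def A_def)
  have w1: "(\<Sum>e\<in>edges M K. \<Sum>q<k+1. ewt R K e q) + (\<Sum>q<inum R K. iwt R K q) = 1"
    and wp: "\<And>q. q < inum R K \<Longrightarrow> iwt R K q > 0"
    using R unfolding valid_quads_def by blast+
  have UV: "U K \<in> div_free_poly (cell M K) k" using U by (simp add: Wh_iff)
  have avg: "cell_avg M U K \<bullet> c + s = (\<Sum>e\<in>edges M K. \<Sum>q<k+1. ewt R K e q * X e q) + (\<Sum>q<inum R K. iwt R K q * Y q)"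
  proof -
    have "cell_avg M U K \<bullet> c + s = (\<Sum>e\<in>edges M K. \<Sum>q<k+1. ewt R K e q * (U K (edge_pt R e q) \<bullet> c)) + (\<Sum>q<inum R K. iwt R K q * (U K (ipt R K q) \<bullet> c))
       + ((\<Sum>e\<in>edges M K. \<Sum>q<k+1. ewt R K e q) + (\<Sum>q<inum R K. iwt R K q)) * s"
      unfolding cell_avg_quad[where u = U and K = K, OF M R UV] w1 by (simp add: inner_add_left inner_sum_left del: sum.lessThan_Suc)
    thus ?thesis unfolding X_def Y_def by (simp add: distrib_left sum.distrib sum_distrib_right distrib_right del: sum.lessThan_Suc)
  qed
  have L: "A * (cell_avg M (Lh H M k R U) K \<bullet> c) = - (\<Sum>e\<in>edges M K. elen e * (\<Sum>q<k+1. gwt R q * F e q))"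
    unfolding A_def cell_avg_Lh[OF M] F_def ..
  \<comment> \<open>Strictness comes from the edge nodes, so there must be one: without edges the
    boundary would be empty and the cell empty or the whole plane.\<close>
  have ne: "edges M K \<noteq> {}"
  proof
    assume "edges M K = {}"
    hence "frontier (cell M K) = {}" using C(1) by (simp add: polygonal_cell_def)
    hence "cell M K = {} \<or> cell M K = UNIV" by (simp add: frontier_eq_empty)
    thus False using C(2,3) by (auto dest: compact_imp_bounded)
  qed
  have lin: "(\<Sum>e\<in>edges M K. \<Sum>q<k+1. \<tau> * elen e * gwt R q * (F e q + y e q))
    = \<tau> * (\<Sum>e\<in>edges M K. elen e * (\<Sum>q<k+1. gwt R q * F e q)) + \<tau> * (\<Sum>e\<in>edges M K. elen e * (\<Sum>q<k+1. gwt R q * y e q))"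
    by (simp add: sum_distrib_left distrib_left sum.distrib mult.assoc del: sum.lessThan_Suc)
  have "(\<Sum>e\<in>edges M K. \<Sum>q<k+1. \<tau> * elen e * gwt R q * (F e q + y e q)) < (\<Sum>e\<in>edges M K. \<Sum>q<k+1. A * ewt R K e q * X e q)"
    using FX C(4) ne by (intro sum_strict_mono) auto
  also have "\<dots> = A * (\<Sum>e\<in>edges M K. \<Sum>q<k+1. ewt R K e q * X e q)"
    by (simp add: sum_distrib_left mult.assoc del: sum.lessThan_Suc)
  finally have 1: "\<tau> * (\<Sum>e\<in>edges M K. elen e * (\<Sum>q<k+1. gwt R q * F e q)) < A * (\<Sum>e\<in>edges M K. \<Sum>q<k+1. ewt R K e q * X e q)"
    unfolding lin y by simp
  have 2: "A * (\<Sum>q<inum R K. iwt R K q * Y q) \<ge> 0"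
    using A int wp unfolding Y_def by (intro mult_nonneg_nonneg sum_nonneg) (auto intro: less_imp_le)
  have "A * ((cell_avg M U K + \<tau> *\<^sub>R cell_avg M (Lh H M k R U) K) \<bullet> c + s)
    = A * (cell_avg M U K \<bullet> c + s) + \<tau> * (A * (cell_avg M (Lh H M k R U) K \<bullet> c))"
    by (simp add: inner_add_left algebra_simps)
  also have "\<dots> > 0" unfolding avg L using 1 2 by (simp add: distrib_left)
  finally show ?thesis using A by (simp add: zero_less_mult_iff)
qed

lemma edge_pt_shift: "edge_pt R (shift_edge s e) q = edge_pt R e q + s"
  by (simp add: edge_pt_def shift_edge_def)

lemma edge_pt_node: "e \<in> edges M K \<Longrightarrow> q < k + 1 \<Longrightarrow> edge_pt R e q \<in> nodes M k R K"
  unfolding nodes_def special_nodes_def by auto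

lemma update_Gstar:
  fixes M :: "('c::finite) mesh"
  assumes eos: "eos H" and M: "valid_mesh M" and R: "valid_quads M k R" and U: "U \<in> Gh H M k R" and \<tau>: "\<tau> > 0"
    and CFL: "\<And>e q. e \<in> edges M K \<Longrightarrow> q < k + 1 \<Longrightarrow>
      \<tau> * gwt R q * (1 + jump_sigma H M R K e q U) * elen e \<le> ewt R K e q * area M K"
  shows "cell_avg M U K + \<tau> *\<^sub>R cell_avg M (Lh H M k R U) K \<in> Gstar"
proof -
  have UW: "U \<in> Wh M k" and adm: "\<And>K x. x \<in> nodes M k R K \<Longrightarrow> U K x \<in> admissible H"
    using U by (auto simp: Gh_def Gh_bar_def)
  define V where "V = cell_avg M U K + \<tau> *\<^sub>R cell_avg M (Lh H M k R U) K"
  have i: "U K (edge_pt R e q) \<in> admissible H" if "e \<in> edges M K" "q < k + 1" for e q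
    by (rule adm[OF edge_pt_node[OF that]])
  \<comment> \<open>A translated edge keeps the order of its end points and hence its Gauss points.
    The exterior trace is thus taken at a node of the neighbouring cell.\<close>
  have x: "trace_ext M U K e (edge_pt R e q) \<in> admissible H" if "e \<in> edges M K" "q < k + 1" for e q
  proof -
    have "shift_edge (shift M K e) e \<in> edges M (nbr M K e)"
      using M that(1) unfolding valid_mesh_def Let_def by blast
    from adm[OF edge_pt_node[OF this that(2)]] show ?thesis by (simp add: trace_ext_def edge_pt_shift)
  qed
  have inn: "U K (ipt R K q) \<in> admissible H" if "q < inum R K" for q
    by (rule adm) (use that in \<open>auto simp: nodes_def special_nodes_def\<close>)
  have nrm: "norm (nrm M K e) = 1" if "e \<in> edges M K" for e
    using M that by (auto simp: valid_mesh_def outward_unit_normal_def)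
  have lam: "\<tau> * elen e * gwt R q > 0" if "e \<in> edges M K" "q < k + 1" for e q
  proof -
    have "elen e > 0" using mesh_cell(1)[OF M] that(1) by (auto simp: polygonal_cell_def elen_def)
    moreover have "gwt R q > 0" using R that(2) by (auto simp: valid_quads_def gauss_quadrature_def)
    ultimately show ?thesis using \<tau> by simp
  qed
  have sig: "jump_sigma H M R K e q U \<ge> 0" if "e \<in> edges M K" "q < k + 1" for e q
    using source_bound(5)[OF eos i[OF that], of 0] by (simp add: jump_sigma_def Let_def)
  have "V \<bullet> nst w C + pst w C > 0" if w: "norm w < 1" for w C
    unfolding V_def
  proof (rule update_pos[OF M R UW \<tau>, where y = "\<lambda>e q. ndot (nrm M K e) w * pst w C - ndot (nrm M K e) (mag (U K (edge_pt R e q))) * (w \<bullet> C)"])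
    show "U K (ipt R K q) \<bullet> nst w C + pst w C \<ge> 0" if "q < inum R K" for q
      using source_bound(2)[OF eos inn[OF that] w, of C] by simp
    fix e q assume eq: "e \<in> edges M K" "q < k + 1"
    define Ui where "Ui = U K (edge_pt R e q)"
    define Ue where "Ue = trace_ext M U K e (edge_pt R e q)"
    define n where "n = nrm M K e"
    define \<sigma> where "\<sigma> = jump_sigma H M R K e q U"
    define X where "X = Ui \<bullet> nst w C + pst w C"
    define Fc where "Fc = (num_flux H Ui Ue n + ((1/2) * ndot n (mag Ue - mag Ui)) *\<^sub>R source H Ui) \<bullet> nst w C"
    define z where "z = ndot n w * pst w C - ndot n (mag Ui) * (w \<bullet> C)"
    have X: "X > 0" unfolding X_def Ui_def by (rule source_bound(2)[OF eos i[OF eq] w])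
    have "Fc < (1 + \<sigma>) * X - z"
      unfolding Fc_def X_def z_def \<sigma>_def jump_sigma_def Let_def Ui_def[symmetric] Ue_def[symmetric] n_def[symmetric]
      by (rule point_ineq[OF eos _ _ _ w]) (use i x nrm eq in \<open>auto simp: Ui_def Ue_def n_def\<close>)
    hence "\<tau> * elen e * gwt R q * (Fc + z) < \<tau> * elen e * gwt R q * ((1 + \<sigma>) * X)"
      using lam[OF eq] by (intro mult_strict_left_mono) auto
    also have "\<dots> = (\<tau> * gwt R q * (1 + \<sigma>) * elen e) * X" by (simp add: mult_ac)
    also have "\<dots> \<le> (ewt R K e q * area M K) * X"
      using CFL[OF eq] X unfolding \<sigma>_def by (intro mult_right_mono) auto
    finally show "let x = edge_pt R e q; n = nrm M K e; Ui = U K x; Ue = trace_ext M U K e x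
      in \<tau> * elen e * gwt R q * ((num_flux H Ui Ue n + (1 / 2 * ndot n (mag Ue - mag Ui)) *\<^sub>R source H Ui) \<bullet> nst w C +
          (ndot (nrm M K e) w * pst w C - ndot (nrm M K e) (mag (U K (edge_pt R e q))) * (w \<bullet> C)))
         < area M K * ewt R K e q * (Ui \<bullet> nst w C + pst w C)"
      unfolding Let_def Ui_def[symmetric] Ue_def[symmetric] n_def[symmetric] Fc_def[symmetric] z_def[symmetric] X_def[symmetric]
      by (simp only: mult.commute)
  next
    have "(\<Sum>e\<in>edges M K. elen e * (\<Sum>q<k+1. gwt R q * (ndot (nrm M K e) w * pst w C - ndot (nrm M K e) (mag (U K (edge_pt R e q))) * (w \<bullet> C))))
      = (\<Sum>e\<in>edges M K. elen e * (\<Sum>q<k+1. gwt R q * ndot (nrm M K e) w)) * pst w C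
      - (\<Sum>e\<in>edges M K. elen e * (\<Sum>q<k+1. gwt R q * ndot (nrm M K e) (mag (U K (edge_pt R e q))))) * (w \<bullet> C)"
      by (simp add: sum_distrib_left sum_distrib_right sum_subtractf right_diff_distrib mult.assoc del: sum.lessThan_Suc)
    also have "\<dots> = 0"
      unfolding sum_normals[OF M R] sum_normal_mag[OF M R UW[unfolded Wh_iff, rule_format]] by simp
    finally show "(\<Sum>e\<in>edges M K. elen e * (\<Sum>q<k+1. gwt R q * (ndot (nrm M K e) w * pst w C - ndot (nrm M K e) (mag (U K (edge_pt R e q))) * (w \<bullet> C)))) = 0" .
  qed
  moreover have "dens V > 0"
  proof -
    define c :: state where "c = (1, 0, 0, 0)"
    have d: "W \<bullet> c = dens W" for W by (simp add: dens_def inner_prod_def c_def)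
    have "V \<bullet> c + 0 > 0"
      unfolding V_def
    proof (rule update_pos[OF M R UW \<tau>, where y = "\<lambda>e q. 0"])
      show "U K (ipt R K q) \<bullet> c + 0 \<ge> 0" if "q < inum R K" for q
        using source_bound(3)[OF eos inn[OF that], where w = 0] by (simp add: d)
      fix e q assume eq: "e \<in> edges M K" "q < k + 1"
      define Ui where "Ui = U K (edge_pt R e q)"
      define Ue where "Ue = trace_ext M U K e (edge_pt R e q)"
      define n where "n = nrm M K e"
      define \<sigma> where "\<sigma> = jump_sigma H M R K e q U"
      define Fc where "Fc = dens (num_flux H Ui Ue n + ((1/2) * ndot n (mag Ue - mag Ui)) *\<^sub>R source H Ui)"
      have X: "dens Ui > 0" unfolding Ui_def by (rule source_bound(3)[OF eos i[OF eq], where w = 0]) simp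
      have "Fc < dens Ui"
        unfolding Fc_def
        by (rule point_ineq_dens[OF eos]) (use i x nrm eq in \<open>auto simp: Ui_def Ue_def n_def\<close>)
      moreover have "\<sigma> * dens Ui \<ge> 0" using sig[OF eq] X by (simp add: \<sigma>_def)
      ultimately have "Fc < (1 + \<sigma>) * dens Ui" by (simp add: distrib_right)
      hence "\<tau> * elen e * gwt R q * Fc < \<tau> * elen e * gwt R q * ((1 + \<sigma>) * dens Ui)"
        using lam[OF eq] by (intro mult_strict_left_mono) auto
      also have "\<dots> = (\<tau> * gwt R q * (1 + \<sigma>) * elen e) * dens Ui" by (simp add: mult_ac)
      also have "\<dots> \<le> (ewt R K e q * area M K) * dens Ui"
        using CFL[OF eq] X unfolding \<sigma>_def by (intro mult_right_mono) auto
      finally show "let x = edge_pt R e q; n = nrm M K e; Ui = U K x; Ue = trace_ext M U K e x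
        in \<tau> * elen e * gwt R q * ((num_flux H Ui Ue n + (1 / 2 * ndot n (mag Ue - mag Ui)) *\<^sub>R source H Ui) \<bullet> c + 0)
           < area M K * ewt R K e q * (Ui \<bullet> c + 0)"
        unfolding Let_def Ui_def[symmetric] Ue_def[symmetric] n_def[symmetric] d Fc_def[symmetric] add_0_right
        by (simp only: mult.commute)
    qed simp
    thus ?thesis by (simp add: d)
  qed
  ultimately show ?thesis by (simp add: Gstar_def V_def)
qed

section \<open>Runge-Kutta stages\<close>

lemma convex_sum_pos:
  fixes f :: "'i \<Rightarrow> real"
  assumes "finite I" "\<And>i. i \<in> I \<Longrightarrow> a i \<ge> 0" "sum a I = 1" "\<And>i. i \<in> I \<Longrightarrow> f i > 0"
  shows "(\<Sum>i\<in>I. a i * f i) > 0"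
proof -
  obtain i where i: "i \<in> I" "a i \<noteq> 0" using assms(3) by (metis sum.neutral zero_neq_one)
  show ?thesis
    by (rule sum_pos2[OF assms(1) i(1)]) (use assms i in \<open>auto simp: less_le\<close>)
qed

lemma Gstar_convex_sum:
  assumes I: "finite I" "\<And>i. i \<in> I \<Longrightarrow> a i \<ge> 0" "sum a I = 1" and G: "\<And>i. i \<in> I \<Longrightarrow> U i \<in> Gstar"
  shows "(\<Sum>i\<in>I. a i *\<^sub>R U i) \<in> Gstar"
proof -
  have "dens (\<Sum>i\<in>I. a i *\<^sub>R U i) > 0"
    unfolding linear_sum[OF dens_lin] using convex_sum_pos[OF I, of "\<lambda>i. dens (U i)"] G
    by (simp add: state_linear Gstar_def)
  moreover have "(\<Sum>i\<in>I. a i *\<^sub>R U i) \<bullet> nst w C + pst w C > 0" if w: "norm w < 1" for w C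
  proof -
    have "(\<Sum>i\<in>I. a i * (U i \<bullet> nst w C + pst w C)) > 0"
      by (rule convex_sum_pos[OF I]) (use G w in \<open>auto simp: Gstar_def\<close>)
    moreover have "(\<Sum>i\<in>I. a i * pst w C) = pst w C" using I(3) by (simp flip: sum_distrib_right)
    ultimately show ?thesis by (simp add: inner_sum_left distrib_left sum.distrib)
  qed
  ultimately show ?thesis by (simp add: Gstar_def)
qed

lemma div_free_poly_sum:
  assumes "finite I" "\<And>i. i \<in> I \<Longrightarrow> f i \<in> div_free_poly X k"
  shows "(\<lambda>x. \<Sum>i\<in>I. c i *\<^sub>R f i x) \<in> div_free_poly X k"
  using assms
proof (induction I rule: finite_induct)
  case empty
  show ?case by (simp add: div_free_poly_const)
next
  case (insert i I)
  have "(\<lambda>x. (\<Sum>i\<in>I. c i *\<^sub>R f i x) + c i *\<^sub>R f i x) \<in> div_free_poly X k" by (rule div_free_poly_lin) (use insert in auto)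
  thus ?case using insert by (simp add: add.commute)
qed

text \<open>The average of a stage is a convex combination of averages after forward Euler steps
  with different step sizes, and the half spaces define a convex set.\<close>

lemma stage_Gh_bar:
  fixes M :: "('c::finite) mesh" and i :: nat
  assumes eos: "eos H" and cold: "no_cold_energy H" and M: "valid_mesh M" and R: "valid_quads M k R"
    and V: "\<And>l. l < i \<Longrightarrow> V l \<in> Gh H M k R" and \<alpha>: "\<And>l. l < i \<Longrightarrow> \<alpha> l \<ge> 0" "(\<Sum>l<i. \<alpha> l) = 1"
    and \<tau>: "\<And>l. l < i \<Longrightarrow> \<tau> l \<ge> 0"
    and CFL: "\<And>l K e q. l < i \<Longrightarrow> \<tau> l > 0 \<Longrightarrow> e \<in> edges M K \<Longrightarrow> q < k + 1 \<Longrightarrow>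
      \<tau> l * gwt R q * (1 + jump_sigma H M R K e q (V l)) * elen e \<le> ewt R K e q * area M K"
  shows "(\<lambda>K x. \<Sum>l<i. \<alpha> l *\<^sub>R (V l K x + \<tau> l *\<^sub>R Lh H M k R (V l) K x)) \<in> Gh_bar H M k"
proof -
  define X where "X = (\<lambda>K x. \<Sum>l<i. \<alpha> l *\<^sub>R (V l K x + \<tau> l *\<^sub>R Lh H M k R (V l) K x))"
  have VW: "V l K \<in> div_free_poly (cell M K) k" if "l < i" for l K using V[OF that] by (auto simp: Gh_def Gh_bar_def Wh_iff)
  have LW: "Lh H M k R (V l) K \<in> div_free_poly (cell M K) k" for l K using Lh_Wh(1)[OF M] by (auto simp: Wh_iff)
  have T: "(\<lambda>x. V l K x + \<tau> l *\<^sub>R Lh H M k R (V l) K x) \<in> div_free_poly (cell M K) k" if "l < i" for l K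
    by (rule div_free_poly_lin[OF VW[OF that] LW])
  have XW: "X K \<in> div_free_poly (cell M K) k" for K
    unfolding X_def by (rule div_free_poly_sum) (use T in auto)
  have "cell_avg M X K \<in> Gstar" for K
  proof -
    obtain I :: "(edge \<times> nat + nat) set" and W Y where pr: "positive_rule M k R K I W Y"
      using ex_positive_rule[OF M R] by blast
    have avg: "cell_avg M u K = (\<Sum>i\<in>I. W i *\<^sub>R u K (Y i))" if "u K \<in> div_free_poly (cell M K) k" for u
      using positive_ruleD(5)[OF pr that] cell_avg_local[of M u K] by simp
    have "cell_avg M X K = (\<Sum>m\<in>I. W m *\<^sub>R (\<Sum>l<i. \<alpha> l *\<^sub>R (V l K (Y m) + \<tau> l *\<^sub>R Lh H M k R (V l) K (Y m))))"
      unfolding avg[where u = X, OF XW] by (simp add: X_def)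
    also have "\<dots> = (\<Sum>l<i. \<alpha> l *\<^sub>R (\<Sum>m\<in>I. W m *\<^sub>R (V l K (Y m) + \<tau> l *\<^sub>R Lh H M k R (V l) K (Y m))))"
      unfolding scaleR_sum_right scaleR_left_commute[of "W _" "\<alpha> _"] by (rule sum.swap)
    also have "\<dots> = (\<Sum>l<i. \<alpha> l *\<^sub>R (cell_avg M (V l) K + \<tau> l *\<^sub>R cell_avg M (Lh H M k R (V l)) K))"
    proof (rule sum.cong[OF refl])
      fix l assume "l \<in> {..<i}"
      hence l: "l < i" by simp
      have "(\<Sum>m\<in>I. W m *\<^sub>R (V l K (Y m) + \<tau> l *\<^sub>R Lh H M k R (V l) K (Y m)))
        = (\<Sum>m\<in>I. W m *\<^sub>R V l K (Y m)) + \<tau> l *\<^sub>R (\<Sum>m\<in>I. W m *\<^sub>R Lh H M k R (V l) K (Y m))"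
        unfolding scaleR_add_right sum.distrib scaleR_sum_right scaleR_left_commute[of "W _" "\<tau> _"] ..
      thus "\<alpha> l *\<^sub>R (\<Sum>m\<in>I. W m *\<^sub>R (V l K (Y m) + \<tau> l *\<^sub>R Lh H M k R (V l) K (Y m)))
        = \<alpha> l *\<^sub>R (cell_avg M (V l) K + \<tau> l *\<^sub>R cell_avg M (Lh H M k R (V l)) K)"
        unfolding avg[where u = "V l", OF VW[OF l]] avg[where u = "Lh H M k R (V l)", OF LW] by simp
    qed
    also have "\<dots> \<in> Gstar"
    proof (rule Gstar_convex_sum)
      fix l assume "l \<in> {..<i}"
      hence l: "l < i" by simp
      show "cell_avg M (V l) K + \<tau> l *\<^sub>R cell_avg M (Lh H M k R (V l)) K \<in> Gstar"
      \<comment> \<open>A vanishing coefficient carries no time step restriction; the Euler step is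
        then the admissible average itself.\<close>
      proof (cases "\<tau> l = 0")
        case True
        have "cell_avg M (V l) K \<in> admissible H" using V[OF l] by (simp add: Gh_def Gh_bar_def)
        thus ?thesis using True admissible_imp_Gstar[OF eos] by simp
      next
        case False
        hence t: "\<tau> l > 0" using \<tau>[OF l] by simp
        show ?thesis by (rule update_Gstar[OF eos M R V[OF l] t]) (rule CFL[OF l t])
      qed
    qed (use \<alpha> in auto)
    finally show ?thesis .
  qed
  thus ?thesis using XW Gstar_imp_admissible[OF eos cold] unfolding X_def[symmetric] by (auto simp: Gh_bar_def Wh_iff)
qed

theorem theorem4p10:
  fixes H :: "real \<Rightarrow> real \<Rightarrow> real"
    and M :: "('c::finite) mesh"
    and R :: "'c quads"
    and k Nr :: nat
    and eps :: "'c dgfun \<Rightarrow> real"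
    and U0 :: "pt \<Rightarrow> state"
    and \<alpha> \<beta> :: "nat \<Rightarrow> nat \<Rightarrow> real"
    and \<Delta>t :: "nat \<Rightarrow> real"
    and U :: "nat \<Rightarrow> 'c dgfun"
    and V :: "nat \<Rightarrow> nat \<Rightarrow> 'c dgfun"
  assumes eos: "eos H"
    and cold: "no_cold_energy H"
    and mesh: "valid_mesh M"
    and quads: "valid_quads M k R"
    and eps: "eps_rule H M k eps"
    and stages: "Nr \<ge> 1"
    and alpha_nonneg: "\<And>i l. 1 \<le> i \<Longrightarrow> i \<le> Nr \<Longrightarrow> l < i \<Longrightarrow> \<alpha> i l \<ge> 0"
    and beta_nonneg: "\<And>i l. 1 \<le> i \<Longrightarrow> i \<le> Nr \<Longrightarrow> l < i \<Longrightarrow> \<beta> i l \<ge> 0"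
    and alpha_sum: "\<And>i. 1 \<le> i \<Longrightarrow> i \<le> Nr \<Longrightarrow> (\<Sum>l<i. \<alpha> i l) = 1"
    and dt_pos: "\<And>n. \<Delta>t n > 0"
    and U0_L2: "U0 \<in> L2fun (domain M)"
    and U0_adm: "\<And>x. x \<in> domain M \<Longrightarrow> U0 x \<in> admissible H"
    and init: "U 0 = limiter M k R eps (proj_Wh M k U0)"
    and stage_0: "\<And>n. V n 0 = U n"
    and stage_i: "\<And>n i. 1 \<le> i \<Longrightarrow> i \<le> Nr \<Longrightarrow>
           V n i = limiter M k R eps
             (\<lambda>K x. \<Sum>l<i. \<alpha> i l *\<^sub>R (V n l K x + (\<beta> i l * \<Delta>t n) *\<^sub>R Lh H M k R (V n l) K x))"
    and step: "\<And>n. U (Suc n) = V n Nr"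
    and CFL: "\<And>n i l K e q. 1 \<le> i \<Longrightarrow> i \<le> Nr \<Longrightarrow> l < i \<Longrightarrow> \<beta> i l \<noteq> 0 \<Longrightarrow>
           e \<in> edges M K \<Longrightarrow> q < k + 1 \<Longrightarrow>
           \<Delta>t n \<le> ewt R K e q * area M K /
             (\<beta> i l * gwt R q * (1 + jump_sigma H M R K e q (V n l)) * elen e)"
  shows "\<forall>n. U n \<in> Gh H M k R"
proof -
  have stageV: "V n i \<in> Gh H M k R" if Un: "U n \<in> Gh H M k R" and i: "i \<le> Nr" for n i
    using i
  proof (induction i rule: less_induct)
    case (less i)
    show ?case
    proof (cases "i = 0")
      case True
      thus ?thesis using Un by (simp add: stage_0)
    next
      case False
      hence i: "1 \<le> i" "i \<le> Nr" using less.prems by auto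
      have "(\<lambda>K x. \<Sum>l<i. \<alpha> i l *\<^sub>R (V n l K x + (\<beta> i l * \<Delta>t n) *\<^sub>R Lh H M k R (V n l) K x)) \<in> Gh_bar H M k"
      proof (rule stage_Gh_bar[OF eos cold mesh quads])
        show "V n l \<in> Gh H M k R" if "l < i" for l using less that i by simp
        show "(\<Sum>l<i. \<alpha> i l) = 1" by (rule alpha_sum[OF i])
        fix l assume l: "l < i"
        show "\<alpha> i l \<ge> 0" by (rule alpha_nonneg[OF i l])
        show "\<beta> i l * \<Delta>t n \<ge> 0" using beta_nonneg[OF i l] dt_pos[of n] by simp
        fix K e q assume pos: "\<beta> i l * \<Delta>t n > 0" and eq: "e \<in> edges M K" "q < k + 1"
        have b: "\<beta> i l > 0" using pos beta_nonneg[OF i l] by (cases "\<beta> i l = 0") auto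
        have Vl: "V n l \<in> Gh H M k R" using less l i by simp
        \<comment> \<open>Admissibility of the stage at the node makes \<open>jump_sigma\<close>
          nonnegative, so the denominator in the time step restriction is positive and can be
          cleared.\<close>
        have "V n l K (edge_pt R e q) \<in> admissible H"
          using Vl edge_pt_node[OF eq] by (auto simp: Gh_def)
        from source_bound(5)[OF eos this, of 0] have "jump_sigma H M R K e q (V n l) \<ge> 0"
          by (simp add: jump_sigma_def Let_def)
        moreover have "elen e > 0" using mesh_cell(1)[OF mesh] eq(1) by (auto simp: polygonal_cell_def elen_def)
        moreover have "gwt R q > 0" using quads eq(2) by (auto simp: valid_quads_def gauss_quadrature_def)
        ultimately have "\<beta> i l * gwt R q * (1 + jump_sigma H M R K e q (V n l)) * elen e > 0" using b by simp
        thus "\<beta> i l * \<Delta>t n * gwt R q * (1 + jump_sigma H M R K e q (V n l)) * elen e \<le> ewt R K e q * area M K"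
          using CFL[OF i l _ eq, of n] b by (simp add: pos_le_divide_eq mult_ac)
      qed
      from limiter_Gh[OF eos cold mesh quads eps this] show ?thesis unfolding stage_i[OF i] .
    qed
  qed
  have "U n \<in> Gh H M k R" for n
  proof (induction n)
    case 0
    show ?case unfolding init
      by (rule limiter_Gh[OF eos cold mesh quads eps proj_Gh_bar[OF eos cold mesh U0_L2 U0_adm]])
  next
    case (Suc n)
    thus ?case unfolding step by (intro stageV) auto
  qed
  thus ?thesis by blast
qed

end
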